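(* Let $q\in\mathbb{C}$ with $0<|q|<1$. Let $f$ be holomorphic in $|z|<R$, where $R>1$, let $a,b,c,d\in\mathbb{C}$ be such that no denominator below vanishes, and assume \[ \left|\frac{aq}{bcd}\right|<R. \] Then \begin{align*} &\sum_{n=0}^{\infty}\frac{(1-aq^{2n})(a,b,c,d;q)_n}{(q,aq/b,aq/c,aq/d;q)_n}\left(\frac{aq}{bcd}\right)^n\sum_{k=0}^n\frac{(q^{-n},aq^n;q)_k}{(q;q)_k}f(q^k)q^k\\ &\quad=\frac{(a,b,c,d,aq/bc,aq/bd,aq/cd;q)_\infty}{(aq/b,aq/c,aq/d,aq/bcd,bcd/a,q;q)_\infty}\int_{aq/bcd}^1\frac{(bcdt/a,tq;q)_\infty}{(bt,ct,dt;q)_\infty}f(t)\,d_qt . \end{align*} For fixed $f$, both sides are meromorphic in $a,b,c,d$ on the region $|aq/bcd|<R$, away from their poles.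
   Context: For $a\in\mathbb{C}$ and $n\in\{0,1,2,\ldots\}\cup\{\infty\}$, $(a;q)_n=\prod_{j=0}^{n-1}(1-aq^j)$ and $(a_1,\ldots,a_r;q)_n=\prod_{i=1}^r(a_i;q)_n$. The Jackson $q$-integral (without the conventional factor $1-q$) is \[ \int_u^v g(t)\,d_qt:=\sum_{n=0}^{\infty}\bigl(vq^n g(vq^n)-uq^n g(uq^n)\bigr), \] whenever the series converges. Expressions such as $aq/bcd$ mean $aq/(bcd)$. Double sums are understood as iterated sums, with the terminating inner sum evaluated first. *)

theory Defs
  imports "HOL-Complex_Analysis.Complex_Analysis"
begin

definition qpoch :: "complex \<Rightarrow> complex \<Rightarrow> nat \<Rightarrow> complex" where
  "qpoch q a n = (\<Prod>j<n. 1 - a * q ^ j)"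

definition qpoch_inf :: "complex \<Rightarrow> complex \<Rightarrow> complex" where
  "qpoch_inf q a = (\<Prod>j. 1 - a * q ^ j)"

definition qpochs :: "complex \<Rightarrow> complex list \<Rightarrow> nat \<Rightarrow> complex" where
  "qpochs q as n = (\<Prod>a\<leftarrow>as. qpoch q a n)"

definition qpochs_inf :: "complex \<Rightarrow> complex list \<Rightarrow> complex" where
  "qpochs_inf q as = (\<Prod>a\<leftarrow>as. qpoch_inf q a)"

(* The Jackson integral is normalised without the conventional factor 1 - q. *)

definition jackson_term ::
    "complex \<Rightarrow> complex \<Rightarrow> complex \<Rightarrow> (complex \<Rightarrow> complex) \<Rightarrow> nat \<Rightarrow> complex" where
  "jackson_term q u v g n = v * q ^ n * g (v * q ^ n) - u * q ^ n * g (u * q ^ n)"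

definition jackson_integrable ::
    "complex \<Rightarrow> complex \<Rightarrow> complex \<Rightarrow> (complex \<Rightarrow> complex) \<Rightarrow> bool" where
  "jackson_integrable q u v g \<longleftrightarrow> summable (jackson_term q u v g)"

definition jackson_integral ::
    "complex \<Rightarrow> complex \<Rightarrow> complex \<Rightarrow> (complex \<Rightarrow> complex) \<Rightarrow> complex" where
  "jackson_integral q u v g = (\<Sum>n. jackson_term q u v g n)"

definition lhs_term ::
    "complex \<Rightarrow> (complex \<Rightarrow> complex) \<Rightarrow> complex \<Rightarrow> complex \<Rightarrow> complex \<Rightarrow> complex \<Rightarrow> nat \<Rightarrow> complex" where
  "lhs_term q f a b c d n =
     (1 - a * q ^ (2 * n)) * qpochs q [a, b, c, d] n
       / qpochs q [q, a * q / b, a * q / c, a * q / d] n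
     * (a * q / (b * c * d)) ^ n
     * (\<Sum>k = 0..n. qpochs q [q powi (- int n), a * q ^ n] k / qpochs q [q] k
          * f (q ^ k) * q ^ k)"

definition integrand ::
    "complex \<Rightarrow> (complex \<Rightarrow> complex) \<Rightarrow> complex \<Rightarrow> complex \<Rightarrow> complex \<Rightarrow> complex \<Rightarrow> complex \<Rightarrow> complex" where
  "integrand q f a b c d t =
     qpochs_inf q [b * c * d * t / a, t * q] / qpochs_inf q [b * t, c * t, d * t] * f t"

definition rhs ::
    "complex \<Rightarrow> (complex \<Rightarrow> complex) \<Rightarrow> complex \<Rightarrow> complex \<Rightarrow> complex \<Rightarrow> complex \<Rightarrow> complex" where
  "rhs q f a b c d =
     qpochs_inf q [a, b, c, d, a * q / (b * c), a * q / (b * d), a * q / (c * d)]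
       / qpochs_inf q [a * q / b, a * q / c, a * q / d, a * q / (b * c * d), b * c * d / a, q]
     * jackson_integral q (a * q / (b * c * d)) 1 (integrand q f a b c d)"

(* Every denominator occurring in lhs_term and rhs is nonzero.  The integrand is only
   evaluated at the nodes q^n and (aq/bcd) q^n of the Jackson integral. *)

definition denominators_nonzero ::
    "complex \<Rightarrow> complex \<Rightarrow> complex \<Rightarrow> complex \<Rightarrow> complex \<Rightarrow> bool" where
  "denominators_nonzero q a b c d \<longleftrightarrow>
     a \<noteq> 0 \<and> b \<noteq> 0 \<and> c \<noteq> 0 \<and> d \<noteq> 0 \<and>
     (\<forall>n. qpochs q [q, a * q / b, a * q / c, a * q / d] n \<noteq> 0) \<and>
     qpochs_inf q [a * q / b, a * q / c, a * q / d, a * q / (b * c * d), b * c * d / a, q] \<noteq> 0 \<and>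
     (\<forall>n. \<forall>t \<in> {q ^ n, a * q / (b * c * d) * q ^ n}. qpochs_inf q [b * t, c * t, d * t] \<noteq> 0)"

(* Holomorphy in several variables: the real Frechet derivative is complex linear.
   Intended for open S. *)

definition sev_holomorphic_on ::
    "(complex ^ 'n \<Rightarrow> complex) \<Rightarrow> (complex ^ 'n) set \<Rightarrow> bool" (infixl "sev'_holomorphic'_on" 50) where
  "F sev_holomorphic_on S \<longleftrightarrow>
     (\<forall>x\<in>S. \<exists>L. (F has_derivative L) (at x) \<and> (\<forall>k v. L (k *s v) = k * L v))"

(* Meromorphy in several variables: locally a quotient of holomorphic functions whose
   denominator does not vanish identically.  Values on the zero set of the denominator
   are irrelevant, since F is a total function that may take arbitrary values at poles. *)

definition sev_meromorphic_on ::
    "(complex ^ 'n \<Rightarrow> complex) \<Rightarrow> (complex ^ 'n) set \<Rightarrow> bool" (infixl "sev'_meromorphic'_on" 50) where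
  "F sev_meromorphic_on S \<longleftrightarrow>
     (\<forall>p\<in>S. \<exists>U G H. open U \<and> connected U \<and> p \<in> U \<and> U \<subseteq> S \<and>
        G sev_holomorphic_on U \<and> H sev_holomorphic_on U \<and> (\<exists>x\<in>U. H x \<noteq> 0) \<and>
        (\<forall>x\<in>U. H x \<noteq> 0 \<longrightarrow> F x = G x / H x))"

(* Points are (a, b, c, d).  All four coordinates are nonzero because both aq/bcd and
   bcd/a occur in the identity. *)

definition param_region :: "complex \<Rightarrow> real \<Rightarrow> (complex ^ 4) set" where
  "param_region q R =
     {p. p $ 1 \<noteq> 0 \<and> p $ 2 \<noteq> 0 \<and> p $ 3 \<noteq> 0 \<and> p $ 4 \<noteq> 0 \<and>
         norm (p $ 1 * q / (p $ 2 * p $ 3 * p $ 4)) < R}"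

definition pole_free_region :: "complex \<Rightarrow> real \<Rightarrow> (complex ^ 4) set" where
  "pole_free_region q R =
     {p \<in> param_region q R. denominators_nonzero q (p $ 1) (p $ 2) (p $ 3) (p $ 4)}"

definition lhs_fun :: "complex \<Rightarrow> (complex \<Rightarrow> complex) \<Rightarrow> complex ^ 4 \<Rightarrow> complex" where
  "lhs_fun q f p = (\<Sum>n. lhs_term q f (p $ 1) (p $ 2) (p $ 3) (p $ 4) n)"

definition rhs_fun :: "complex \<Rightarrow> (complex \<Rightarrow> complex) \<Rightarrow> complex ^ 4 \<Rightarrow> complex" where
  "rhs_fun q f p = rhs q f (p $ 1) (p $ 2) (p $ 3) (p $ 4)"

end

theory Submission
  imports Defs
begin

text \<open>
  Write \<open>(x)\<^sub>n\<close> and \<open>(x)\<^sub>\<infinity>\<close> for the finite and infinite \<open>q\<close>-shifted factorials, \<open>u = aq/(bcd)\<close> and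
  \<open>s = bc/a\<close>, so that \<open>q/u = sd\<close>.  Multiplication by
  \<open>(aq/b)\<^sub>\<infinity> (aq/c)\<^sub>\<infinity> (aq/d)\<^sub>\<infinity> (u)\<^sub>\<infinity> (q/u)\<^sub>\<infinity> (q)\<^sub>\<infinity>\<close>
  removes every denominator from the identity: the left-hand side becomes \<open>series_fun\<close> times
  \<open>(u)\<^sub>\<infinity> (q/u)\<^sub>\<infinity> (q)\<^sub>\<infinity>\<close>, the right-hand side becomes \<open>nodes_fun\<close>, and both are holomorphic on the
  whole region \<open>|u| < R\<close>, since they are locally uniformly convergent series of holomorphic functions
  (\<open>sev_holomorphic_on_suminf\<close>).  This gives meromorphy of the original sides and holomorphy
  away from the poles; what remains is that the difference of the cleared sides, the \<open>defect\<close>, is zero.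

  The series converges up to \<open>|u| = R\<close> because the inner sum decays like \<open>r\<^sup>-\<^sup>n\<close> for
  every \<open>r < R\<close>.  It equals \<open>(aq\<^sup>n)\<^sub>\<infinity>\<close> times a \<open>q\<close>-difference of order \<open>n\<close> of
  \<open>f(t) / (aq\<^sup>n t)\<^sub>\<infinity>\<close>, and by the finite \<open>q\<close>-binomial theorem such a difference annihilates \<open>t\<^sup>m\<close>
  for \<open>m < n\<close>; the Cauchy estimates bound the other Taylor coefficients (\<open>inner_sum_bound\<close>).

  For the vanishing of the defect, fix \<open>a, b, c\<close> in general position and let \<open>z = 1/d\<close> vary in a
  punctured disc around \<open>0\<close>.  At \<open>d = q\<^sup>-\<^sup>N\<close> all sums terminate, and comparison of the
  coefficients of \<open>f(q\<^sup>k)\<close> is a shifted instance of the terminating very-well-poised \<open>6\<phi>5\<close> sum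
  (\<open>terminating_6phi5\<close>, \<open>terminating_coefficient\<close>, \<open>defect_terminating\<close>).  These points accumulate
  only at \<open>z = 0\<close>, which is a singular point: the zeros \<open>z = s q\<^sup>j\<close> of the factor \<open>(s/z)\<^sub>\<infinity> = (q/u)\<^sub>\<infinity>\<close> accumulate
  there too.  At those zeros the two families of nodes \<open>q\<^sup>n\<close> and \<open>u q\<^sup>n\<close> of the Jackson integral overlap and
  cancel, so that the defect vanishes (\<open>defect_lattice\<close>); as the zeros are simple, the defect is \<open>(s/z)\<^sub>\<infinity>\<close>
  times a holomorphic function \<open>h\<close> on the punctured disc.  On the circles \<open>|z| = |s| |q|\<^sup>M\<^sup>-\<^sup>1\<^sup>/\<^sup>2\<close>, which run
  midway between the zeros, \<open>h\<close> grows at most like a power of \<open>1/|z|\<close> (\<open>defect_circle_bound\<close>).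
  By the maximum principle \<open>h\<close> has at worst a pole at \<open>0\<close>, and since \<open>h(q\<^sup>N) = 0\<close> for all large \<open>N\<close>
  it is zero (\<open>holomorphic_punctured_eq_0\<close>).  The excluded values of \<open>a\<close> form a countable set, and
  continuity in \<open>a\<close> covers them (\<open>defect_eq_0\<close>).
\<close>

no_notation fps_nth (infixl \<open>$\<close> 75)

section \<open>Holomorphic functions of several complex variables\<close>

lemma norm_vector_smult_complex: "norm (k *s v) = norm k * norm (v :: complex ^ 'n)"
  by (simp add: norm_vec_def L2_set_def norm_mult power_mult_distrib real_sqrt_mult flip: sum_distrib_left)

lemma mult_right_eq_mult: "(\<lambda>w. w * c) = (*) (c :: complex)"
  by (simp add: fun_eq_iff mult.commute)

lemma sev_holomorphic_onI:
  assumes "\<And>x. x \<in> S \<Longrightarrow> (F has_derivative L x) (at x)"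
    and "\<And>x k v. x \<in> S \<Longrightarrow> L x (k *s v) = k * L x v"
  shows "F sev_holomorphic_on S"
  using assms unfolding sev_holomorphic_on_def by blast

lemma sev_holomorphic_onE:
  assumes "F sev_holomorphic_on S"
  obtains L where "\<And>x. x \<in> S \<Longrightarrow> (F has_derivative L x) (at x)"
    "\<And>x k v. x \<in> S \<Longrightarrow> L x (k *s v) = k * L x v"
  using assms unfolding sev_holomorphic_on_def by metis

lemma sev_holomorphic_on_subset:
  "F sev_holomorphic_on S \<Longrightarrow> T \<subseteq> S \<Longrightarrow> F sev_holomorphic_on T"
  unfolding sev_holomorphic_on_def by blast

lemma sev_holomorphic_on_isCont: "F sev_holomorphic_on S \<Longrightarrow> x \<in> S \<Longrightarrow> isCont F x"
  unfolding sev_holomorphic_on_def using has_derivative_continuous by blast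

lemma sev_holomorphic_on_imp_continuous_on: "F sev_holomorphic_on S \<Longrightarrow> continuous_on S F"
  by (simp add: continuous_at_imp_continuous_on sev_holomorphic_on_isCont)

lemma sev_holomorphic_on_transform:
  assumes "F sev_holomorphic_on S" "open S" "\<And>x. x \<in> S \<Longrightarrow> F x = G x"
  shows "G sev_holomorphic_on S"
  using assms unfolding sev_holomorphic_on_def
  by (metis has_derivative_transform_within_open)

named_theorems sev_intros

lemma sev_holomorphic_on_const [sev_intros]: "(\<lambda>x. c) sev_holomorphic_on S"
  by (rule sev_holomorphic_onI[where L = "\<lambda>_ _. 0"]) auto

lemma sev_holomorphic_on_nth [sev_intros]: "(\<lambda>x. x $ i) sev_holomorphic_on S"
  by (rule sev_holomorphic_onI[where L = "\<lambda>_ v. v $ i"])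
     (auto intro: bounded_linear_imp_has_derivative bounded_linear_vec_nth)

lemma sev_holomorphic_on_add [sev_intros]:
  assumes "F sev_holomorphic_on S" "G sev_holomorphic_on S"
  shows "(\<lambda>x. F x + G x) sev_holomorphic_on S"
proof -
  obtain L where L: "\<And>x. x \<in> S \<Longrightarrow> (F has_derivative L x) (at x)"
    "\<And>x k v. x \<in> S \<Longrightarrow> L x (k *s v) = k * L x v" using sev_holomorphic_onE[OF assms(1)] by blast
  obtain L' where L': "\<And>x. x \<in> S \<Longrightarrow> (G has_derivative L' x) (at x)"
    "\<And>x k v. x \<in> S \<Longrightarrow> L' x (k *s v) = k * L' x v" using sev_holomorphic_onE[OF assms(2)] by blast
  show ?thesis
    by (rule sev_holomorphic_onI[where L = "\<lambda>x v. L x v + L' x v"])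
       (auto intro!: has_derivative_add L(1) L'(1) simp: L(2) L'(2) distrib_left)
qed

lemma sev_holomorphic_on_mult [sev_intros]:
  assumes "F sev_holomorphic_on S" "G sev_holomorphic_on S"
  shows "(\<lambda>x. F x * G x) sev_holomorphic_on S"
proof -
  obtain L where L: "\<And>x. x \<in> S \<Longrightarrow> (F has_derivative L x) (at x)"
    "\<And>x k v. x \<in> S \<Longrightarrow> L x (k *s v) = k * L x v" using sev_holomorphic_onE[OF assms(1)] by blast
  obtain L' where L': "\<And>x. x \<in> S \<Longrightarrow> (G has_derivative L' x) (at x)"
    "\<And>x k v. x \<in> S \<Longrightarrow> L' x (k *s v) = k * L' x v" using sev_holomorphic_onE[OF assms(2)] by blast
  show ?thesis
    by (rule sev_holomorphic_onI[where L = "\<lambda>x v. F x * L' x v + L x v * G x"])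
       (auto intro!: has_derivative_mult L(1) L'(1) simp: L(2) L'(2) distrib_left mult.left_commute)
qed

lemma sev_holomorphic_on_compose:
  assumes F: "F sev_holomorphic_on S" and g: "g holomorphic_on T" "open T" "\<And>x. x \<in> S \<Longrightarrow> F x \<in> T"
  shows "(\<lambda>x. g (F x)) sev_holomorphic_on S"
proof -
  obtain L where L: "\<And>x. x \<in> S \<Longrightarrow> (F has_derivative L x) (at x)"
    "\<And>x k v. x \<in> S \<Longrightarrow> L x (k *s v) = k * L x v" using sev_holomorphic_onE[OF F] by blast
  show ?thesis
  proof (rule sev_holomorphic_onI[where L = "\<lambda>x v. deriv g (F x) * L x v"])
    fix x assume x: "x \<in> S"
    have "(g has_field_derivative deriv g (F x)) (at (F x))"
      using g x by (metis holomorphic_derivI)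
    then show "((\<lambda>x. g (F x)) has_derivative (\<lambda>v. deriv g (F x) * L x v)) (at x)"
      unfolding has_field_derivative_def by (intro has_derivative_compose[OF L(1)[OF x]])
  qed (simp add: L(2))
qed

lemma sev_holomorphic_on_diff [sev_intros]:
  assumes "F sev_holomorphic_on S" "G sev_holomorphic_on S"
  shows "(\<lambda>x. F x - G x) sev_holomorphic_on S"
  using sev_holomorphic_on_add[OF assms(1) sev_holomorphic_on_mult[OF sev_holomorphic_on_const[of "-1"] assms(2)]]
  by simp

lemma sev_holomorphic_on_divide [sev_intros]:
  assumes "F sev_holomorphic_on S" "G sev_holomorphic_on S" "\<And>x. x \<in> S \<Longrightarrow> G x \<noteq> 0"
  shows "(\<lambda>x. F x / G x) sev_holomorphic_on S"
proof -
  have "inverse holomorphic_on - {0::complex}" by (intro holomorphic_intros) auto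
  then have "(\<lambda>x. inverse (G x)) sev_holomorphic_on S"
    by (rule sev_holomorphic_on_compose[OF assms(2)]) (use assms(3) in auto)
  then show ?thesis using sev_holomorphic_on_mult[OF assms(1)] by (simp add: divide_inverse)
qed

lemma sev_holomorphic_on_power [sev_intros]:
  assumes "F sev_holomorphic_on S"
  shows "(\<lambda>x. F x ^ n) sev_holomorphic_on S"
  by (rule sev_holomorphic_on_compose[OF assms, where T = UNIV]) (auto intro: holomorphic_intros)

lemma sev_holomorphic_on_prod [sev_intros]:
  "(\<And>i. i \<in> A \<Longrightarrow> F i sev_holomorphic_on S) \<Longrightarrow> (\<lambda>x. \<Prod>i\<in>A. F i x) sev_holomorphic_on S"
  by (induction A rule: infinite_finite_induct) (auto intro!: sev_intros)

lemma sev_holomorphic_on_sum [sev_intros]: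
  "(\<And>i. i \<in> A \<Longrightarrow> F i sev_holomorphic_on S) \<Longrightarrow> (\<lambda>x. \<Sum>i\<in>A. F i x) sev_holomorphic_on S"
  by (induction A rule: infinite_finite_induct) (auto intro!: sev_intros)

text \<open>
  Restriction to a holomorphic curve is how facts in one variable are applied to functions of several:
  below, only the last parameter moves, along \<open>z \<mapsto> (a, b, c, 1/z)\<close>.
\<close>

lemma sev_holomorphic_on_curve:
  fixes F :: "complex ^ 'n \<Rightarrow> complex"
  assumes F: "F sev_holomorphic_on S" and g: "\<And>i. g i holomorphic_on D" "open D"
    and sub: "\<And>z. z \<in> D \<Longrightarrow> (\<chi> i. g i z) \<in> S"
  shows "(\<lambda>z. F (\<chi> i. g i z)) holomorphic_on D"
proof -
  obtain L where L: "\<And>x. x \<in> S \<Longrightarrow> (F has_derivative L x) (at x)"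
    "\<And>x k v. x \<in> S \<Longrightarrow> L x (k *s v) = k * L x v" using sev_holomorphic_onE[OF F] by blast
  show ?thesis unfolding holomorphic_on_open[OF g(2)]
  proof (intro ballI exI)
    fix z assume z: "z \<in> D"
    define v where "v = (\<chi> i. deriv (g i) z)"
    have "((\<lambda>z. \<chi> i. g i z) has_derivative (\<lambda>w. w *s v)) (at z)"
    proof (subst has_derivative_componentwise_within, intro ballI)
      fix b :: "complex ^ 'n" assume "b \<in> Basis"
      then obtain i u where b: "b = axis i u" by (auto simp: Basis_vec_def)
      have "(g i has_derivative (\<lambda>w. deriv (g i) z * w)) (at z)"
        using holomorphic_derivI[OF g(1) g(2) z, of i] by (simp add: has_field_derivative_def)
      then have "((\<lambda>z. g i z \<bullet> u) has_derivative (\<lambda>w. (deriv (g i) z * w) \<bullet> u)) (at z)"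
        by (rule has_derivative_inner_left)
      then show "((\<lambda>z. (\<chi> i. g i z) \<bullet> b) has_derivative (\<lambda>w. (w *s v) \<bullet> b)) (at z)"
        by (simp add: b inner_axis v_def mult.commute)
    qed
    from has_derivative_compose[OF this L(1)[OF sub[OF z]]]
    show "((\<lambda>z. F (\<chi> i. g i z)) has_field_derivative L (\<chi> i. g i z) v) (at z)"
      unfolding has_field_derivative_def L(2)[OF sub[OF z]] by (simp only: mult_right_eq_mult)
  qed
qed

text \<open>
  The derivative in direction \<open>v\<close> is the derivative at \<open>0\<close> of the one-variable function
  \<open>z \<mapsto> F(x + zv)\<close>, which is holomorphic on the disc of radius \<open>e / |v|\<close>; the Cauchy inequality on
  that disc gives the bound.
\<close>

lemma Cauchy_directional_bound:
  fixes F :: "complex ^ 'n \<Rightarrow> complex"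
  assumes F: "F sev_holomorphic_on S" and x: "cball x e \<subseteq> S" "e > 0"
    and bd: "\<And>y. y \<in> cball x e \<Longrightarrow> norm (F y) \<le> M"
    and D: "(F has_derivative L) (at x)" and lin: "\<And>k v. L (k *s v) = k * L v"
  shows "norm (L v) \<le> M * norm v / e"
proof (cases "v = 0")
  case True
  then show ?thesis using lin[of 0 0] by simp
next
  case False
  define r where "r = e / norm v"
  have r: "r > 0" using False x by (simp add: r_def)
  define g where "g z = F (\<chi> i. x $ i + z * v $ i)" for z
  have eq: "(\<chi> i. x $ i + z * v $ i) = x + z *s v" for z by (simp add: vec_eq_iff)
  have in_S: "(\<chi> i. x $ i + z * v $ i) \<in> cball x e" if "z \<in> cball 0 r" for z
    using that False by (simp add: eq dist_norm norm_vector_smult_complex r_def field_simps)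
  have "g field_differentiable at z" if z: "z \<in> cball 0 r" for z
  proof -
    obtain L' where L': "(F has_derivative L') (at (x + z *s v))" "\<And>k v. L' (k *s v) = k * L' v"
      using F in_S[OF z] x(1) unfolding sev_holomorphic_on_def eq by blast
    have "((\<lambda>z. x + z *s v) has_derivative (\<lambda>w. w *s v)) (at z)"
    proof (rule has_derivative_eq_rhs)
      show "((\<lambda>z. x + z *s v) has_derivative (\<lambda>w. 0 + w *s v)) (at z)"
        by (intro has_derivative_add has_derivative_const bounded_linear_imp_has_derivative
              bounded_linearI'[where 'a = complex])
           (auto simp: vec_eq_iff algebra_simps)
    qed simp
    from has_derivative_compose[OF this L'(1)] have "(g has_field_derivative L' v) (at z)"
      unfolding has_field_derivative_def L'(2) g_def eq by (simp only: mult_right_eq_mult)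
    then show ?thesis by (auto simp: field_differentiable_def)
  qed
  then have holo: "g holomorphic_on cball 0 r"
    by (auto simp: holomorphic_on_def intro: field_differentiable_at_within)
  have "norm ((deriv ^^ 1) g 0) \<le> fact 1 * M / r ^ 1"
  proof (rule Cauchy_inequality)
    show "g holomorphic_on ball 0 r" by (rule holomorphic_on_subset[OF holo]) auto
    show "continuous_on (cball 0 r) g" by (rule holomorphic_on_imp_continuous_on[OF holo])
    show "norm (g z) \<le> M" if "norm (0 - z) = r" for z
      unfolding g_def using that by (intro bd in_S) auto
  qed (rule r)
  moreover have "deriv g 0 = L v"
  proof (rule DERIV_imp_deriv)
    have "((\<lambda>z. x + z *s v) has_derivative (\<lambda>w. w *s v)) (at 0)"
    proof (rule has_derivative_eq_rhs)
      show "((\<lambda>z. x + z *s v) has_derivative (\<lambda>w. 0 + w *s v)) (at 0)"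
        by (intro has_derivative_add has_derivative_const bounded_linear_imp_has_derivative
              bounded_linearI'[where 'a = complex])
           (auto simp: vec_eq_iff algebra_simps)
    qed simp
    from has_derivative_compose[OF this, of F L] D show "(g has_field_derivative L v) (at 0)"
      unfolding has_field_derivative_def g_def eq by (simp add: mult_right_eq_mult lin)
  qed
  ultimately show ?thesis by (simp add: r_def field_simps)
qed

text \<open>
  A Weierstrass M-test in several variables.  The bounds for the terms on a ball yield,
  through \<open>Cauchy_directional_bound\<close>, proportional bounds for the derivatives on the ball of half the
  radius, so the series may be differentiated term by term, and complex linearity passes to the sum of
  the derivatives.
\<close>

theorem sev_holomorphic_on_suminf:
  fixes t :: "nat \<Rightarrow> complex ^ 'n \<Rightarrow> complex"
  assumes S: "open S" and t: "\<And>n. t n sev_holomorphic_on S"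
    and bd: "\<And>p. p \<in> S \<Longrightarrow> \<exists>M. summable M \<and> (\<forall>\<^sub>F x in nhds p. \<forall>n. norm (t n x) \<le> M n)"
  shows "(\<lambda>x. \<Sum>n. t n x) sev_holomorphic_on S"
  unfolding sev_holomorphic_on_def
proof
  fix p assume p: "p \<in> S"
  obtain M where M: "summable M" and ev: "\<forall>\<^sub>F x in nhds p. \<forall>n. norm (t n x) \<le> M n"
    using bd[OF p] by blast
  have "\<forall>\<^sub>F x in nhds p. x \<in> S \<and> (\<forall>n. norm (t n x) \<le> M n)"
    using ev eventually_nhds_in_open[OF S p] by eventually_elim auto
  then obtain e' where e': "e' > 0" "\<And>x. dist x p < e' \<Longrightarrow> x \<in> S \<and> (\<forall>n. norm (t n x) \<le> M n)"
    unfolding eventually_nhds_metric by blast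
  define e where "e = e' / 2"
  have e: "e > 0" using e' by (simp add: e_def)
  obtain L where L: "\<And>n x. x \<in> S \<Longrightarrow> (t n has_derivative L n x) (at x)"
    "\<And>n x k v. x \<in> S \<Longrightarrow> L n x (k *s v) = k * L n x v"
    using t unfolding sev_holomorphic_on_def by metis
  have near: "cball x e \<subseteq> ball p e'" if "x \<in> ball p e" for x
  proof
    fix y assume "y \<in> cball x e"
    then show "y \<in> ball p e'" using that dist_triangle[of p y x] by (simp add: e_def)
  qed
  have in_S: "x \<in> S" if "x \<in> ball p e'" for x using e'(2)[of x] that by (simp add: dist_commute)
  have Mb: "norm (t n x) \<le> M n" if "x \<in> ball p e'" for n x using e'(2)[of x] that by (simp add: dist_commute)
  have sub: "ball p e \<subseteq> ball p e'" using e by (intro subset_ball) (simp add: e_def)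
  have Lb: "norm (L n x v) \<le> M n * norm v / e" if x: "x \<in> ball p e" for n x v
    by (rule Cauchy_directional_bound[OF t[of n] _ e _ L(1) L(2)])
       (use near[OF x] in_S Mb sub x in \<open>blast+\<close>)
  have sM: "summable (\<lambda>n. M n * c)" for c by (rule summable_mult2[OF M])
  have sL: "summable (\<lambda>n. L n x v)" if x: "x \<in> ball p e" for x v
    by (rule summable_comparison_test'[where N = 0 and g = "\<lambda>n. M n * (norm v / e)"])
       (use sM[of "norm v / e"] Lb[OF x] in auto)
  have "\<exists>g. \<forall>x\<in>ball p e. (\<lambda>n. t n x) sums g x \<and>
          (g has_derivative (\<lambda>v. \<Sum>n. L n x v)) (at x within ball p e)"
  proof (rule has_derivative_series[where f' = L and x = p])
    show "(t n has_derivative L n x) (at x within ball p e)" if "x \<in> ball p e" for n x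
      using L(1) in_S sub that by (blast intro: has_derivative_at_withinI)
    show "\<forall>\<^sub>F n in sequentially. \<forall>x\<in>ball p e. \<forall>h.
             norm ((\<Sum>i<n. L i x h) - (\<Sum>i. L i x h)) \<le> \<epsilon> * norm h" if "\<epsilon> > 0" for \<epsilon>
    proof -
      have "\<forall>\<^sub>F n in sequentially. norm (\<Sum>i. M (i + n)) < \<epsilon> * e"
        using suminf_exist_split[OF _ M, of "\<epsilon> * e"] that e by (auto simp: eventually_sequentially)
      then show ?thesis
      proof eventually_elim
        case (elim n)
        show ?case
        proof (intro ballI allI)
          fix x h assume x: "x \<in> ball p e"
          have "norm ((\<Sum>i<n. L i x h) - (\<Sum>i. L i x h)) = norm (\<Sum>i. L (i + n) x h)"
            using suminf_minus_initial_segment[OF sL[OF x, of h], of n]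
            by (simp add: norm_minus_commute)
          also have "\<dots> \<le> (\<Sum>i. M (i + n) * (norm h / e))"
            by (rule norm_suminf_le)
               (use Lb[OF x] summable_ignore_initial_segment[OF sM[of "norm h / e"], of n] in auto)
          also have "\<dots> = (\<Sum>i. M (i + n)) * (norm h / e)"
            by (rule suminf_mult2[symmetric]) (rule summable_ignore_initial_segment[OF M])
          also have "\<dots> \<le> \<epsilon> * e * (norm h / e)"
            using elim e by (intro mult_right_mono) auto
          finally show "norm ((\<Sum>i<n. L i x h) - (\<Sum>i. L i x h)) \<le> \<epsilon> * norm h"
            using e by simp
        qed
      qed
    qed
    show "(\<lambda>n. t n p) sums (\<Sum>n. t n p)"
      by (intro summable_sums summable_comparison_test'[OF M, of 0] Mb) (use e' in auto)
  qed (use e in auto)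
  then obtain g where g: "\<And>x. x \<in> ball p e \<Longrightarrow> (\<lambda>n. t n x) sums g x"
    "\<And>x. x \<in> ball p e \<Longrightarrow> (g has_derivative (\<lambda>v. \<Sum>n. L n x v)) (at x within ball p e)" by blast
  have pe: "p \<in> ball p e" using e by simp
  have "(g has_derivative (\<lambda>v. \<Sum>n. L n p v)) (at p)"
    using g(2)[OF pe] at_within_open[OF pe] by simp
  then have "((\<lambda>x. \<Sum>n. t n x) has_derivative (\<lambda>v. \<Sum>n. L n p v)) (at p)"
    by (rule has_derivative_transform_within_open[OF _ open_ball pe]) (use g(1) in \<open>auto simp: sums_unique\<close>)
  moreover have "(\<Sum>n. L n p (k *s v)) = k * (\<Sum>n. L n p v)" for k v
    using L(2)[OF p] suminf_mult[OF sL[OF pe], of k v] by simp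
  ultimately show "\<exists>L. ((\<lambda>x. \<Sum>n. t n x) has_derivative L) (at p) \<and> (\<forall>k v. L (k *s v) = k * L v)" by blast
qed

section \<open>Finite and infinite q-shifted factorials\<close>

locale q_in_disc =
  fixes q :: complex
  assumes q_pos: "0 < norm q" and q_lt_1: "norm q < 1"
begin

lemma q_nonzero [simp]: "q \<noteq> 0"
  using q_pos by auto

lemma norm_q_power_le_1: "norm q ^ n \<le> 1"
  using q_lt_1 by (intro power_le_one) auto

lemma q_power_neq_1: "n > 0 \<Longrightarrow> q ^ n \<noteq> 1"
proof
  assume "n > 0" "q ^ n = 1"
  then have "norm q ^ n = 1" by (metis norm_one norm_power)
  moreover have "norm q ^ n < 1" using \<open>n > 0\<close> q_lt_1 by (simp add: power_Suc_less_one power_less_one_iff)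
  ultimately show False by simp
qed

lemma qpoch_0 [simp]: "qpoch q a 0 = 1"
  by (simp add: qpoch_def)

lemma qpoch_Suc: "qpoch q a (Suc n) = qpoch q a n * (1 - a * q ^ n)"
  by (simp add: qpoch_def)

lemma qpoch_add: "qpoch q a (m + n) = qpoch q a m * qpoch q (a * q ^ m) n"
  by (induction n) (simp_all add: qpoch_Suc power_add mult_ac)

lemma qpoch_Suc_left: "qpoch q a (Suc n) = (1 - a) * qpoch q (a * q) n"
  using qpoch_add[of a 1 n] by (simp add: qpoch_Suc)

lemma qpoch_eq_0_iff: "qpoch q a n = 0 \<longleftrightarrow> (\<exists>j<n. a * q ^ j = 1)"
  by (auto simp: qpoch_def)

lemma qpoch_q_nonzero [simp]: "qpoch q q n \<noteq> 0"
  using q_power_neq_1 by (force simp: qpoch_eq_0_iff simp flip: power_Suc)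

lemma sum_norm_q_power_le: "(\<Sum>j<n. norm q ^ j) \<le> 1 / (1 - norm q)"
proof -
  have "(\<Sum>j<n. norm q ^ j) \<le> (\<Sum>j. norm q ^ j)"
    using q_lt_1 by (intro sum_le_suminf) auto
  also have "\<dots> = 1 / (1 - norm q)" using q_lt_1 by (simp add: suminf_geometric)
  finally show ?thesis .
qed

lemma prod_one_plus_le:
  assumes "x \<ge> 0"
  shows "(\<Prod>j<n. 1 + x * norm q ^ j) \<le> exp (x / (1 - norm q))"
proof -
  have "(\<Prod>j<n. 1 + x * norm q ^ j) \<le> (\<Prod>j<n. exp (x * norm q ^ j))"
    using assms by (intro prod_mono) auto
  also have "\<dots> = exp (x * (\<Sum>j<n. norm q ^ j))"
    by (simp add: exp_sum sum_distrib_left)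
  also have "\<dots> \<le> exp (x / (1 - norm q))"
    using mult_left_mono[OF sum_norm_q_power_le assms, of n] by simp
  finally show ?thesis .
qed

lemma norm_qpoch_le:
  assumes "norm a \<le> x"
  shows "norm (qpoch q a n) \<le> exp (x / (1 - norm q))"
proof -
  have x0: "x \<ge> 0" using assms norm_ge_zero[of a] by linarith
  have "norm (qpoch q a n) \<le> (\<Prod>j<n. 1 + x * norm q ^ j)"
    unfolding qpoch_def prod_norm[symmetric]
  proof (intro prod_mono conjI)
    fix j
    have "norm (1 - a * q ^ j) \<le> 1 + norm a * norm q ^ j"
      by (metis norm_mult norm_one norm_power norm_triangle_ineq4)
    also have "\<dots> \<le> 1 + x * norm q ^ j" using assms by (simp add: mult_right_mono)
    finally show "norm (1 - a * q ^ j) \<le> 1 + x * norm q ^ j" .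
  qed auto
  also have "\<dots> \<le> exp (x / (1 - norm q))" by (rule prod_one_plus_le[OF x0])
  finally show ?thesis .
qed

lemma qpoch_convergent: "convergent_prod (\<lambda>j. 1 - a * q ^ j)"
proof (rule abs_convergent_prod_imp_convergent_prod, rule summable_imp_abs_convergent_prod)
  have "summable (\<lambda>j. norm a * norm q ^ j)"
    using q_lt_1 by (intro summable_mult summable_geometric) auto
  then show "summable (\<lambda>i. norm (1 - a * q ^ i - 1))"
    by (simp add: norm_mult norm_power)
qed

lemma qpoch_tendsto: "(\<lambda>n. qpoch q a n) \<longlonglongrightarrow> qpoch_inf q a"
proof -
  have "(\<lambda>n. qpoch q a (Suc n)) \<longlonglongrightarrow> qpoch_inf q a"
    using convergent_prod_LIMSEQ[OF qpoch_convergent[of a]]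
    by (simp add: qpoch_def qpoch_inf_def lessThan_Suc_atMost)
  then show ?thesis by (simp only: filterlim_sequentially_Suc)
qed

lemma norm_qpoch_inf_le:
  assumes "norm a \<le> x"
  shows "norm (qpoch_inf q a) \<le> exp (x / (1 - norm q))"
  by (rule LIMSEQ_le_const2[OF tendsto_norm[OF qpoch_tendsto]])
     (use norm_qpoch_le[OF assms] in blast)

lemma qpoch_inf_split: "qpoch_inf q a = qpoch q a n * qpoch_inf q (a * q ^ n)"
proof -
  have "(\<lambda>m. qpoch q a (m + n)) \<longlonglongrightarrow> qpoch_inf q a"
    by (rule LIMSEQ_ignore_initial_segment[OF qpoch_tendsto])
  moreover have "(\<lambda>m. qpoch q a n * qpoch q (a * q ^ n) m) \<longlonglongrightarrow> qpoch q a n * qpoch_inf q (a * q ^ n)"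
    by (intro tendsto_intros qpoch_tendsto)
  ultimately show ?thesis
    using LIMSEQ_unique by (simp add: qpoch_add add.commute[of _ n])
qed

lemma qpoch_inf_eq_0_iff: "qpoch_inf q a = 0 \<longleftrightarrow> (\<exists>j. a * q ^ j = 1)"
proof
  assume "\<exists>j. a * q ^ j = 1"
  then obtain j where "a * q ^ j = 1" by blast
  then show "qpoch_inf q a = 0"
    using qpoch_inf_split[of a "Suc j"] by (simp add: qpoch_Suc)
next
  assume "qpoch_inf q a = 0"
  then show "\<exists>j. a * q ^ j = 1"
    using prodinf_nonzero[OF qpoch_convergent[of a]] by (auto simp: qpoch_inf_def)
qed

lemma qpoch_inf_nonzero:
  assumes "norm a < 1"
  shows "qpoch_inf q a \<noteq> 0"
proof
  assume "qpoch_inf q a = 0"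
  then obtain j where "a * q ^ j = 1" by (auto simp: qpoch_inf_eq_0_iff)
  then have "norm a * norm q ^ j = 1" by (metis norm_mult norm_one norm_power)
  moreover have "norm a * norm q ^ j \<le> norm a * 1"
    by (intro mult_left_mono norm_q_power_le_1) auto
  ultimately show False using assms by simp
qed

lemma norm_qpoch_minus_1_le: "norm (qpoch q a n - 1) \<le> exp (norm a / (1 - norm q)) - 1"
proof -
  have "norm (qpoch q a n - 1) \<le> (\<Prod>j<n. 1 + norm (- (a * q ^ j))) - 1"
    unfolding qpoch_def using norm_prod_minus1_le_prod_minus1[of "\<lambda>j. - (a * q ^ j)" "{..<n}"] by simp
  also have "\<dots> = (\<Prod>j<n. 1 + norm a * norm q ^ j) - 1" by (simp add: norm_mult norm_power)
  also have "\<dots> \<le> exp (norm a / (1 - norm q)) - 1" using prod_one_plus_le[of "norm a" n] by simp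
  finally show ?thesis .
qed

lemma holomorphic_qpoch_inf: "qpoch_inf q holomorphic_on UNIV"
proof (rule holomorphic_uniform_sequence[where f = "\<lambda>n a. qpoch q a n"])
  show "(\<lambda>a. qpoch q a n) holomorphic_on UNIV" for n
    unfolding qpoch_def by (intro holomorphic_intros)
next
  fix x :: complex
  define B where "B = norm x + 1"
  have B: "B \<ge> 0" by (simp add: B_def)
  define c where "c = 1 / (1 - norm q)"
  have "uniform_limit (cball x 1) (\<lambda>n a. qpoch q a n) (qpoch_inf q) sequentially"
    unfolding uniform_limit_iff
  proof (intro allI impI)
    fix e :: real assume e: "e > 0"
    have lim: "(\<lambda>n. exp (B * c) * (exp (B * norm q ^ n * c) - 1)) \<longlonglongrightarrow> exp (B * c) * (exp (B * 0 * c) - 1)"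
      using q_lt_1 by (intro tendsto_intros LIMSEQ_power_zero) auto
    then have "\<forall>\<^sub>F n in sequentially. exp (B * c) * (exp (B * norm q ^ n * c) - 1) < e"
      using order_tendstoD(2)[OF lim, of e] e by simp
    then show "\<forall>\<^sub>F n in sequentially. \<forall>a\<in>cball x 1. dist (qpoch q a n) (qpoch_inf q a) < e"
    proof eventually_elim
      case (elim n)
      show ?case
      proof
        fix a assume a: "a \<in> cball x 1"
        have aB: "norm a \<le> B"
        proof -
          have "norm a \<le> norm x + norm (a - x)" by (rule norm_triangle_sub)
          then show ?thesis using a by (simp add: B_def dist_norm norm_minus_commute)
        qed
        have "norm (qpoch q (a * q ^ n) m - 1) \<le> exp (B * norm q ^ n * c) - 1" for m
        proof -
          have "norm (qpoch q (a * q ^ n) m - 1) \<le> exp (norm (a * q ^ n) / (1 - norm q)) - 1"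
            by (rule norm_qpoch_minus_1_le)
          also have "\<dots> \<le> exp (B * norm q ^ n * c) - 1"
            using aB q_lt_1 by (simp add: c_def norm_mult norm_power divide_right_mono mult_right_mono)
          finally show ?thesis .
        qed
        then have 1: "norm (qpoch_inf q (a * q ^ n) - 1) \<le> exp (B * norm q ^ n * c) - 1"
          by (intro LIMSEQ_le_const2[OF tendsto_norm[OF tendsto_diff[OF qpoch_tendsto tendsto_const]]]) auto
        have 2: "norm (qpoch q a n) \<le> exp (B * c)"
          using norm_qpoch_le[OF aB, of n] by (simp add: c_def)
        have "dist (qpoch q a n) (qpoch_inf q a) = norm (qpoch_inf q a - qpoch q a n)"
          by (simp add: dist_norm norm_minus_commute)
        also have "\<dots> = norm (qpoch q a n * (qpoch_inf q (a * q ^ n) - 1))"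
          by (subst qpoch_inf_split[of a n]) (simp add: algebra_simps)
        also have "\<dots> \<le> exp (B * c) * (exp (B * norm q ^ n * c) - 1)"
          unfolding norm_mult using 1 2 by (intro mult_mono) auto
        finally show "dist (qpoch q a n) (qpoch_inf q a) < e" using elim by simp
      qed
    qed
  qed
  then show "\<exists>d>0. cball x d \<subseteq> UNIV \<and> uniform_limit (cball x d) (\<lambda>n a. qpoch q a n) (qpoch_inf q) sequentially"
    by (intro exI[of _ 1]) auto
qed auto

text \<open>
  On a closed disc of radius less than \<open>1\<close> the entire function \<open>(x)\<^sub>\<infinity>\<close> has no zeros, hence is bounded
  away from \<open>0\<close> by compactness.
\<close>

lemma norm_qpoch_inf_ge:
  assumes "k < 1"
  obtains e where "e > 0" "\<And>x. norm x \<le> k \<Longrightarrow> e \<le> norm (qpoch_inf q x)"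
proof (cases "k \<ge> 0")
  case True
  have "continuous_on (cball 0 k) (\<lambda>x. norm (qpoch_inf q x))"
    by (intro continuous_on_norm continuous_on_subset[OF holomorphic_on_imp_continuous_on[OF holomorphic_qpoch_inf]]) auto
  then obtain x0 where x0: "x0 \<in> cball 0 k" "\<And>x. x \<in> cball 0 k \<Longrightarrow> norm (qpoch_inf q x0) \<le> norm (qpoch_inf q x)"
    using continuous_attains_inf[of "cball (0::complex) k" "\<lambda>x. norm (qpoch_inf q x)"] True by auto
  show ?thesis
    by (rule that[of "norm (qpoch_inf q x0)"]) (use x0 assms qpoch_inf_nonzero[of x0] in auto)
next
  case False
  show ?thesis
  proof (rule that[of 1])
    fix x :: complex assume "norm x \<le> k"
    then show "1 \<le> norm (qpoch_inf q x)" using False norm_ge_zero[of x] by linarith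
  qed auto
qed

text \<open>
  The lower bound passes from the infinite to the finite products because the quotient
  \<open>(xq\<^sup>n)\<^sub>\<infinity>\<close> is bounded above uniformly in \<open>n\<close>.
\<close>

lemma norm_qpoch_ge:
  assumes "k < 1"
  obtains e where "e > 0" "\<And>x n. norm x \<le> k \<Longrightarrow> e \<le> norm (qpoch q x n)"
proof -
  obtain e where e: "e > 0" "\<And>x. norm x \<le> k \<Longrightarrow> e \<le> norm (qpoch_inf q x)"
    using norm_qpoch_inf_ge[OF assms] by blast
  define E where "E = exp (1 / (1 - norm q))"
  have E: "E > 0" by (simp add: E_def)
  show ?thesis
  proof (rule that[of "e / E"])
    show "e / E > 0" using e E by simp
    fix x :: complex and n assume x: "norm x \<le> k"
    have "norm x * norm q ^ n \<le> 1 * 1"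
      using x assms by (intro mult_mono norm_q_power_le_1) auto
    then have "norm (qpoch_inf q (x * q ^ n)) \<le> E"
      unfolding E_def by (intro norm_qpoch_inf_le) (simp add: norm_mult norm_power)
    moreover have "e \<le> norm (qpoch q x n) * norm (qpoch_inf q (x * q ^ n))"
      using e(2)[OF x] qpoch_inf_split[of x n] by (simp add: norm_mult)
    ultimately have "e \<le> norm (qpoch q x n) * E"
      by (meson mult_left_mono norm_ge_zero order_trans)
    then show "e / E \<le> norm (qpoch q x n)" using E by (simp add: field_simps)
  qed
qed

end

section \<open>The terminating very-well-poised sum\<close>

context q_in_disc begin

text \<open>
  The terms of the very-well-poised \<open>6\<phi>5\<close> series, without the customary factor \<open>1 / (1 - a)\<close>, so that
  \<open>a = 1\<close> is admitted.
\<close>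

definition vwp_term :: "complex \<Rightarrow> complex \<Rightarrow> complex \<Rightarrow> complex \<Rightarrow> nat \<Rightarrow> complex" where
  "vwp_term a b c d n =
     (1 - a * q ^ (2 * n)) * (qpoch q a n * qpoch q b n * qpoch q c n * qpoch q d n)
       / (qpoch q q n * qpoch q (a * q / b) n * qpoch q (a * q / c) n * qpoch q (a * q / d) n)
     * (a * q / (b * c * d)) ^ n"

text \<open>
  A certificate in the style of Wilf and Zeilberger, with \<open>A\<close> in place of \<open>q\<^sup>n\<close>.  After the common part of the
  terms is cancelled, it says that the terms for \<open>d/q\<close>, minus a constant multiple of the terms
  for \<open>d\<close>, form a telescoping sequence; both sides are polynomials of degree at most four in \<open>A\<close>.
\<close>

lemma vwp_certificate:
  fixes a b c d A :: complex
  assumes nz: "a \<noteq> 0" "b \<noteq> 0" "c \<noteq> 0" "d \<noteq> 0"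
    and k: "\<kappa> * ((1 - a * q / (b * d)) * (1 - a * q / (c * d))) = 1 - a * q / d"
  shows "(1 - a * A\<^sup>2) * ((1 - d / q) * (1 - a * q / d) * A
            - \<kappa> * (1 - a * q / (b * c * d)) * (1 - d * A / q) * (1 - a * q * A / d))
         = \<kappa> * (a * q / (b * c * d) * (1 - a * A) * (1 - b * A) * (1 - c * A) * (1 - d * A / q)
               - (1 - A) * (1 - a * A / b) * (1 - a * A / c) * (1 - a * q * A / d))"
proof -
  have q: "q \<noteq> 0" by simp
  have aux: "P * (D * (\<kappa> * Y) * A - \<kappa> * U * V * W) = \<kappa> * (P * (D * Y * A - U * V * W))"
    for P D Y U V W :: complex by algebra
  have *: "(1 - a * A\<^sup>2) * ((1 - d / q) * ((1 - a * q / (b * d)) * (1 - a * q / (c * d))) * A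
            - (1 - a * q / (b * c * d)) * (1 - d * A / q) * (1 - a * q * A / d))
         = (a * q / (b * c * d) * (1 - a * A) * (1 - b * A) * (1 - c * A) * (1 - d * A / q)
               - (1 - A) * (1 - a * A / b) * (1 - a * A / c) * (1 - a * q * A / d))"
    using nz q by (simp add: divide_simps) algebra
  have "(1 - a * A\<^sup>2) * ((1 - d / q) * (1 - a * q / d) * A
            - \<kappa> * (1 - a * q / (b * c * d)) * (1 - d * A / q) * (1 - a * q * A / d))
      = \<kappa> * ((1 - a * A\<^sup>2) * ((1 - d / q) * ((1 - a * q / (b * d)) * (1 - a * q / (c * d))) * A
            - (1 - a * q / (b * c * d)) * (1 - d * A / q) * (1 - a * q * A / d)))"
    unfolding k[symmetric] by (rule aux)
  then show ?thesis unfolding * .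
qed

text \<open>
  The passage from \<open>d\<close> to \<open>d/q\<close> multiplies a terminating sum by an explicit factor.  The hypothesis
  \<open>M\<close> makes the upper boundary term of the telescoping sum vanish; at the lower end the
  factor \<open>1 - q\<^sup>0\<close> does.
\<close>

lemma vwp_contiguous:
  fixes a b c d :: complex
  assumes nz: "a \<noteq> 0" "b \<noteq> 0" "c \<noteq> 0" "d \<noteq> 0" "d \<noteq> q"
    and B: "\<And>n. qpoch q (a * q / b) n \<noteq> 0" and C: "\<And>n. qpoch q (a * q / c) n \<noteq> 0"
    and D: "\<And>n. qpoch q (a * q / d) n \<noteq> 0"
    and bd: "a * q / (b * d) \<noteq> 1" and cd: "a * q / (c * d) \<noteq> 1"
    and M: "qpoch q (d / q) (Suc M) = 0"
  shows "(\<Sum>n\<le>M. vwp_term a b c (d / q) n) =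
           (1 - a * q / d) * (1 - a * q / (b * c * d)) / ((1 - a * q / (b * d)) * (1 - a * q / (c * d)))
            * (\<Sum>n\<le>M. vwp_term a b c d n)"
proof -
  define u where "u = a * q / (b * c * d)"
  define \<kappa> where "\<kappa> = (1 - a * q / d) / ((1 - a * q / (b * d)) * (1 - a * q / (c * d)))"
  have \<kappa>: "\<kappa> * ((1 - a * q / (b * d)) * (1 - a * q / (c * d))) = 1 - a * q / d"
    using bd cd by (simp add: \<kappa>_def)
  have dq: "1 - d / q \<noteq> 0" using nz by (simp add: field_simps)
  \<comment> \<open>the part common to both terms and to the antidifference \<open>G\<close>, so that all of them are polynomials in \<open>q\<^sup>n\<close> times \<open>x n\<close>\<close>
  define x where "x n = qpoch q a n * qpoch q b n * qpoch q c n * qpoch q (d / q) n * u ^ n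
      / ((1 - d / q) * qpoch q q n * qpoch q (a * q / b) n * qpoch q (a * q / c) n * qpoch q (a * q / d) (Suc n))"
    for n
  define G where "G n = \<kappa> * ((1 - q ^ n) * (1 - a * q ^ n / b) * (1 - a * q ^ n / c) * (1 - a * q * q ^ n / d)) * x n"
    for n
  have t1: "vwp_term a b c d n = (1 - a * (q ^ n)\<^sup>2) * ((1 - d * q ^ n / q) * (1 - a * q * q ^ n / d)) * x n" for n
  proof -
    have 1: "qpoch q d n * (1 - d / q) = qpoch q (d / q) n * (1 - d * q ^ n / q)"
      using qpoch_Suc[of "d / q" n] qpoch_Suc_left[of "d / q" n] by (simp add: mult_ac)
    have 2: "qpoch q (a * q / d) (Suc n) = qpoch q (a * q / d) n * (1 - a * q * q ^ n / d)"
      by (simp add: qpoch_Suc)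
    have 3: "1 - a * q * q ^ n / d \<noteq> 0" using D[of "Suc n"] by (simp add: qpoch_Suc)
    have 4: "qpoch q d n = qpoch q (d / q) n * (1 - d * q ^ n / q) / (1 - d / q)"
      by (rule eq_divide_imp[OF dq 1])
    show ?thesis unfolding vwp_term_def x_def 2 4 u_def[symmetric] using 3 nz
      by (simp add: power_mult power2_eq_square mult_ac power_even_eq)
  qed
  have t2: "vwp_term a b c (d / q) n = (1 - a * (q ^ n)\<^sup>2) * ((1 - d / q) * (1 - a * q / d) * q ^ n) * x n" for n
  proof -
    have 3: "1 - a * q / d \<noteq> 0" using D[of "Suc 0"] by (simp add: qpoch_Suc)
    have 2: "qpoch q (a * q / d) (Suc n) = (1 - a * q / d) * qpoch q (a * q / (d / q)) n"
      by (subst qpoch_Suc_left) (simp add: mult_ac)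
    have 4: "a * q / (b * c * (d / q)) = u * q" by (simp add: u_def)
    have red: "L * (P1 * P2 * P3 * P4) / (Q1 * Q2 * Q3 * E) * (U * R)
        = L * (p * y * R) * (P1 * P2 * P3 * P4 * U / (p * Q1 * Q2 * Q3 * (y * E)))"
      if "p \<noteq> 0" "y \<noteq> 0" for L P1 P2 P3 P4 Q1 Q2 Q3 E U R p y :: complex
      using that by (simp add: divide_simps)
    have sq: "(q ^ n)\<^sup>2 = q ^ (2 * n)" and uq: "(u * q) ^ n = u ^ n * q ^ n"
      by (simp_all add: power_mult_distrib mult.commute flip: power_mult)
    show ?thesis unfolding vwp_term_def x_def 2 4 sq uq by (rule red[OF dq 3])
  qed
  have t3: "G (Suc n) = \<kappa> * (u * (1 - a * q ^ n) * (1 - b * q ^ n) * (1 - c * q ^ n) * (1 - d * q ^ n / q)) * x n" for n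
  proof -
    have nzs: "1 - q * q ^ n \<noteq> 0" "1 - a * q * q ^ n / b \<noteq> 0" "1 - a * q * q ^ n / c \<noteq> 0" "1 - a * q * (q * q ^ n) / d \<noteq> 0"
      using qpoch_q_nonzero[of "Suc n"] B[of "Suc n"] C[of "Suc n"] D[of "Suc (Suc n)"] by (simp_all add: qpoch_Suc)
    have 1: "x (Suc n) = (1 - a * q ^ n) * (1 - b * q ^ n) * (1 - c * q ^ n) * (1 - d * q ^ n / q) * u
        / ((1 - q * q ^ n) * (1 - a * q * q ^ n / b) * (1 - a * q * q ^ n / c) * (1 - a * q * (q * q ^ n) / d)) * x n"
      unfolding x_def by (simp add: qpoch_Suc mult_ac)
    have red: "\<kappa> * (p1 * p2 * p3 * p4) * (r / (p1 * p2 * p3 * p4) * y) = \<kappa> * r * y"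
      if "p1 \<noteq> 0" "p2 \<noteq> 0" "p3 \<noteq> 0" "p4 \<noteq> 0" for p1 p2 p3 p4 r y :: complex
      using that by simp
    have "G (Suc n) = \<kappa> * ((1 - q * q ^ n) * (1 - a * q * q ^ n / b) * (1 - a * q * q ^ n / c) * (1 - a * q * (q * q ^ n) / d)) * x (Suc n)"
      by (simp add: G_def mult.assoc)
    also have "\<dots> = \<kappa> * ((1 - a * q ^ n) * (1 - b * q ^ n) * (1 - c * q ^ n) * (1 - d * q ^ n / q) * u) * x n"
      unfolding 1 by (rule red[OF nzs])
    finally show ?thesis by (simp add: mult_ac)
  qed
  have tele: "vwp_term a b c (d / q) n - \<kappa> * (1 - u) * vwp_term a b c d n = G (Suc n) - G n" for n
  proof -
    have fac1: "P * Q * x - k * (1 - u) * (P * (R1 * R2) * x) = P * (Q - k * (1 - u) * R1 * R2) * x"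
      for P Q R1 R2 k x :: complex by (simp add: algebra_simps)
    have fac2: "k * X1 * x - k * X2 * x = k * (X1 - X2) * x" for k X1 X2 x :: complex
      by (simp add: algebra_simps)
    show ?thesis
      unfolding t1 t2 t3 fac1 unfolding G_def fac2
      using vwp_certificate[OF nz(1-4) \<kappa>, of "q ^ n"] by (simp only: u_def)
  qed
  have "(\<Sum>n\<le>M. vwp_term a b c (d / q) n) - \<kappa> * (1 - u) * (\<Sum>n\<le>M. vwp_term a b c d n)
      = (\<Sum>n\<le>M. G (Suc n) - G n)"
    by (simp add: sum_subtractf sum_distrib_left flip: tele)
  also have "\<dots> = G (Suc M) - G 0" by (induction M) simp_all
  also have "\<dots> = 0" using M by (simp add: G_def x_def)
  finally show ?thesis by (simp add: \<kappa>_def u_def)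
qed

text \<open>
  Each step \<open>N \<rightarrow> N + 1\<close> is an instance of \<open>vwp_contiguous\<close> with \<open>d = q\<^sup>-\<^sup>N\<close>.
\<close>

theorem terminating_6phi5:
  fixes a b c :: complex
  assumes nz: "a \<noteq> 0" "b \<noteq> 0" "c \<noteq> 0"
    and A: "\<And>j. a * q ^ Suc j \<noteq> 1"
    and B: "\<And>n. qpoch q (a * q / b) n \<noteq> 0" and C: "\<And>n. qpoch q (a * q / c) n \<noteq> 0"
  shows "(\<Sum>n\<le>N. vwp_term a b c (inverse (q ^ N)) n)
     = qpoch q a (Suc N) * qpoch q (a * q / (b * c)) N / (qpoch q (a * q / b) N * qpoch q (a * q / c) N)"
proof (induction N)
  case 0
  show ?case by (simp add: vwp_term_def qpoch_Suc)
next
  case (Suc N)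
  define d where "d = inverse (q ^ N)"
  have d: "inverse (q ^ Suc N) = d / q" by (simp add: d_def field_simps)
  have aqd: "a * q / d = a * q ^ Suc N" by (simp add: d_def divide_inverse mult_ac)
  have "qpoch q (d / q) (Suc (Suc N)) = 0"
    unfolding qpoch_eq_0_iff by (intro exI[of _ "Suc N"]) (simp add: d_def)
  moreover have "d \<noteq> q"
  proof
    assume "d = q"
    then have "q ^ Suc N = 1" by (simp add: d_def field_simps)
    then show False using q_power_neq_1[of "Suc N"] by simp
  qed
  moreover have "a * q / (b * d) \<noteq> 1"
  proof -
    have "a * q / (b * d) = a * q / b * q ^ N" by (simp add: d_def divide_inverse mult_ac)
    then show ?thesis using B[of "Suc N"] by (simp add: qpoch_Suc)
  qed
  moreover have "a * q / (c * d) \<noteq> 1"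
  proof -
    have "a * q / (c * d) = a * q / c * q ^ N" by (simp add: d_def divide_inverse mult_ac)
    then show ?thesis using C[of "Suc N"] by (simp add: qpoch_Suc)
  qed
  moreover have "qpoch q (a * q / d) n \<noteq> 0" for n
  proof
    assume "qpoch q (a * q / d) n = 0"
    then obtain j where "a * q ^ Suc N * q ^ j = 1" unfolding aqd qpoch_eq_0_iff by blast
    then show False using A[of "N + j"] by (simp add: power_add mult_ac)
  qed
  ultimately have *: "(\<Sum>n\<le>Suc N. vwp_term a b c (d / q) n) =
           (1 - a * q / d) * (1 - a * q / (b * c * d)) / ((1 - a * q / (b * d)) * (1 - a * q / (c * d)))
            * (\<Sum>n\<le>Suc N. vwp_term a b c d n)"
    using nz B C by (intro vwp_contiguous) (auto simp: d_def)
  have "vwp_term a b c d (Suc N) = 0"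
  proof -
    have "qpoch q d (Suc N) = 0" unfolding qpoch_eq_0_iff by (intro exI[of _ N]) (simp add: d_def)
    then show ?thesis by (simp add: vwp_term_def)
  qed
  then have **: "(\<Sum>n\<le>Suc N. vwp_term a b c d n) = (\<Sum>n\<le>N. vwp_term a b c d n)" by simp
  have e: "a * q / (b * c * d) = a * q / (b * c) * q ^ N" "a * q / (b * d) = a * q / b * q ^ N"
    "a * q / (c * d) = a * q / c * q ^ N"
    by (simp_all add: d_def divide_inverse mult_ac)
  show ?case
    unfolding d * ** unfolding Suc.IH[folded d_def] unfolding aqd e
    by (simp add: qpoch_Suc mult_ac)
qed

text \<open>
  The constant \<open>(-1)\<^sup>k q\<^sup>-\<^sup>k\<^sup>(\<^sup>k\<^sup>+\<^sup>1\<^sup>)\<^sup>/\<^sup>2\<close> that arises when the factors of a shifted factorial are reversed.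
\<close>

definition rev_factor :: "nat \<Rightarrow> complex" where
  "rev_factor k = (\<Prod>i<k. - inverse (q ^ Suc i))"

lemma rev_factor_nonzero [simp]: "rev_factor k \<noteq> 0"
  by (simp add: rev_factor_def)

lemma rev_factor_square: "(rev_factor k)\<^sup>2 * q ^ (k * (k + 1)) = 1"
proof (induction k)
  case (Suc k)
  define w where "w = q ^ Suc k"
  have w: "w \<noteq> 0" by (simp add: w_def)
  have 1: "rev_factor (Suc k) = rev_factor k * - inverse w" by (simp add: rev_factor_def w_def)
  have "Suc k * (Suc k + 1) = k * (k + 1) + (Suc k + Suc k)" by simp
  then have 2: "q ^ (Suc k * (Suc k + 1)) = q ^ (k * (k + 1)) * (w * w)"
    by (simp only: power_add w_def)
  show ?case using Suc w unfolding 1 2 by (simp add: power2_eq_square field_simps)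
qed (simp add: rev_factor_def)

text \<open>
  Reversal of the order of the factors, from \<open>1 - s q\<^sup>-\<^sup>i = - s q\<^sup>-\<^sup>i (1 - q\<^sup>i / s)\<close>.
  For \<open>s = 1\<close> it turns \<open>(q\<^sup>-\<^sup>n)\<^sub>k\<close> into a quotient of factorials \<open>(q)\<^sub>n\<close>.
\<close>

lemma qpoch_reverse:
  assumes "s \<noteq> 0"
  shows "qpoch q (s / q ^ (m + k)) k * qpoch q (q / s) m * q ^ (k * m)
           = rev_factor k * s ^ k * qpoch q (q / s) (m + k)"
proof (induction k)
  case (Suc k)
  have 1: "qpoch q (s / q ^ (m + Suc k)) (Suc k) = (1 - s / q ^ Suc (m + k)) * qpoch q (s / q ^ (m + k)) k"
    unfolding qpoch_Suc_left by simp
  have 2: "(1 - s / q ^ Suc (m + k)) * q ^ m = - inverse (q ^ Suc k) * s * (1 - q / s * q ^ (m + k))"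
    using assms by (simp add: field_simps power_add)
  have "qpoch q (s / q ^ (m + Suc k)) (Suc k) * qpoch q (q / s) m * q ^ (Suc k * m)
      = ((1 - s / q ^ Suc (m + k)) * q ^ m) * (qpoch q (s / q ^ (m + k)) k * qpoch q (q / s) m * q ^ (k * m))"
    unfolding 1 by (simp add: power_add mult_ac)
  also have "\<dots> = rev_factor (Suc k) * s ^ Suc k * qpoch q (q / s) (m + Suc k)"
    unfolding 2 Suc by (simp add: rev_factor_def qpoch_Suc mult_ac)
  finally show ?case .
qed (simp add: rev_factor_def)

text \<open>
  The factors \<open>(q\<^sup>-\<^sup>n)\<^sub>k (aq\<^sup>n)\<^sub>k\<close> of the inner sum turn a very-well-poised term of index \<open>m + k\<close> into
  one of index \<open>m\<close> with parameters \<open>aq\<^sup>2\<^sup>k, bq\<^sup>k, cq\<^sup>k, dq\<^sup>k\<close>, essentially because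
  \<open>(a)\<^sub>m\<^sub>+\<^sub>k (aq\<^sup>m\<^sup>+\<^sup>k)\<^sub>k = (a)\<^sub>2\<^sub>k (aq\<^sup>2\<^sup>k)\<^sub>m\<close>.
\<close>

lemma vwp_term_shift:
  "vwp_term a b c d (m + k) * (qpoch q (inverse (q ^ (m + k))) k * qpoch q (a * q ^ (m + k)) k)
    = qpoch q a (2 * k) * (qpoch q b k * qpoch q c k * qpoch q d k)
        / (qpoch q (a * q / b) k * qpoch q (a * q / c) k * qpoch q (a * q / d) k)
        * (a * q / (b * c * d)) ^ k * rev_factor k
      * vwp_term (a * q ^ (2 * k)) (b * q ^ k) (c * q ^ k) (d * q ^ k) m"
proof -
  define u where "u = a * q / (b * c * d)"
  have rev: "qpoch q (inverse (q ^ (m + k))) k = rev_factor k * qpoch q q (m + k) / (qpoch q q m * q ^ (k * m))"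
    using qpoch_reverse[of 1 m k] by (simp add: field_simps)
  have A: "qpoch q a (m + k) * qpoch q (a * q ^ (m + k)) k = qpoch q a (2 * k) * qpoch q (a * q ^ (2 * k)) m"
    by (simp flip: qpoch_add add: mult_2 add_ac)
  have add: "qpoch q x (m + k) = qpoch q x k * qpoch q (x * q ^ k) m" for x
    by (subst add.commute) (rule qpoch_add)
  have e: "a * q ^ (2 * k) * q / (b * q ^ k) = a * q / b * q ^ k"
     "a * q ^ (2 * k) * q / (c * q ^ k) = a * q / c * q ^ k"
     "a * q ^ (2 * k) * q / (d * q ^ k) = a * q / d * q ^ k"
    by (simp_all add: mult_2 power_add)
  have e2: "a * q ^ (2 * k) * q / (b * q ^ k * (c * q ^ k) * (d * q ^ k)) = u / q ^ k"
    by (simp add: u_def mult_2 power_add)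
  have e3: "a * q ^ (2 * (m + k)) = a * q ^ (2 * k) * q ^ (2 * m)"
    by (simp add: power_add algebra_simps)
  have e4: "u ^ (m + k) / q ^ (k * m) = u ^ k * (u / q ^ k) ^ m"
    by (simp add: power_add power_divide power_mult)
  have "vwp_term a b c d (m + k) * (qpoch q (inverse (q ^ (m + k))) k * qpoch q (a * q ^ (m + k)) k)
     = (1 - a * q ^ (2 * (m + k))) * (qpoch q a (m + k) * qpoch q (a * q ^ (m + k)) k)
       * (qpoch q b (m + k) * qpoch q c (m + k) * qpoch q d (m + k))
       / (qpoch q q m * (qpoch q (a * q / b) (m + k) * qpoch q (a * q / c) (m + k) * qpoch q (a * q / d) (m + k)))
       * rev_factor k * (u ^ (m + k) / q ^ (k * m))"
  proof -
    have "L * (P * B * C * D) / (Q * X * Y * Z) * U * (R * Q / (S * E) * P') =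
        L * (P * P') * (B * C * D) / (S * (X * Y * Z)) * R * (U / E)"
      if "Q \<noteq> 0" for L P B C D Q X Y Z U R S E P' :: complex
      using that by (simp add: divide_simps)
    then show ?thesis
      unfolding vwp_term_def rev u_def[symmetric] by (simp only: qpoch_q_nonzero not_False_eq_True)
  qed
  also have "\<dots> = qpoch q a (2 * k) * (qpoch q b k * qpoch q c k * qpoch q d k)
        / (qpoch q (a * q / b) k * qpoch q (a * q / c) k * qpoch q (a * q / d) k)
        * u ^ k * rev_factor k
      * vwp_term (a * q ^ (2 * k)) (b * q ^ k) (c * q ^ k) (d * q ^ k) m"
    unfolding A e3 e4 unfolding add vwp_term_def e e2 by (simp add: mult_ac)
  finally show ?thesis by (simp add: u_def)
qed

text \<open>
  The coefficient of \<open>f(q\<^sup>k) q\<^sup>k / (q)\<^sub>k\<close> in the terminating double sum: by \<open>vwp_term_shift\<close> it is a multiple of a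
  \<open>6\<phi>5\<close> sum with \<open>N - k\<close> in place of \<open>N\<close>.
\<close>

theorem terminating_coefficient:
  fixes a b c :: complex
  assumes nz: "a \<noteq> 0" "b \<noteq> 0" "c \<noteq> 0"
    and A: "\<And>j. a * q ^ Suc j \<noteq> 1"
    and B: "\<And>n. qpoch q (a * q / b) n \<noteq> 0" and C: "\<And>n. qpoch q (a * q / c) n \<noteq> 0"
    and BC: "qpoch q (b * c / a / q ^ N) k \<noteq> 0"
    and kN: "k \<le> N" and d: "d = inverse (q ^ N)"
  shows "(\<Sum>n=k..N. vwp_term a b c d n * (qpoch q (inverse (q ^ n)) k * qpoch q (a * q ^ n) k))
     = qpoch q a (Suc N) * qpoch q (a * q / (b * c)) N / (qpoch q (a * q / b) N * qpoch q (a * q / c) N)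
       * (qpoch q b k * qpoch q c k * qpoch q d k) / qpoch q (b * c / a / q ^ N) k"
proof -
  obtain m where N: "N = m + k" using kN by (metis le_add_diff_inverse2)
  define s where "s = b * c / a"
  have s0: "s \<noteq> 0" using nz by (simp add: s_def)
  have qs: "a * q / (b * c) = q / s" by (simp add: s_def)
  define u where "u = a * q / (b * c * d)"
  define K where "K = qpoch q a (2 * k) * (qpoch q b k * qpoch q c k * qpoch q d k)
        / (qpoch q (a * q / b) k * qpoch q (a * q / c) k * qpoch q (a * q / d) k)
        * u ^ k * rev_factor k"
  have split: "qpoch q x (m + k) = qpoch q x k * qpoch q (x * q ^ k) m" for x
    by (subst add.commute) (rule qpoch_add)
  have dqk: "d * q ^ k = inverse (q ^ m)" by (simp add: d N power_add field_simps)
  have aqd: "a * q / d = a * q ^ Suc N" by (simp add: d divide_inverse mult_ac)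
  have D: "qpoch q (a * q / d) n \<noteq> 0" for n
  proof
    assume "qpoch q (a * q / d) n = 0"
    then obtain j where "a * q ^ Suc N * q ^ j = 1" unfolding aqd qpoch_eq_0_iff by blast
    then show False using A[of "N + j"] by (simp add: power_add mult_ac)
  qed
  have "(\<Sum>n=k..N. vwp_term a b c d n * (qpoch q (inverse (q ^ n)) k * qpoch q (a * q ^ n) k))
     = (\<Sum>n\<le>m. vwp_term a b c d (n + k) * (qpoch q (inverse (q ^ (n + k))) k * qpoch q (a * q ^ (n + k)) k))"
    using sum.shift_bounds_cl_nat_ivl[of "\<lambda>n. vwp_term a b c d n * (qpoch q (inverse (q ^ n)) k * qpoch q (a * q ^ n) k)" 0 k m]
    by (simp add: N atLeast0AtMost)
  also have "\<dots> = K * (\<Sum>n\<le>m. vwp_term (a * q ^ (2 * k)) (b * q ^ k) (c * q ^ k) (inverse (q ^ m)) n)"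
    unfolding vwp_term_shift K_def u_def dqk by (simp add: sum_distrib_left)
  also have "\<dots> = K * (qpoch q (a * q ^ (2 * k)) (Suc m) * qpoch q (q / s) m
        / (qpoch q (a * q / b * q ^ k) m * qpoch q (a * q / c * q ^ k) m))"
  proof -
    have e: "a * q ^ (2 * k) * q / (b * q ^ k) = a * q / b * q ^ k"
     "a * q ^ (2 * k) * q / (c * q ^ k) = a * q / c * q ^ k"
      by (simp_all add: mult_2 power_add)
    have e2: "a * q ^ (2 * k) * q / (b * q ^ k * (c * q ^ k)) = q / s"
      by (simp add: s_def mult_2 power_add)
    have B': "qpoch q (a * q / b * q ^ k) n \<noteq> 0" for n using B[of "k + n"] by (simp add: qpoch_add)
    have C': "qpoch q (a * q / c * q ^ k) n \<noteq> 0" for n using C[of "k + n"] by (simp add: qpoch_add)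
    have A': "a * q ^ (2 * k) * q ^ Suc j \<noteq> 1" for j
      using A[of "2 * k + j"] by (simp add: power_add mult_ac)
    have "(\<Sum>n\<le>m. vwp_term (a * q ^ (2 * k)) (b * q ^ k) (c * q ^ k) (inverse (q ^ m)) n)
      = qpoch q (a * q ^ (2 * k)) (Suc m) * qpoch q (q / s) m
        / (qpoch q (a * q / b * q ^ k) m * qpoch q (a * q / c * q ^ k) m)"
      using terminating_6phi5[of "a * q ^ (2 * k)" "b * q ^ k" "c * q ^ k" m] nz A' B' C'
      unfolding e e2 by simp
    then show ?thesis by simp
  qed
  also have "\<dots> = (qpoch q a (2 * k) * qpoch q (a * q ^ (2 * k)) (Suc m)) / qpoch q (a * q / d) k
       * (qpoch q b k * qpoch q c k * qpoch q d k) / (qpoch q (a * q / b) N * qpoch q (a * q / c) N)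
       * (u ^ k * rev_factor k * qpoch q (q / s) m)"
    unfolding K_def N split[of "a * q / b"] split[of "a * q / c"] by (simp add: divide_simps)
  also have "qpoch q a (2 * k) * qpoch q (a * q ^ (2 * k)) (Suc m) = qpoch q a (Suc N) * qpoch q (a * q / d) k"
    unfolding aqd N using qpoch_add[of a "2 * k" "Suc m"] qpoch_add[of a "Suc (m + k)" k]
    by (simp add: mult_2 add_ac)
  also have "u ^ k * rev_factor k * qpoch q (q / s) m = qpoch q (q / s) N / qpoch q (s / q ^ N) k"
  proof -
    \<comment> \<open>the two reversals contribute \<open>rev_factor k\<close> twice, which compensates the powers of \<open>q\<close>\<close>
    have us: "u * s = q ^ Suc N" using nz by (simp add: u_def s_def d divide_simps)
    have "u ^ k * rev_factor k * qpoch q (q / s) m * qpoch q (s / q ^ N) k * q ^ (k * m)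
      = u ^ k * rev_factor k * (qpoch q (s / q ^ (m + k)) k * qpoch q (q / s) m * q ^ (k * m))"
      by (simp add: N mult_ac)
    also have "\<dots> = (rev_factor k)\<^sup>2 * (u * s) ^ k * qpoch q (q / s) N"
      unfolding qpoch_reverse[OF s0] by (simp add: N power_mult_distrib power2_eq_square mult_ac)
    also have "(u * s) ^ k = q ^ (k * (k + 1)) * q ^ (k * m)"
      unfolding us by (simp add: N power_add algebra_simps flip: power_mult)
    also have "(rev_factor k)\<^sup>2 * (q ^ (k * (k + 1)) * q ^ (k * m)) = q ^ (k * m)"
      using rev_factor_square[of k] by (metis mult.assoc mult_1)
    finally show ?thesis using BC by (simp add: s_def[symmetric] field_simps)
  qed
  finally show ?thesis unfolding qs s_def[symmetric] using D[of k] by (simp add: divide_simps)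
qed

end

section \<open>Geometric decay of the terminating inner sums\<close>

context q_in_disc begin

text \<open>
  Both sides, as polynomials in \<open>x\<close>, acquire the factor \<open>1 - x q\<^sup>-\<^sup>n\<^sup>-\<^sup>1\<close> when \<open>n\<close> increases by one.  On the
  left this is the recurrence \<open>rec\<close> for the coefficients.
\<close>

lemma finite_q_binomial:
  "(\<Sum>k\<le>n. qpoch q (inverse (q ^ n)) k / qpoch q q k * x ^ k) = qpoch q (x / q ^ n) n"
proof -
  define c where "c n k = qpoch q (inverse (q ^ n)) k / qpoch q q k" for n k
  have c0: "c n 0 = 1" for n by (simp add: c_def)
  have rec: "c (Suc n) (Suc k) = c n (Suc k) - c n k / q ^ Suc n" for n k
  proof -
    define w where "w = inverse (q ^ n)"
    have w: "inverse (q ^ Suc n) = w / q" by (simp add: w_def field_simps)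
    have 1: "qpoch q (w / q) (Suc k) = (1 - w / q) * qpoch q w k"
      using qpoch_Suc_left[of "w / q" k] by simp
    have 2: "qpoch q w (Suc k) = qpoch q w k * (1 - w * q ^ k)" by (rule qpoch_Suc)
    have 3: "qpoch q q (Suc k) = qpoch q q k * (1 - q * q ^ k)" by (rule qpoch_Suc)
    have nz: "1 - q * q ^ k \<noteq> 0" using qpoch_q_nonzero[of "Suc k"] unfolding 3 by simp
    have 4: "c n k / q ^ Suc n = c n k * (w / q)" unfolding w[symmetric] by (simp add: divide_inverse)
    have alg: "(1 - w / q) * P / (Q * y) = P * (1 - w * z) / (Q * y) - P / Q * (w / q)"
      if "y \<noteq> 0" "Q \<noteq> 0" "y = 1 - q * z" for P Q y z :: complex
      using that(1,2) by (simp add: divide_simps) (simp add: that(3) algebra_simps)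
    show ?thesis unfolding 4 unfolding c_def w w_def[symmetric] 1 2 3
      by (rule alg[OF nz]) auto
  qed
  have c_top: "c n (Suc n) = 0" for n
  proof -
    have "qpoch q (inverse (q ^ n)) (Suc n) = 0"
      unfolding qpoch_eq_0_iff by (intro exI[of _ n]) simp
    then show ?thesis by (simp add: c_def)
  qed
  have "(\<Sum>k\<le>n. c n k * x ^ k) = qpoch q (x / q ^ n) n"
  proof (induction n)
    case 0
    then show ?case by (simp add: c0)
  next
    case (Suc n)
    have "(\<Sum>k\<le>Suc n. c (Suc n) k * x ^ k) = 1 + (\<Sum>k\<le>n. c (Suc n) (Suc k) * x ^ Suc k)"
      by (subst sum.atMost_Suc_shift) (simp add: c0)
    also have "\<dots> = (1 + (\<Sum>k\<le>n. c n (Suc k) * x ^ Suc k)) - x / q ^ Suc n * (\<Sum>k\<le>n. c n k * x ^ k)"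
      by (simp add: rec sum_subtractf sum_distrib_left algebra_simps)
    also have "1 + (\<Sum>k\<le>n. c n (Suc k) * x ^ Suc k) = (\<Sum>k\<le>Suc n. c n k * x ^ k)"
      unfolding sum.atMost_Suc_shift[of "\<lambda>k. c n k * x ^ k" n] by (simp only: c0 power_0 mult_1_right)
    also have "\<dots> = (\<Sum>k\<le>n. c n k * x ^ k)" by (simp add: c_top)
    also have "(\<Sum>k\<le>n. c n k * x ^ k) - x / q ^ Suc n * (\<Sum>k\<le>n. c n k * x ^ k)
       = (1 - x / q ^ Suc n) * qpoch q (x / q ^ n) n"
      unfolding Suc by (simp add: algebra_simps)
    also have "\<dots> = qpoch q (x / q ^ Suc n) (Suc n)"
      unfolding qpoch_Suc_left by simp
    finally show ?case .
  qed
  then show ?thesis by (simp add: c_def)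
qed

text \<open>
  Up to a constant factor, the \<open>n\<close>-th divided difference of \<open>F\<close> at the nodes \<open>1, q, \<dots>, q\<^sup>n\<close>: among the linear
  combinations of these values it is characterised by annihilating the polynomials of degree less than \<open>n\<close>.
\<close>

definition q_difference :: "nat \<Rightarrow> (complex \<Rightarrow> complex) \<Rightarrow> complex" where
  "q_difference n F = (\<Sum>k\<le>n. qpoch q (inverse (q ^ n)) k / qpoch q q k * F (q ^ k) * q ^ k)"

text \<open>
  On \<open>t\<^sup>m\<close> the \<open>q\<close>-difference takes the value \<open>(q\<^sup>m\<^sup>+\<^sup>1\<^sup>-\<^sup>n)\<^sub>n\<close>, which contains the factor \<open>1 - q\<^sup>0\<close> when
  \<open>m < n\<close> and is bounded otherwise.
\<close>

lemma q_difference_monomial_bound: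
  "norm (\<Sum>k\<le>n. qpoch q (inverse (q ^ n)) k / qpoch q q k * (q ^ k) ^ m * q ^ k)
     \<le> (if m < n then 0 else exp (1 / (1 - norm q)))"
proof -
  have "(\<Sum>k\<le>n. qpoch q (inverse (q ^ n)) k / qpoch q q k * (q ^ k) ^ m * q ^ k)
      = (\<Sum>k\<le>n. qpoch q (inverse (q ^ n)) k / qpoch q q k * (q ^ Suc m) ^ k)"
    by (simp add: power_mult_distrib mult_ac flip: power_mult)
  also have "\<dots> = qpoch q (q ^ Suc m / q ^ n) n" by (rule finite_q_binomial)
  finally have eq: "(\<Sum>k\<le>n. qpoch q (inverse (q ^ n)) k / qpoch q q k * (q ^ k) ^ m * q ^ k) = qpoch q (q ^ Suc m / q ^ n) n" .
  show ?thesis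
  proof (cases "m < n")
    case True
    have "n = Suc m + (n - Suc m)" using True by simp
    then have "q ^ Suc m * q ^ (n - Suc m) = q ^ n" by (metis power_add)
    then have "qpoch q (q ^ Suc m / q ^ n) n = 0"
      unfolding qpoch_eq_0_iff using True by (intro exI[of _ "n - Suc m"]) auto
    then show ?thesis using True eq by simp
  next
    case False
    then have "Suc m = n + (Suc m - n)" by simp
    then have "q ^ Suc m / q ^ n = q ^ (Suc m - n)" by (metis nonzero_mult_div_cancel_left power_add power_not_zero q_nonzero)
    then have "norm (q ^ Suc m / q ^ n) \<le> 1" by (simp add: norm_power norm_q_power_le_1)
    from norm_qpoch_le[OF this, of n] False eq show ?thesis by simp
  qed
qed

text \<open>
  Only the Taylor coefficients of order at least \<open>n\<close> contribute, and by the Cauchy inequality on the circle of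
  radius \<open>r\<close> they are dominated by a geometric series that starts at \<open>r\<^sup>-\<^sup>n\<close>.
\<close>

lemma q_difference_bound:
  assumes hol: "F holomorphic_on ball 0 R" and r: "1 < r" "r < R"
    and B: "\<And>z. norm z = r \<Longrightarrow> norm (F z) \<le> B"
  shows "norm (q_difference n F) \<le> B * exp (1 / (1 - norm q)) * (r / (r - 1)) * (1 / r) ^ n"
proof -
  define E where "E = exp (1 / (1 - norm q))"
  define Fm where "Fm m = (deriv ^^ m) F 0 / fact m" for m
  have B0: "B \<ge> 0" using order_trans[OF norm_ge_zero B[of "of_real r"]] r by simp
  have Fm: "norm (Fm m) \<le> B * (1 / r) ^ m" for m
  proof -
    have "norm ((deriv ^^ m) F 0) \<le> fact m * B / r ^ m"
      by (rule Cauchy_inequality)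
         (use r B in \<open>auto intro!: holomorphic_on_imp_continuous_on holomorphic_on_subset[OF hol]\<close>)
    then show ?thesis by (simp add: Fm_def norm_divide field_simps power_one_over)
  qed
  define w where "w k = qpoch q (inverse (q ^ n)) k / qpoch q q k" for k
  have "(\<lambda>m. Fm m * (q ^ k) ^ m) sums F (q ^ k)" for k
  proof -
    have "q ^ k \<in> ball 0 R" using norm_q_power_le_1[of k] r by (simp add: norm_power)
    from holomorphic_power_series[OF hol this] show ?thesis by (simp add: Fm_def)
  qed
  then have "(\<lambda>m. \<Sum>k\<le>n. w k * (Fm m * (q ^ k) ^ m) * q ^ k) sums q_difference n F"
    unfolding q_difference_def w_def[symmetric] by (intro sums_sum sums_mult sums_mult2)
  then have sums: "(\<lambda>m. Fm m * (\<Sum>k\<le>n. w k * (q ^ k) ^ m * q ^ k)) sums q_difference n F"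
    by (simp add: sum_distrib_left mult_ac)
  define g where "g m = (if m < n then 0 else B * E * (1 / r) ^ m)" for m
  have le: "norm (Fm m * (\<Sum>k\<le>n. w k * (q ^ k) ^ m * q ^ k)) \<le> g m" for m
  proof -
    have "norm (Fm m * (\<Sum>k\<le>n. w k * (q ^ k) ^ m * q ^ k)) \<le> (B * (1 / r) ^ m) * (if m < n then 0 else E)"
      unfolding norm_mult w_def E_def
      by (intro mult_mono Fm q_difference_monomial_bound mult_nonneg_nonneg B0) (use r in auto)
    then show ?thesis by (simp add: g_def mult_ac split: if_splits)
  qed
  have "(\<lambda>m. g (m + n)) sums (B * E * (1 / r) ^ n * (1 / (1 - 1 / r)))"
    unfolding g_def using sums_mult[OF geometric_sums[of "1 / r"], of "B * E * (1 / r) ^ n"] r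
    by (simp add: power_add mult_ac)
  moreover have "(\<Sum>m<n. g m) = 0" by (simp add: g_def)
  ultimately have g: "g sums (B * E * (1 / r) ^ n * (1 / (1 - 1 / r)))"
    using sums_iff_shift[of g n] by simp
  have "norm (q_difference n F) \<le> suminf g"
    unfolding sums_unique[OF sums] by (rule norm_suminf_le[OF le]) (use g in \<open>auto simp: sums_iff\<close>)
  also have "\<dots> = B * E * (1 / r) ^ n * (1 / (1 - 1 / r))" using g by (simp add: sums_iff)
  also have "1 / (1 - 1 / r) = r / (r - 1)" using r by (simp add: field_simps)
  finally show ?thesis by (simp add: E_def mult_ac)
qed

definition inner_sum :: "(complex \<Rightarrow> complex) \<Rightarrow> complex \<Rightarrow> nat \<Rightarrow> complex" where
  "inner_sum f a n = (\<Sum>k\<le>n. qpoch q (inverse (q ^ n)) k * qpoch q (a * q ^ n) k / qpoch q q k * f (q ^ k) * q ^ k)"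

text \<open>
  Since \<open>(aq\<^sup>n)\<^sub>k = (aq\<^sup>n)\<^sub>\<infinity> / (aq\<^sup>n q\<^sup>k)\<^sub>\<infinity>\<close>, the inner sum is \<open>(aq\<^sup>n)\<^sub>\<infinity>\<close> times the \<open>q\<close>-difference of
  \<open>F(t) = f(t) / (aq\<^sup>n t)\<^sub>\<infinity>\<close>.  For large \<open>n\<close>, uniformly in \<open>|a| \<le> A\<close>, this \<open>F\<close> is holomorphic
  on the whole disc where \<open>f\<close> is and \<open>q_difference_bound\<close> applies; the finitely many remaining \<open>n\<close> only affect
  the constant.
\<close>

lemma inner_sum_bound:
  assumes hol: "f holomorphic_on ball 0 R" and r: "1 < r" "r < R"
  shows "\<exists>C\<ge>0. \<forall>a n. norm a \<le> A \<longrightarrow> norm (inner_sum f a n) \<le> C * (1 / r) ^ n"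
proof -
  obtain e where e: "e > 0" "\<And>x. norm x \<le> 1 / 2 \<Longrightarrow> e \<le> norm (qpoch_inf q x)"
    using norm_qpoch_inf_ge[of "1 / 2"] by auto
  have r0: "r > 0" using r by simp
  have "continuous_on (sphere 0 r) f"
    by (rule holomorphic_on_imp_continuous_on, rule holomorphic_on_subset[OF hol]) (use r in auto)
  then have "bounded (f ` sphere 0 r)" by (intro compact_imp_bounded compact_continuous_image) auto
  then obtain B where "B > 0" "\<forall>x\<in>f ` sphere 0 r. norm x \<le> B"
    unfolding bounded_pos by blast
  then have B: "\<And>z. norm z = r \<Longrightarrow> norm (f z) \<le> B" and B0: "B > 0" by auto
  define A' where "A' = max A 1"
  have A': "A' \<ge> 1" "A \<le> A'" by (auto simp: A'_def)
  \<comment> \<open>beyond \<open>n0\<close> the argument \<open>a q\<^sup>n t\<close> stays in the disc of radius \<open>1/2\<close>, where \<open>(x)\<^sub>\<infinity>\<close> is bounded below by \<open>e\<close>\<close>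
  obtain n0 where n0: "norm q ^ n0 < 1 / (2 * R * A')"
    using real_arch_pow_inv[of "1 / (2 * R * A')" "norm q"] q_lt_1 A' r by auto
  define E where "E = exp (A' / (1 - norm q))"
  define C1 where "C1 = E * (B / e * exp (1 / (1 - norm q)) * (r / (r - 1)))"
  have large: "norm (inner_sum f a n) \<le> C1 * (1 / r) ^ n" if a: "norm a \<le> A" and n: "n \<ge> n0" for a n
  proof -
    define x where "x = a * q ^ n"
    have aA: "norm a \<le> A'" using a A' by simp
    have qn: "norm q ^ n \<le> norm q ^ n0" using n q_lt_1 by (intro power_decreasing) auto
    have xR: "norm x * R \<le> 1 / 2"
    proof -
      have "norm x * R \<le> A' * norm q ^ n0 * R"
        unfolding x_def norm_mult norm_power using aA qn r A' by (intro mult_right_mono mult_mono) auto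
      also have "\<dots> \<le> A' * (1 / (2 * R * A')) * R" using n0 A' r by (intro mult_right_mono mult_left_mono) auto
      also have "\<dots> = 1 / 2" using A' r by simp
      finally show ?thesis .
    qed
    have xz: "norm (x * z) \<le> 1 / 2" if "norm z \<le> R" for z
    proof -
      have "norm (x * z) \<le> norm x * R" unfolding norm_mult using that by (intro mult_left_mono) auto
      then show ?thesis using xR by simp
    qed
    have nzx: "qpoch_inf q (x * z) \<noteq> 0" if "norm z \<le> R" for z
      using e(2)[OF xz[OF that]] e(1) by auto
    define F where "F z = f z / qpoch_inf q (x * z)" for z
    have holF: "F holomorphic_on ball 0 R" unfolding F_def
    proof (intro holomorphic_on_divide hol)
      show "(\<lambda>z. qpoch_inf q (x * z)) holomorphic_on ball 0 R"
        by (rule holomorphic_on_compose_gen[where g = "qpoch_inf q" and t = UNIV, unfolded o_def])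
           (auto intro: holomorphic_intros holomorphic_qpoch_inf)
    qed (use nzx in auto)
    have "norm (F z) \<le> B / e" if "norm z = r" for z
      unfolding F_def norm_divide using B[OF that] e(2)[OF xz[of z]] e(1) that r B0 by (intro frac_le) auto
    then have qd: "norm (q_difference n F) \<le> B / e * exp (1 / (1 - norm q)) * (r / (r - 1)) * (1 / r) ^ n"
      using q_difference_bound[OF holF r] by blast
    have eq: "inner_sum f a n = qpoch_inf q x * q_difference n F"
    proof -
      have "qpoch q x k = qpoch_inf q x / qpoch_inf q (x * q ^ k)" for k
        using qpoch_inf_split[of x k] nzx[of "q ^ k"] norm_q_power_le_1[of k] r by (simp add: norm_power)
      then show ?thesis
        unfolding inner_sum_def q_difference_def F_def x_def[symmetric]
        by (simp add: sum_distrib_left mult_ac)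
    qed
    have nx: "norm (qpoch_inf q x) \<le> E"
    proof -
      have "norm a * norm q ^ n \<le> A' * 1" using aA A' by (intro mult_mono norm_q_power_le_1) auto
      then show ?thesis unfolding E_def by (intro norm_qpoch_inf_le) (simp add: x_def norm_mult norm_power)
    qed
    have "norm (inner_sum f a n) \<le> E * (B / e * exp (1 / (1 - norm q)) * (r / (r - 1)) * (1 / r) ^ n)"
      unfolding eq norm_mult by (intro mult_mono nx qd) (auto simp: E_def)
    then show ?thesis by (simp add: C1_def mult_ac)
  qed
  define K where "K n = (\<Sum>k\<le>n. norm (qpoch q (inverse (q ^ n)) k) * E / norm (qpoch q q k) * norm (f (q ^ k)) * norm (q ^ k))" for n
  have small: "norm (inner_sum f a n) \<le> K n" if a: "norm a \<le> A" for a n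
    unfolding inner_sum_def K_def
  proof (rule sum_norm_le)
    fix k
    have aA: "norm a \<le> A'" using a A' by simp
    have "norm a * norm q ^ n \<le> A' * 1" using aA A' by (intro mult_mono norm_q_power_le_1) auto
    then have "norm (qpoch q (a * q ^ n) k) \<le> E"
      unfolding E_def by (intro norm_qpoch_le) (simp add: norm_mult norm_power)
    then show "norm (qpoch q (inverse (q ^ n)) k * qpoch q (a * q ^ n) k / qpoch q q k * f (q ^ k) * q ^ k)
      \<le> norm (qpoch q (inverse (q ^ n)) k) * E / norm (qpoch q q k) * norm (f (q ^ k)) * norm (q ^ k)"
      unfolding norm_mult norm_divide
      by (intro mult_right_mono divide_right_mono mult_left_mono) auto
  qed
  have K0: "K n \<ge> 0" for n unfolding K_def E_def by (intro sum_nonneg) auto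
  define C where "C = C1 + (\<Sum>n<n0. K n * r ^ n)"
  have C1: "C1 \<ge> 0" unfolding C1_def E_def using e B0 r by auto
  have sum0: "(\<Sum>n<n0. K n * r ^ n) \<ge> 0" using K0 r0 by (intro sum_nonneg) auto
  show ?thesis
  proof (intro exI[of _ C] conjI allI impI)
    show "C \<ge> 0" using C1 sum0 by (simp add: C_def)
    fix a :: complex and n assume a: "norm a \<le> A"
    show "norm (inner_sum f a n) \<le> C * (1 / r) ^ n"
    proof (cases "n \<ge> n0")
      case True
      have "C1 * (1 / r) ^ n \<le> C * (1 / r) ^ n"
        using sum0 r0 by (intro mult_right_mono) (auto simp: C_def)
      then show ?thesis using large[OF a True] by simp
    next
      case False
      have "K n * r ^ n \<le> (\<Sum>n<n0. K n * r ^ n)"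
        using False K0 r0 by (intro member_le_sum) auto
      then have "K n * r ^ n \<le> C" using C1 by (simp add: C_def)
      then have "K n \<le> C * (1 / r) ^ n" using r0 by (simp add: field_simps power_one_over)
      then show ?thesis using small[OF a, of n] by simp
    qed
  qed
qed

end

section \<open>The two sides cleared of denominators\<close>

definition vec4 :: "complex \<Rightarrow> complex \<Rightarrow> complex \<Rightarrow> complex \<Rightarrow> complex ^ 4" where
  "vec4 a b c d = (\<chi> i. if i = 1 then a else if i = 2 then b else if i = 3 then c else d)"

lemma vec4_nth [simp]: "vec4 a b c d $ 1 = a" "vec4 a b c d $ 2 = b" "vec4 a b c d $ 3 = c" "vec4 a b c d $ 4 = d"
  by (simp_all add: vec4_def)

lemma sev_eventually_bounded:
  assumes "F sev_holomorphic_on S" "p \<in> S" "norm (F p) < K"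
  shows "\<forall>\<^sub>F x in nhds p. norm (F x) \<le> K"
proof -
  have "isCont (\<lambda>x. norm (F x)) p" using sev_holomorphic_on_isCont[OF assms(1,2)] by (intro continuous_intros)
  then have "((\<lambda>x. norm (F x)) \<longlongrightarrow> norm (F p)) (nhds p)"
    using tendsto_at_iff_tendsto_nhds[of "\<lambda>x. norm (F x)" p] by (simp add: isCont_def)
  from order_tendstoD(2)[OF this assms(3)] show ?thesis by eventually_elim auto
qed

context q_in_disc begin

lemma sev_holomorphic_on_qpoch [sev_intros]:
  "F sev_holomorphic_on S \<Longrightarrow> (\<lambda>x. qpoch q (F x) n) sev_holomorphic_on S"
  unfolding qpoch_def by (intro sev_intros)

lemma sev_holomorphic_on_qpoch_inf [sev_intros]:
  "F sev_holomorphic_on S \<Longrightarrow> (\<lambda>x. qpoch_inf q (F x)) sev_holomorphic_on S"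
  by (rule sev_holomorphic_on_compose[OF _ holomorphic_qpoch_inf]) auto

lemma sev_holomorphic_on_inner_sum [sev_intros]:
  "F sev_holomorphic_on S \<Longrightarrow> (\<lambda>x. inner_sum f (F x) n) sev_holomorphic_on S"
  unfolding inner_sum_def by (intro sev_intros) auto

text \<open>
  The term of the left-hand side times \<open>(aq/b)\<^sub>\<infinity> (aq/c)\<^sub>\<infinity> (aq/d)\<^sub>\<infinity>\<close>, with the denominators absorbed
  by \<open>(aq/b)\<^sub>\<infinity> / (aq/b)\<^sub>n = (aq\<^sup>n\<^sup>+\<^sup>1/b)\<^sub>\<infinity>\<close>.  The product \<open>(d)\<^sub>n u\<^sup>n\<close> is kept together as it
  remains bounded when \<open>d \<rightarrow> \<infinity>\<close>.
\<close>

definition series_term where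
  "series_term f a b c d n =
     (1 - a * q ^ (2 * n)) * (qpoch q a n * qpoch q b n * qpoch q c n) / qpoch q q n
     * (qpoch_inf q (a * q / b * q ^ n) * qpoch_inf q (a * q / c * q ^ n) * qpoch_inf q (a * q / d * q ^ n))
     * inner_sum f a n * (qpoch q d n * (a * q / (b * c * d)) ^ n)"

text \<open>
  The contributions of the nodes \<open>q\<^sup>n\<close> and \<open>u q\<^sup>n\<close> to the Jackson integral, multiplied by
  \<open>(b)\<^sub>\<infinity> (c)\<^sub>\<infinity> (d)\<^sub>\<infinity> (aq/bc)\<^sub>\<infinity> (aq/bd)\<^sub>\<infinity> (aq/cd)\<^sub>\<infinity>\<close>, which cancels all denominators of the integrand.  The factors
  \<open>(d)\<^sub>n (sdq\<^sup>n)\<^sub>\<infinity>\<close> and \<open>u (d)\<^sub>\<infinity>\<close> are put last because they alone are unbounded when \<open>d \<rightarrow> \<infinity>\<close>.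
\<close>

definition node1_term where
  "node1_term f a b c d n =
     q ^ n * f (q ^ n) * (qpoch_inf q (a * q / (b * c)) * qpoch_inf q (a * q / (b * d)) * qpoch_inf q (a * q / (c * d)))
     * (qpoch q b n * qpoch q c n) * qpoch_inf q (q * q ^ n) * (qpoch q d n * qpoch_inf q (b * c * d / a * q ^ n))"

definition node2_term where
  "node2_term f a b c d n =
     q ^ n * f (a * q / (b * c * d) * q ^ n) * (qpoch_inf q b * qpoch_inf q c)
     * (qpoch q (a * q / (b * c)) n * qpoch q (a * q / (b * d)) n * qpoch q (a * q / (c * d)) n)
     * (qpoch_inf q (q * q ^ n) * qpoch_inf q (a * q / (b * c * d) * (q * q ^ n)))
     * (a * q / (b * c * d) * qpoch_inf q d)"

lemma norm_mult_q_power_le: "norm x \<le> B \<Longrightarrow> norm (x * q ^ n) \<le> B"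
  using mult_mono[of "norm x" B "norm q ^ n" 1] norm_q_power_le_1[of n] order_trans[OF norm_ge_zero, of x B]
  by (simp add: norm_mult norm_power)

lemma norm_qpoch_inf_shift_le: "norm x \<le> B \<Longrightarrow> norm (qpoch_inf q (x * q ^ n)) \<le> exp (B / (1 - norm q))"
  by (intro norm_qpoch_inf_le norm_mult_q_power_le)

text \<open>
  In this bound and in those for the two families of nodes, \<open>d\<close> enters the hypotheses only through its reciprocal, so that they serve both
  for local bounds in the parameters and for the limit \<open>d \<rightarrow> \<infinity>\<close>.
\<close>

lemma series_term_bound:
  assumes hol: "f holomorphic_on ball 0 R" and r: "1 < r" "r < R" and B: "B \<ge> 0"
  shows "\<exists>C\<ge>0. \<forall>a b c d n. norm a \<le> B \<and> norm b \<le> B \<and> norm c \<le> B \<and>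
           norm (a * q / b) \<le> B \<and> norm (a * q / c) \<le> B \<and> norm (a * q / d) \<le> B \<longrightarrow>
           norm (series_term f a b c d n) \<le> C * (1 / r) ^ n * norm (qpoch q d n * (a * q / (b * c * d)) ^ n)"
proof -
  obtain C0 where C0: "C0 \<ge> 0" "\<And>a n. norm a \<le> B \<Longrightarrow> norm (inner_sum f a n) \<le> C0 * (1 / r) ^ n"
    using inner_sum_bound[OF hol r, of B] by blast
  obtain e where e: "e > 0" "\<And>x n. norm x \<le> norm q \<Longrightarrow> e \<le> norm (qpoch q x n)"
    using norm_qpoch_ge[OF q_lt_1] by blast
  define E where "E = exp (B / (1 - norm q))"
  have E: "E \<ge> 0" by (simp add: E_def)
  define C where "C = (1 + B) * (E * E * E) / e * (E * E * E) * C0"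
  show ?thesis
  proof (intro exI[of _ C] conjI allI impI)
    show "C \<ge> 0" unfolding C_def using B E e C0 by auto
    fix a b c d n
    assume *: "norm a \<le> B \<and> norm b \<le> B \<and> norm c \<le> B \<and>
           norm (a * q / b) \<le> B \<and> norm (a * q / c) \<le> B \<and> norm (a * q / d) \<le> B"
    have 1: "norm (1 - a * q ^ (2 * n)) \<le> 1 + B"
      using norm_triangle_ineq4[of 1 "a * q ^ (2 * n)"] norm_mult_q_power_le[of a B "2 * n"] * by simp
    have "norm (series_term f a b c d n) \<le>
       ((1 + B) * (E * E * E) / e * (E * E * E) * (C0 * (1 / r) ^ n)) * norm (qpoch q d n * (a * q / (b * c * d)) ^ n)"
      unfolding series_term_def norm_mult[of _ "qpoch q d n * _"]
    proof (rule mult_right_mono)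
      show "norm ((1 - a * q ^ (2 * n)) * (qpoch q a n * qpoch q b n * qpoch q c n) / qpoch q q n
     * (qpoch_inf q (a * q / b * q ^ n) * qpoch_inf q (a * q / c * q ^ n) * qpoch_inf q (a * q / d * q ^ n))
     * inner_sum f a n) \<le> (1 + B) * (E * E * E) / e * (E * E * E) * (C0 * (1 / r) ^ n)"
        unfolding norm_mult norm_divide
        by (intro mult_mono frac_le 1 mult_nonneg_nonneg divide_nonneg_nonneg norm_ge_zero C0(2) e(2)
              norm_qpoch_le[of _ B, folded E_def] norm_qpoch_inf_shift_le[of _ B, folded E_def] E)
           (use * B e r C0 in auto)
    qed auto
    then show "norm (series_term f a b c d n) \<le> C * (1 / r) ^ n * norm (qpoch q d n * (a * q / (b * c * d)) ^ n)"
      by (simp add: C_def mult_ac)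
  qed
qed

lemma bounded_on_cball:
  assumes "f holomorphic_on ball 0 R" "\<rho> < R"
  shows "\<exists>K\<ge>0. \<forall>z. norm z \<le> \<rho> \<longrightarrow> norm (f z) \<le> (K :: real)"
proof -
  have "continuous_on (cball 0 \<rho>) f"
    by (rule holomorphic_on_imp_continuous_on, rule holomorphic_on_subset[OF assms(1)]) (use assms in auto)
  then have "bounded (f ` cball 0 \<rho>)" by (intro compact_imp_bounded compact_continuous_image) auto
  then obtain K where "K > 0" "\<forall>x\<in>f ` cball 0 \<rho>. norm x \<le> K"
    unfolding bounded_pos by blast
  then show ?thesis by (intro exI[of _ K]) auto
qed

lemma node1_term_bound:
  assumes hol: "f holomorphic_on ball 0 R" and R: "1 < R" and B: "B \<ge> 1"
  shows "\<exists>C\<ge>0. \<forall>a b c d n. norm a \<le> B \<and> norm b \<le> B \<and> norm c \<le> B \<and>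
           norm (a * q / (b * c)) \<le> B \<and> norm (a * q / (b * d)) \<le> B \<and> norm (a * q / (c * d)) \<le> B \<longrightarrow>
           norm (node1_term f a b c d n) \<le> C * norm q ^ n * norm (qpoch q d n * qpoch_inf q (b * c * d / a * q ^ n))"
proof -
  obtain K where K: "K \<ge> 0" "\<And>z. norm z \<le> 1 \<Longrightarrow> norm (f z) \<le> K"
    using bounded_on_cball[OF hol R] by blast
  define E where "E = exp (B / (1 - norm q))"
  have E: "E \<ge> 0" by (simp add: E_def)
  define C where "C = K * (E * E * E) * (E * E) * E"
  show ?thesis
  proof (intro exI[of _ C] conjI allI impI)
    show "C \<ge> 0" unfolding C_def using E K by auto
    fix a b c d n
    assume *: "norm a \<le> B \<and> norm b \<le> B \<and> norm c \<le> B \<and>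
           norm (a * q / (b * c)) \<le> B \<and> norm (a * q / (b * d)) \<le> B \<and> norm (a * q / (c * d)) \<le> B"
    have "norm (node1_term f a b c d n) \<le>
      (norm q ^ n * K * (E * E * E) * (E * E) * E) * norm (qpoch q d n * qpoch_inf q (b * c * d / a * q ^ n))"
      unfolding node1_term_def norm_mult[of _ "qpoch q d n * _"]
    proof (rule mult_right_mono)
      show "norm (q ^ n * f (q ^ n) * (qpoch_inf q (a * q / (b * c)) * qpoch_inf q (a * q / (b * d)) * qpoch_inf q (a * q / (c * d)))
     * (qpoch q b n * qpoch q c n) * qpoch_inf q (q * q ^ n)) \<le> norm q ^ n * K * (E * E * E) * (E * E) * E"
        unfolding norm_mult norm_power
        by (intro mult_mono mult_nonneg_nonneg norm_ge_zero K(2)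
              norm_qpoch_le[of _ B, folded E_def] norm_qpoch_inf_le[of _ B, folded E_def]
              norm_qpoch_inf_shift_le[of _ B, folded E_def] E)
           (use * B K q_lt_1 norm_q_power_le_1[of n] in \<open>auto simp: norm_power\<close>)
    qed auto
    then show "norm (node1_term f a b c d n) \<le> C * norm q ^ n * norm (qpoch q d n * qpoch_inf q (b * c * d / a * q ^ n))"
      by (simp add: C_def mult_ac)
  qed
qed

lemma node2_term_bound:
  assumes hol: "f holomorphic_on ball 0 R" and \<rho>: "\<rho> < R" and B: "B \<ge> 1" "\<rho> \<le> B"
  shows "\<exists>C\<ge>0. \<forall>a b c d n. norm a \<le> B \<and> norm b \<le> B \<and> norm c \<le> B \<and> norm (a * q / (b * c * d)) \<le> \<rho> \<and>
           norm (a * q / (b * c)) \<le> B \<and> norm (a * q / (b * d)) \<le> B \<and> norm (a * q / (c * d)) \<le> B \<longrightarrow>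
           norm (node2_term f a b c d n) \<le> C * norm q ^ n * norm (a * q / (b * c * d) * qpoch_inf q d)"
proof -
  obtain K where K: "K \<ge> 0" "\<And>z. norm z \<le> \<rho> \<Longrightarrow> norm (f z) \<le> K"
    using bounded_on_cball[OF hol \<rho>] by blast
  define E where "E = exp (B / (1 - norm q))"
  have E: "E \<ge> 0" by (simp add: E_def)
  define C where "C = K * (E * E) * (E * E * E) * (E * E)"
  show ?thesis
  proof (intro exI[of _ C] conjI allI impI)
    show "C \<ge> 0" unfolding C_def using E K by auto
    fix a b c d n
    assume *: "norm a \<le> B \<and> norm b \<le> B \<and> norm c \<le> B \<and> norm (a * q / (b * c * d)) \<le> \<rho> \<and>
           norm (a * q / (b * c)) \<le> B \<and> norm (a * q / (b * d)) \<le> B \<and> norm (a * q / (c * d)) \<le> B"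
    have u: "norm (a * q / (b * c * d) * (q * q ^ n)) \<le> B"
      using norm_mult_q_power_le[of "a * q / (b * c * d)" B "Suc n"] * B by simp
    have u2: "norm (a * q / (b * c * d) * q ^ n) \<le> \<rho>"
      using norm_mult_q_power_le[of "a * q / (b * c * d)" \<rho> n] * by simp
    have "norm (node2_term f a b c d n) \<le>
      (norm q ^ n * K * (E * E) * (E * E * E) * (E * E)) * norm (a * q / (b * c * d) * qpoch_inf q d)"
      unfolding node2_term_def norm_mult[of _ "a * q / (b * c * d) * qpoch_inf q d"]
    proof (rule mult_right_mono)
      show "norm (q ^ n * f (a * q / (b * c * d) * q ^ n) * (qpoch_inf q b * qpoch_inf q c)
     * (qpoch q (a * q / (b * c)) n * qpoch q (a * q / (b * d)) n * qpoch q (a * q / (c * d)) n)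
     * (qpoch_inf q (q * q ^ n) * qpoch_inf q (a * q / (b * c * d) * (q * q ^ n))))
      \<le> norm q ^ n * K * (E * E) * (E * E * E) * (E * E)"
        unfolding norm_mult[of _ "_ * _"] norm_mult[of _ "f _"] norm_mult[of _ "qpoch_inf q _"] norm_mult[of _ "qpoch q _ _"] norm_power
        by (intro mult_mono mult_nonneg_nonneg norm_ge_zero K(2) u2
              norm_qpoch_le[of _ B, folded E_def] norm_qpoch_inf_le[OF u, folded E_def]
              norm_qpoch_inf_shift_le[of _ B, folded E_def] norm_qpoch_inf_le[of _ B, folded E_def] E)
           (use * B K q_lt_1 in auto)
    qed auto
    then show "norm (node2_term f a b c d n) \<le> C * norm q ^ n * norm (a * q / (b * c * d) * qpoch_inf q d)"
      by (simp add: C_def mult_ac)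
  qed
qed

end

section \<open>Holomorphy of the cleared sides\<close>

lemma param_regionD:
  fixes p :: "complex ^ 4"
  assumes "p \<in> param_region q R"
  shows "p $ 1 \<noteq> 0" "p $ 2 \<noteq> 0" "p $ 3 \<noteq> 0" "p $ 4 \<noteq> 0" "norm (p $ 1 * q / (p $ 2 * p $ 3 * p $ 4)) < R"
  using assms by (auto simp: param_region_def)

lemma open_param_region: "open (param_region q R)"
proof -
  define T where "T = {p :: complex ^ 4. p $ 1 \<noteq> 0 \<and> p $ 2 \<noteq> 0 \<and> p $ 3 \<noteq> 0 \<and> p $ 4 \<noteq> 0}"
  have T: "open T" unfolding T_def
    by (intro open_Collect_conj open_Collect_neq continuous_intros)
  have "continuous_on T (\<lambda>p. norm (p $ 1 * q / (p $ 2 * p $ 3 * p $ 4)))"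
    by (intro continuous_intros) (auto simp: T_def)
  then have "open (T \<inter> (\<lambda>p. norm (p $ 1 * q / (p $ 2 * p $ 3 * p $ 4))) -` {..<R})"
    using T by (intro continuous_open_preimage) auto
  also have "T \<inter> (\<lambda>p. norm (p $ 1 * q / (p $ 2 * p $ 3 * p $ 4))) -` {..<R} = param_region q R"
    by (auto simp: T_def param_region_def)
  finally show ?thesis .
qed

context q_in_disc begin

text \<open>
  Near a point of the region all monomials in the parameters that occur as arguments are bounded, and \<open>|u|\<close>
  stays below some \<open>\<rho> < R\<close>.
\<close>

lemma param_region_local_bounds:
  assumes p: "p \<in> param_region q R" and R: "R > 1"
  obtains B \<rho> where "B \<ge> 1" "0 \<le> \<rho>" "\<rho> < R" "\<rho> \<le> B"
    "\<forall>\<^sub>F x in nhds p. norm (x $ 1) \<le> B \<and> norm (x $ 2) \<le> B \<and> norm (x $ 3) \<le> B \<and> norm (x $ 4) \<le> B \<and>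
       norm (x $ 1 * q / x $ 2) \<le> B \<and> norm (x $ 1 * q / x $ 3) \<le> B \<and> norm (x $ 1 * q / x $ 4) \<le> B \<and>
       norm (x $ 1 * q / (x $ 2 * x $ 3)) \<le> B \<and> norm (x $ 1 * q / (x $ 2 * x $ 4)) \<le> B \<and>
       norm (x $ 1 * q / (x $ 3 * x $ 4)) \<le> B \<and> norm (x $ 2 * x $ 3 * x $ 4 / x $ 1) \<le> B \<and>
       norm (x $ 1 * q / (x $ 2 * x $ 3 * x $ 4)) \<le> \<rho>"
proof -
  note nz = param_regionD[OF p]
  define \<rho> where "\<rho> = (norm (p $ 1 * q / (p $ 2 * p $ 3 * p $ 4)) + R) / 2"
  have mid: "0 \<le> (x + R) / 2 \<and> (x + R) / 2 < R \<and> x < (x + R) / 2" if "0 \<le> x" "x < R" for x :: real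
    using that by (simp add: field_simps)
  have \<rho>: "0 \<le> \<rho>" "\<rho> < R" "norm (p $ 1 * q / (p $ 2 * p $ 3 * p $ 4)) < \<rho>"
    unfolding \<rho>_def using mid[OF norm_ge_zero nz(5)] by blast+
  define B where "B = 1 + \<rho> + norm (p $ 1) + norm (p $ 2) + norm (p $ 3) + norm (p $ 4)
    + norm (p $ 1 * q / p $ 2) + norm (p $ 1 * q / p $ 3) + norm (p $ 1 * q / p $ 4)
    + norm (p $ 1 * q / (p $ 2 * p $ 3)) + norm (p $ 1 * q / (p $ 2 * p $ 4)) + norm (p $ 1 * q / (p $ 3 * p $ 4))
    + norm (p $ 2 * p $ 3 * p $ 4 / p $ 1)"
  have nn: "0 \<le> norm (p $ 1)" "0 \<le> norm (p $ 2)" "0 \<le> norm (p $ 3)" "0 \<le> norm (p $ 4)"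
    "0 \<le> norm (p $ 1 * q / p $ 2)" "0 \<le> norm (p $ 1 * q / p $ 3)" "0 \<le> norm (p $ 1 * q / p $ 4)"
    "0 \<le> norm (p $ 1 * q / (p $ 2 * p $ 3))" "0 \<le> norm (p $ 1 * q / (p $ 2 * p $ 4))" "0 \<le> norm (p $ 1 * q / (p $ 3 * p $ 4))"
    "0 \<le> norm (p $ 2 * p $ 3 * p $ 4 / p $ 1)"
    by (rule norm_ge_zero)+
  have lt: "norm (p $ 1) < B" "norm (p $ 2) < B" "norm (p $ 3) < B" "norm (p $ 4) < B" "norm (p $ 1 * q / p $ 2) < B" "norm (p $ 1 * q / p $ 3) < B" "norm (p $ 1 * q / p $ 4) < B" "norm (p $ 1 * q / (p $ 2 * p $ 3)) < B" "norm (p $ 1 * q / (p $ 2 * p $ 4)) < B" "norm (p $ 1 * q / (p $ 3 * p $ 4)) < B" "norm (p $ 2 * p $ 3 * p $ 4 / p $ 1) < B"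
    using nn \<rho>(1) unfolding B_def by linarith+
  show ?thesis
  proof (rule that[of B \<rho>])
    show "B \<ge> 1" "\<rho> \<le> B" using nn \<rho> unfolding B_def by linarith+
    show "\<forall>\<^sub>F x in nhds p. norm (x $ 1) \<le> B \<and> norm (x $ 2) \<le> B \<and> norm (x $ 3) \<le> B \<and> norm (x $ 4) \<le> B \<and>
       norm (x $ 1 * q / x $ 2) \<le> B \<and> norm (x $ 1 * q / x $ 3) \<le> B \<and> norm (x $ 1 * q / x $ 4) \<le> B \<and>
       norm (x $ 1 * q / (x $ 2 * x $ 3)) \<le> B \<and> norm (x $ 1 * q / (x $ 2 * x $ 4)) \<le> B \<and>
       norm (x $ 1 * q / (x $ 3 * x $ 4)) \<le> B \<and> norm (x $ 2 * x $ 3 * x $ 4 / x $ 1) \<le> B \<and>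
       norm (x $ 1 * q / (x $ 2 * x $ 3 * x $ 4)) \<le> \<rho>"
    proof (intro eventually_conj)
      have ev: "\<forall>\<^sub>F x in nhds p. norm (F x) \<le> K"
        if "F sev_holomorphic_on param_region q R" "norm (F p) < K" for F K
        using sev_eventually_bounded[OF that(1) p that(2)] .
      show "\<forall>\<^sub>F x in nhds p. norm (x $ 1) \<le> B" "\<forall>\<^sub>F x in nhds p. norm (x $ 2) \<le> B"
        "\<forall>\<^sub>F x in nhds p. norm (x $ 3) \<le> B" "\<forall>\<^sub>F x in nhds p. norm (x $ 4) \<le> B"
        by (rule ev, intro sev_intros, rule lt)+
      show "\<forall>\<^sub>F x in nhds p. norm (x $ 1 * q / x $ 2) \<le> B" "\<forall>\<^sub>F x in nhds p. norm (x $ 1 * q / x $ 3) \<le> B"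
        "\<forall>\<^sub>F x in nhds p. norm (x $ 1 * q / x $ 4) \<le> B"
        "\<forall>\<^sub>F x in nhds p. norm (x $ 1 * q / (x $ 2 * x $ 3)) \<le> B"
        "\<forall>\<^sub>F x in nhds p. norm (x $ 1 * q / (x $ 2 * x $ 4)) \<le> B"
        "\<forall>\<^sub>F x in nhds p. norm (x $ 1 * q / (x $ 3 * x $ 4)) \<le> B"
        "\<forall>\<^sub>F x in nhds p. norm (x $ 2 * x $ 3 * x $ 4 / x $ 1) \<le> B"
        by ((rule ev, intro sev_intros, (auto simp: param_region_def)[1], rule lt)+)
      show "\<forall>\<^sub>F x in nhds p. norm (x $ 1 * q / (x $ 2 * x $ 3 * x $ 4)) \<le> \<rho>"
        by (rule ev, intro sev_intros, simp add: param_region_def, rule \<rho>(3))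
    qed
  qed (use \<rho> in auto)
qed

text \<open>
  Summable majorants near each point: geometric with ratio \<open>\<rho> / r\<close>, where \<open>|u| \<le> \<rho> < r < R\<close>, for the series,
  and with ratio \<open>|q|\<close> for the two families of nodes.
\<close>

lemma param_term_bounds:
  assumes hol: "f holomorphic_on ball 0 R" and R: "R > 1" and p: "p \<in> param_region q R"
  shows "\<exists>M. summable M \<and> (\<forall>\<^sub>F x in nhds p. \<forall>n. norm (series_term f (x $ 1) (x $ 2) (x $ 3) (x $ 4) n) \<le> M n)" (is ?A)
    and "\<exists>M. summable M \<and> (\<forall>\<^sub>F x in nhds p. \<forall>n. norm (node1_term f (x $ 1) (x $ 2) (x $ 3) (x $ 4) n) \<le> M n)" (is ?B)
    and "\<exists>M. summable M \<and> (\<forall>\<^sub>F x in nhds p. \<forall>n. norm (node2_term f (x $ 1) (x $ 2) (x $ 3) (x $ 4) n) \<le> M n)" (is ?C)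
proof -
  obtain B \<rho> where B: "B \<ge> 1" "0 \<le> \<rho>" "\<rho> < R" "\<rho> \<le> B" and ev:
    "\<forall>\<^sub>F x in nhds p. norm (x $ 1) \<le> B \<and> norm (x $ 2) \<le> B \<and> norm (x $ 3) \<le> B \<and> norm (x $ 4) \<le> B \<and>
       norm (x $ 1 * q / x $ 2) \<le> B \<and> norm (x $ 1 * q / x $ 3) \<le> B \<and> norm (x $ 1 * q / x $ 4) \<le> B \<and>
       norm (x $ 1 * q / (x $ 2 * x $ 3)) \<le> B \<and> norm (x $ 1 * q / (x $ 2 * x $ 4)) \<le> B \<and>
       norm (x $ 1 * q / (x $ 3 * x $ 4)) \<le> B \<and> norm (x $ 2 * x $ 3 * x $ 4 / x $ 1) \<le> B \<and>
       norm (x $ 1 * q / (x $ 2 * x $ 3 * x $ 4)) \<le> \<rho>"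
    using param_region_local_bounds[OF p R] by blast
  define E where "E = exp (B / (1 - norm q))"
  have E: "E \<ge> 0" by (simp add: E_def)
  define r where "r = (max 1 \<rho> + R) / 2"
  have r: "1 < r" "\<rho> < r" "r < R" using B R by (auto simp: r_def)
  show ?A
  proof -
    obtain C where C: "C \<ge> 0" "\<And>a b c d n. norm a \<le> B \<and> norm b \<le> B \<and> norm c \<le> B \<and>
           norm (a * q / b) \<le> B \<and> norm (a * q / c) \<le> B \<and> norm (a * q / d) \<le> B \<Longrightarrow>
           norm (series_term f a b c d n) \<le> C * (1 / r) ^ n * norm (qpoch q d n * (a * q / (b * c * d)) ^ n)"
      using series_term_bound[OF hol r(1,3), of B] B by force
    have "summable (\<lambda>n. C * E * (\<rho> / r) ^ n)"
      using r B by (intro summable_mult summable_geometric) auto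
    moreover have "\<forall>\<^sub>F x in nhds p. \<forall>n. norm (series_term f (x $ 1) (x $ 2) (x $ 3) (x $ 4) n) \<le> C * E * (\<rho> / r) ^ n"
      using ev
    proof eventually_elim
      case (elim x)
      show ?case
      proof
      fix n
      have "norm (series_term f (x $ 1) (x $ 2) (x $ 3) (x $ 4) n)
          \<le> C * (1 / r) ^ n * norm (qpoch q (x $ 4) n * (x $ 1 * q / (x $ 2 * x $ 3 * x $ 4)) ^ n)"
        by (rule C) (use elim in auto)
      also have "\<dots> \<le> C * (1 / r) ^ n * (E * \<rho> ^ n)"
        unfolding norm_mult[of "qpoch q (x $ 4) n"] norm_power
        by (intro mult_left_mono mult_mono power_mono norm_qpoch_le[of _ B, folded E_def]) (use elim C r E B in auto)
      finally show "norm (series_term f (x $ 1) (x $ 2) (x $ 3) (x $ 4) n) \<le> C * E * (\<rho> / r) ^ n"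
        by (simp add: power_divide mult_ac)
      qed
    qed
    ultimately show ?thesis by blast
  qed
  show ?B
  proof -
    obtain C where C: "C \<ge> 0" "\<And>a b c d n. norm a \<le> B \<and> norm b \<le> B \<and> norm c \<le> B \<and>
           norm (a * q / (b * c)) \<le> B \<and> norm (a * q / (b * d)) \<le> B \<and> norm (a * q / (c * d)) \<le> B \<Longrightarrow>
           norm (node1_term f a b c d n) \<le> C * norm q ^ n * norm (qpoch q d n * qpoch_inf q (b * c * d / a * q ^ n))"
      using node1_term_bound[OF hol R, of B] B by force
    have "summable (\<lambda>n. C * (E * E) * norm q ^ n)"
      using q_lt_1 by (intro summable_mult summable_geometric) auto
    moreover have "\<forall>\<^sub>F x in nhds p. \<forall>n. norm (node1_term f (x $ 1) (x $ 2) (x $ 3) (x $ 4) n) \<le> C * (E * E) * norm q ^ n"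
      using ev
    proof eventually_elim
      case (elim x)
      show ?case
      proof
      fix n
      have "norm (node1_term f (x $ 1) (x $ 2) (x $ 3) (x $ 4) n)
          \<le> C * norm q ^ n * norm (qpoch q (x $ 4) n * qpoch_inf q (x $ 2 * x $ 3 * x $ 4 / x $ 1 * q ^ n))"
        by (rule C) (use elim in auto)
      also have "\<dots> \<le> C * norm q ^ n * (E * E)"
        unfolding norm_mult[of "qpoch q (x $ 4) n"]
        by (intro mult_left_mono mult_mono norm_qpoch_le[of _ B, folded E_def]
              norm_qpoch_inf_shift_le[of _ B, folded E_def]) (use elim C E in auto)
      finally show "norm (node1_term f (x $ 1) (x $ 2) (x $ 3) (x $ 4) n) \<le> C * (E * E) * norm q ^ n"
        by (simp add: mult_ac)
      qed
    qed
    ultimately show ?thesis by blast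
  qed
  show ?C
  proof -
    obtain C where C: "C \<ge> 0" "\<And>a b c d n. norm a \<le> B \<and> norm b \<le> B \<and> norm c \<le> B \<and> norm (a * q / (b * c * d)) \<le> \<rho> \<and>
           norm (a * q / (b * c)) \<le> B \<and> norm (a * q / (b * d)) \<le> B \<and> norm (a * q / (c * d)) \<le> B \<Longrightarrow>
           norm (node2_term f a b c d n) \<le> C * norm q ^ n * norm (a * q / (b * c * d) * qpoch_inf q d)"
      using node2_term_bound[OF hol B(3) B(1) B(4)] by blast
    have "summable (\<lambda>n. C * (B * E) * norm q ^ n)"
      using q_lt_1 by (intro summable_mult summable_geometric) auto
    moreover have "\<forall>\<^sub>F x in nhds p. \<forall>n. norm (node2_term f (x $ 1) (x $ 2) (x $ 3) (x $ 4) n) \<le> C * (B * E) * norm q ^ n"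
      using ev
    proof eventually_elim
      case (elim x)
      show ?case
      proof
      fix n
      have "norm (node2_term f (x $ 1) (x $ 2) (x $ 3) (x $ 4) n)
          \<le> C * norm q ^ n * norm (x $ 1 * q / (x $ 2 * x $ 3 * x $ 4) * qpoch_inf q (x $ 4))"
        by (rule C) (use elim in auto)
      also have "\<dots> \<le> C * norm q ^ n * (B * E)"
        unfolding norm_mult[of _ "qpoch_inf q (x $ 4)"]
        by (intro mult_left_mono mult_mono norm_qpoch_inf_le[of _ B, folded E_def]) (use elim C E B in auto)
      finally show "norm (node2_term f (x $ 1) (x $ 2) (x $ 3) (x $ 4) n) \<le> C * (B * E) * norm q ^ n"
        by (simp add: mult_ac)
      qed
    qed
    ultimately show ?thesis by blast
  qed
qed

definition series_fun where
  "series_fun f p = (\<Sum>n. series_term f (p $ 1) (p $ 2) (p $ 3) (p $ 4) n)"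

definition nodes_fun where
  "nodes_fun f p = qpoch_inf q (p $ 1) *
     ((\<Sum>n. node1_term f (p $ 1) (p $ 2) (p $ 3) (p $ 4) n) - (\<Sum>n. node2_term f (p $ 1) (p $ 2) (p $ 3) (p $ 4) n))"

lemma series_term_sev:
  "(\<lambda>x. series_term f (x $ 1) (x $ 2) (x $ 3) (x $ 4) n) sev_holomorphic_on param_region q R"
  unfolding series_term_def by (intro sev_intros) (auto simp: param_region_def)

lemma node1_term_sev:
  "(\<lambda>x. node1_term f (x $ 1) (x $ 2) (x $ 3) (x $ 4) n) sev_holomorphic_on param_region q R"
  unfolding node1_term_def by (intro sev_intros) (auto simp: param_region_def)

lemma node2_term_sev:
  assumes hol: "f holomorphic_on ball 0 R"
  shows "(\<lambda>x. node2_term f (x $ 1) (x $ 2) (x $ 3) (x $ 4) n) sev_holomorphic_on param_region q R"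
proof -
  have *: "(\<lambda>x. f (x $ 1 * q / (x $ 2 * x $ 3 * x $ 4) * q ^ n)) sev_holomorphic_on param_region q R"
  proof (rule sev_holomorphic_on_compose[OF _ hol])
    show "(\<lambda>x. x $ 1 * q / (x $ 2 * x $ 3 * x $ 4) * q ^ n) sev_holomorphic_on param_region q R"
      by (intro sev_intros) (auto simp: param_region_def)
    fix x assume "x \<in> param_region q R"
    from param_regionD(5)[OF this] show "x $ 1 * q / (x $ 2 * x $ 3 * x $ 4) * q ^ n \<in> ball 0 R"
      using norm_mult_q_power_le[OF order_refl, of "x $ 1 * q / (x $ 2 * x $ 3 * x $ 4)" n] by (simp only: mem_ball_0)
  qed auto
  show ?thesis
    unfolding node2_term_def by (intro sev_intros *) (auto simp: param_region_def)
qed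

lemma series_fun_sev:
  assumes "f holomorphic_on ball 0 R" "R > 1"
  shows "series_fun f sev_holomorphic_on param_region q R"
proof -
  have "(\<lambda>x. \<Sum>n. series_term f (x $ 1) (x $ 2) (x $ 3) (x $ 4) n) sev_holomorphic_on param_region q R"
    by (rule sev_holomorphic_on_suminf[OF open_param_region series_term_sev])
       (rule param_term_bounds(1)[OF assms])
  then show ?thesis by (simp add: series_fun_def[abs_def])
qed

lemma nodes_fun_sev:
  assumes "f holomorphic_on ball 0 R" "R > 1"
  shows "nodes_fun f sev_holomorphic_on param_region q R"
proof -
  have 1: "(\<lambda>x. \<Sum>n. node1_term f (x $ 1) (x $ 2) (x $ 3) (x $ 4) n) sev_holomorphic_on param_region q R"
    by (rule sev_holomorphic_on_suminf[OF open_param_region node1_term_sev])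
       (rule param_term_bounds(2)[OF assms])
  have 2: "(\<lambda>x. \<Sum>n. node2_term f (x $ 1) (x $ 2) (x $ 3) (x $ 4) n) sev_holomorphic_on param_region q R"
    by (rule sev_holomorphic_on_suminf[OF open_param_region node2_term_sev[OF assms(1)]])
       (rule param_term_bounds(3)[OF assms])
  show ?thesis unfolding nodes_fun_def[abs_def]
    by (rule sev_holomorphic_on_mult[OF sev_holomorphic_on_qpoch_inf[OF sev_holomorphic_on_nth]
          sev_holomorphic_on_diff[OF 1 2]])
qed

lemma param_summable:
  assumes hol: "f holomorphic_on ball 0 R" and R: "R > 1" and p: "p \<in> param_region q R"
  shows "summable (series_term f (p $ 1) (p $ 2) (p $ 3) (p $ 4))"
    "summable (node1_term f (p $ 1) (p $ 2) (p $ 3) (p $ 4))"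
    "summable (node2_term f (p $ 1) (p $ 2) (p $ 3) (p $ 4))"
proof -
  have *: "summable (t p)" if ex: "\<exists>M. summable M \<and> (\<forall>\<^sub>F x in nhds p. \<forall>n. norm (t x n) \<le> M n)"
    for t :: "complex ^ 4 \<Rightarrow> nat \<Rightarrow> complex"
  proof -
    from ex obtain M where M: "summable M" and ev: "\<forall>\<^sub>F x in nhds p. \<forall>n. norm (t x n) \<le> M n"
      by (elim exE conjE)
    have le: "norm (t p n) \<le> M n" for n using eventually_nhds_x_imp_x[OF ev] by (rule spec)
    show ?thesis by (rule summable_comparison_test'[OF M le])
  qed
  show "summable (series_term f (p $ 1) (p $ 2) (p $ 3) (p $ 4))"
    "summable (node1_term f (p $ 1) (p $ 2) (p $ 3) (p $ 4))"
    "summable (node2_term f (p $ 1) (p $ 2) (p $ 3) (p $ 4))"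
    by (rule *[of "\<lambda>x. series_term f (x $ 1) (x $ 2) (x $ 3) (x $ 4)", OF param_term_bounds(1)[OF hol R p]]
          *[of "\<lambda>x. node1_term f (x $ 1) (x $ 2) (x $ 3) (x $ 4)", OF param_term_bounds(2)[OF hol R p]]
          *[of "\<lambda>x. node2_term f (x $ 1) (x $ 2) (x $ 3) (x $ 4)", OF param_term_bounds(3)[OF hol R p]])+
qed

end

section \<open>Two sequences of zeros of the defect\<close>

context q_in_disc begin

definition defect where
  "defect f p = series_fun f p * (qpoch_inf q (p $ 1 * q / (p $ 2 * p $ 3 * p $ 4))
       * qpoch_inf q (p $ 2 * p $ 3 * p $ 4 / p $ 1) * qpoch_inf q q) - nodes_fun f p"

lemma defect_sev:
  assumes "f holomorphic_on ball 0 R" "R > 1"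
  shows "defect f sev_holomorphic_on param_region q R"
  unfolding defect_def[abs_def]
  by (intro sev_intros series_fun_sev nodes_fun_sev assms) (auto simp: param_region_def)

text \<open>
  Interchange of the two summations, which is legitimate here because the outer sum is finite as well.
\<close>

lemma inner_sum_exchange:
  "(\<Sum>n\<le>N. t n * inner_sum f a n) =
     (\<Sum>k\<le>N. f (q ^ k) * q ^ k / qpoch q q k *
        (\<Sum>n=k..N. t n * (qpoch q (inverse (q ^ n)) k * qpoch q (a * q ^ n) k)))"
proof -
  define g where "g n k = t n * (qpoch q (inverse (q ^ n)) k * qpoch q (a * q ^ n) k) * (f (q ^ k) * q ^ k / qpoch q q k)" for n k
  have "(\<Sum>n\<le>N. t n * inner_sum f a n) = (\<Sum>n\<le>N. \<Sum>k\<le>n. g n k)"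
    by (simp add: inner_sum_def g_def sum_distrib_left mult_ac)
  also have "\<dots> = (\<Sum>n\<le>N. \<Sum>k\<in>{..N} \<inter> {k. k \<le> n}. g n k)"
    by (intro sum.cong) auto
  also have "\<dots> = (\<Sum>n\<le>N. \<Sum>k\<le>N. if k \<le> n then g n k else 0)"
    by (simp add: sum.inter_restrict)
  also have "\<dots> = (\<Sum>k\<le>N. \<Sum>n\<le>N. if k \<le> n then g n k else 0)"
    by (rule sum.swap)
  also have "\<dots> = (\<Sum>k\<le>N. \<Sum>n\<in>{..N} \<inter> {n. k \<le> n}. g n k)"
    by (simp add: sum.inter_restrict)
  also have "\<dots> = (\<Sum>k\<le>N. \<Sum>n=k..N. g n k)"
    by (intro sum.cong) auto
  finally show ?thesis by (simp add: g_def sum_distrib_left mult_ac)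
qed

text \<open>
  For \<open>d = q\<^sup>-\<^sup>N\<close> the factor \<open>(d)\<^sub>n\<close> cuts all sums off at \<open>N\<close> and \<open>(d)\<^sub>\<infinity> = 0\<close> removes the nodes \<open>u q\<^sup>n\<close>, so
  the claim is an identity between linear combinations of \<open>f(1), \<dots>, f(q\<^sup>N)\<close>; it holds coefficient by coefficient.
\<close>

lemma defect_terminating:
  fixes a b c :: complex
  assumes nz: "a \<noteq> 0" "b \<noteq> 0" "c \<noteq> 0"
    and A: "\<And>j. a * q ^ Suc j \<noteq> 1"
    and B: "\<And>n. qpoch q (a * q / b) n \<noteq> 0" and C: "\<And>n. qpoch q (a * q / c) n \<noteq> 0"
    and BC: "\<And>k. qpoch q (b * c / a / q ^ N) k \<noteq> 0"
    and d: "d = inverse (q ^ N)"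
  shows "defect f (vec4 a b c d) = 0"
proof -
  define s where "s = b * c / a"
  define u where "u = a * q / (b * c * d)"
  have sd: "b * c * d / a = s / q ^ N" by (simp add: s_def d divide_inverse mult_ac)
  have aqd: "a * q / d = a * q ^ Suc N" by (simp add: d divide_inverse mult_ac)
  have D: "qpoch q (a * q / d) n \<noteq> 0" for n
  proof
    assume "qpoch q (a * q / d) n = 0"
    then obtain j where "a * q ^ Suc N * q ^ j = 1" unfolding aqd qpoch_eq_0_iff by blast
    then show False using A[of "N + j"] by (simp add: power_add mult_ac)
  qed
  have d_van: "qpoch q d n = 0" if "n > N" for n
    unfolding qpoch_eq_0_iff using that by (intro exI[of _ N]) (simp add: d)
  have d_inf: "qpoch_inf q d = 0"
    unfolding qpoch_inf_eq_0_iff by (intro exI[of _ N]) (simp add: d)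
  have shift: "qpoch_inf q (x * q ^ n) = qpoch_inf q x / qpoch q x n" if "qpoch q x n \<noteq> 0" for x n
    using qpoch_inf_split[of x n] that by (simp add: field_simps)
  define H where "H = qpoch_inf q (a * q / b) * qpoch_inf q (a * q / c) * qpoch_inf q (a * q / d)"
  have st: "series_term f a b c d n = H * (vwp_term a b c d n * inner_sum f a n)" for n
    unfolding series_term_def vwp_term_def H_def shift[OF B] shift[OF C] shift[OF D] by (simp add: mult_ac)
  have "series_fun f (vec4 a b c d) = (\<Sum>n\<le>N. series_term f a b c d n)"
    unfolding series_fun_def by (simp, rule suminf_finite) (auto simp: series_term_def d_van)
  also have "\<dots> = H * (\<Sum>n\<le>N. vwp_term a b c d n * inner_sum f a n)"
    by (simp add: st sum_distrib_left)
  finally have S: "series_fun f (vec4 a b c d) = H * (\<Sum>n\<le>N. vwp_term a b c d n * inner_sum f a n)" .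
  have "(\<Sum>n. node2_term f a b c d n) = 0"
    by (simp add: node2_term_def d_inf)
  moreover have "(\<Sum>n. node1_term f a b c d n) = (\<Sum>n\<le>N. node1_term f a b c d n)"
    by (rule suminf_finite) (auto simp: node1_term_def d_van)
  ultimately have Nf: "nodes_fun f (vec4 a b c d) = (\<Sum>k\<le>N. qpoch_inf q a * node1_term f a b c d k)"
    by (simp add: nodes_fun_def sum_distrib_left)
  define V where "V = qpoch q a (Suc N) * qpoch q (a * q / (b * c)) N / (qpoch q (a * q / b) N * qpoch q (a * q / c) N)"
  have term_eq: "H * (f (q ^ k) * q ^ k / qpoch q q k * (V * (qpoch q b k * qpoch q c k * qpoch q d k) / qpoch q (s / q ^ N) k))
       * (qpoch_inf q u * qpoch_inf q (s / q ^ N) * qpoch_inf q q) = qpoch_inf q a * node1_term f a b c d k" for k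
  proof -
    have e1: "qpoch_inf q (a * q / b) = qpoch q (a * q / b) N * qpoch_inf q (a * q / (b * d))"
      using qpoch_inf_split[of "a * q / b" N] by (simp add: d divide_inverse mult_ac)
    have e2: "qpoch_inf q (a * q / c) = qpoch q (a * q / c) N * qpoch_inf q (a * q / (c * d))"
      using qpoch_inf_split[of "a * q / c" N] by (simp add: d divide_inverse mult_ac)
    have e3: "qpoch_inf q a = qpoch q a (Suc N) * qpoch_inf q (a * q / d)"
      using qpoch_inf_split[of a "Suc N"] unfolding aqd .
    have e4: "qpoch_inf q (a * q / (b * c)) = qpoch q (a * q / (b * c)) N * qpoch_inf q u"
      using qpoch_inf_split[of "a * q / (b * c)" N] by (simp add: u_def d divide_inverse mult_ac)
    have e5: "qpoch_inf q (s / q ^ N) = qpoch q (s / q ^ N) k * qpoch_inf q (s / q ^ N * q ^ k)"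
      by (rule qpoch_inf_split)
    have e6: "qpoch_inf q q = qpoch q q k * qpoch_inf q (q * q ^ k)"
      by (rule qpoch_inf_split)
    have "X1 * Y1 * (X2 * Y2) * Z * (F * g / qk * (A * W / (X1 * X2) * T / sk) ) * (U * (sk * sk') * (qk * qk'))
        = A * Z * (g * F * (W * U * Y1 * Y2) * T * qk' * sk')"
      if "X1 \<noteq> 0" "X2 \<noteq> 0" "qk \<noteq> 0" "sk \<noteq> 0"
      for X1 X2 Y1 Y2 Z F g qk A W T sk U sk' qk' :: complex
      using that by (simp add: divide_simps)
    note red = this[OF B[of N] C[of N] qpoch_q_nonzero[of k] BC[of k, folded s_def]]
    have "H * (f (q ^ k) * q ^ k / qpoch q q k * (V * (qpoch q b k * qpoch q c k * qpoch q d k) / qpoch q (s / q ^ N) k))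
       * (qpoch_inf q u * qpoch_inf q (s / q ^ N) * qpoch_inf q q)
      = qpoch q (a * q / b) N * qpoch_inf q (a * q / (b * d)) * (qpoch q (a * q / c) N * qpoch_inf q (a * q / (c * d))) * qpoch_inf q (a * q / d)
        * (f (q ^ k) * q ^ k / qpoch q q k * (qpoch q a (Suc N) * qpoch q (a * q / (b * c)) N / (qpoch q (a * q / b) N * qpoch q (a * q / c) N)
          * (qpoch q b k * qpoch q c k * qpoch q d k) / qpoch q (s / q ^ N) k))
        * (qpoch_inf q u * (qpoch q (s / q ^ N) k * qpoch_inf q (s / q ^ N * q ^ k)) * (qpoch q q k * qpoch_inf q (q * q ^ k)))"
      unfolding H_def V_def e1 e2 by (simp only: e5[symmetric] e6[symmetric])
    also have "\<dots> = qpoch q a (Suc N) * qpoch_inf q (a * q / d) * (q ^ k * f (q ^ k) * (qpoch q (a * q / (b * c)) N * qpoch_inf q u * qpoch_inf q (a * q / (b * d)) * qpoch_inf q (a * q / (c * d)))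
       * (qpoch q b k * qpoch q c k * qpoch q d k) * qpoch_inf q (q * q ^ k) * qpoch_inf q (s / q ^ N * q ^ k))"
      by (rule red)
    also have "\<dots> = qpoch_inf q a * node1_term f a b c d k"
      unfolding e3 e4 node1_term_def sd by (simp add: mult_ac)
    finally show ?thesis .
  qed
  have "series_fun f (vec4 a b c d) * (qpoch_inf q u * qpoch_inf q (s / q ^ N) * qpoch_inf q q)
      = (\<Sum>k\<le>N. qpoch_inf q a * node1_term f a b c d k)"
    unfolding S inner_sum_exchange term_eq[symmetric]
    by (simp add: sum_distrib_left sum_distrib_right terminating_coefficient[OF nz A B C BC _ d, folded V_def, unfolded s_def[symmetric]] s_def[symmetric] mult.assoc)
  then show ?thesis by (simp add: defect_def Nf sd u_def)
qed

text \<open>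
  The hypothesis means \<open>u = q\<^sup>j\<^sup>+\<^sup>1\<close>.  Then \<open>(q/u)\<^sub>\<infinity> = 0\<close> removes the series, the first nodes \<open>q\<^sup>n\<close>, \<open>n \<le> j\<close>,
  have weight zero, and the nodes \<open>q\<^sup>m\<^sup>+\<^sup>j\<^sup>+\<^sup>1 = u q\<^sup>m\<close> of the two families carry the same weight.
\<close>

lemma defect_lattice:
  fixes a b c d :: complex
  assumes hol: "f holomorphic_on ball 0 R" "R > 1" and p: "vec4 a b c d \<in> param_region q R"
    and j: "b * c * d / a * q ^ j = 1"
  shows "defect f (vec4 a b c d) = 0"
proof -
  have nz: "a \<noteq> 0" "b \<noteq> 0" "c \<noteq> 0" "d \<noteq> 0" using param_regionD(1-4)[OF p] by simp_all
  define J where "J = Suc j"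
  define u where "u = a * q / (b * c * d)"
  have u: "u = q ^ J" using j nz by (simp add: u_def J_def field_simps)
  have bcda: "b * c * d / a * q ^ (m + J) = q * q ^ m" for m
  proof -
    have "b * c * d / a * q ^ (m + J) = (b * c * d / a * q ^ j) * (q * q ^ m)"
      by (simp add: J_def power_add mult_ac)
    then show ?thesis unfolding j by simp
  qed
  have early: "node1_term f a b c d n = 0" if "n < J" for n
  proof -
    have "qpoch_inf q (b * c * d / a * q ^ n) = 0"
      unfolding qpoch_inf_eq_0_iff
    proof (intro exI)
      show "b * c * d / a * q ^ n * q ^ (j - n) = 1"
        using j that by (simp add: J_def mult.assoc flip: power_add)
    qed
    then show ?thesis by (simp add: node1_term_def)
  qed
  have sw: "qpoch_inf q (x * q ^ J) * qpoch q x (m + J) = qpoch q (x * q ^ J) m * qpoch_inf q x" for x m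
    using qpoch_inf_split[of x J] qpoch_add[of x J m] by (simp add: add.commute mult_ac)
  have late: "node1_term f a b c d (m + J) = node2_term f a b c d m" for m
  proof -
    have e: "a * q / (b * c) = d * q ^ J" "a * q / (b * d) = c * q ^ J" "a * q / (c * d) = b * q ^ J"
      using nz by (simp_all add: u[symmetric] u_def)
    have "node1_term f a b c d (m + J) =
       q ^ m * q ^ J * f (q ^ J * q ^ m)
        * (qpoch_inf q (d * q ^ J) * qpoch q d (m + J)) * (qpoch_inf q (c * q ^ J) * qpoch q c (m + J))
        * (qpoch_inf q (b * q ^ J) * qpoch q b (m + J))
        * (qpoch_inf q (q ^ J * (q * q ^ m)) * qpoch_inf q (q * q ^ m))"
      unfolding node1_term_def bcda e by (simp add: power_add mult_ac)
    also have "\<dots> = node2_term f a b c d m"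
      unfolding sw node2_term_def e u_def[symmetric] unfolding u by (simp add: mult_ac)
    finally show ?thesis .
  qed
  have "summable (node1_term f a b c d)" using param_summable(2)[OF hol p] by simp
  then have "(\<Sum>n. node1_term f a b c d n) = (\<Sum>m. node1_term f a b c d (m + J)) + (\<Sum>n<J. node1_term f a b c d n)"
    by (rule suminf_split_initial_segment)
  also have "\<dots> = (\<Sum>m. node2_term f a b c d m)" by (simp add: early late)
  finally have "nodes_fun f (vec4 a b c d) = 0" by (simp add: nodes_fun_def)
  moreover have "qpoch_inf q (b * c * d / a) = 0" unfolding qpoch_inf_eq_0_iff using j by blast
  ultimately show ?thesis by (simp add: defect_def)
qed

end

section \<open>An identity theorem at an isolated singularity\<close>

text \<open>
  The quotient extends over each zero of \<open>P\<close> with the value \<open>\<phi>' / P'\<close>.  Infinitely many zeros are allowed, as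
  the removal of singularities is done locally.
\<close>

lemma holomorphic_divide_simple_zeros:
  assumes S: "open S" and \<phi>: "\<phi> holomorphic_on S" and P: "P holomorphic_on S"
    and zeros: "\<And>z. z \<in> S \<Longrightarrow> P z = 0 \<Longrightarrow> \<phi> z = 0 \<and> deriv P z \<noteq> 0"
  obtains h where "h holomorphic_on S" "\<And>z. z \<in> S \<Longrightarrow> \<phi> z = P z * h z"
proof -
  define h where "h z = (if P z = 0 then deriv \<phi> z / deriv P z else \<phi> z / P z)" for z
  have eq: "\<phi> z = P z * h z" if "z \<in> S" for z using zeros[OF that] by (simp add: h_def)
  have "h field_differentiable at z" if z: "z \<in> S" for z
  proof (cases "P z = 0")
    case False
    define T where "T = {w \<in> S. P w \<noteq> 0}"
    have "open T"
    proof -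
      have "open (S \<inter> P -` (- {0}))"
        by (rule continuous_open_preimage[OF holomorphic_on_imp_continuous_on[OF P] S]) auto
      moreover have "S \<inter> P -` (- {0}) = T" by (auto simp: T_def)
      ultimately show ?thesis by simp
    qed
    have "(\<lambda>w. \<phi> w / P w) holomorphic_on T"
      by (intro holomorphic_on_divide holomorphic_on_subset[OF \<phi>] holomorphic_on_subset[OF P]) (auto simp: T_def)
    then have "h holomorphic_on T"
      by (rule holomorphic_transform) (auto simp: h_def T_def)
    moreover have "z \<in> T" using z False by (simp add: T_def)
    ultimately show ?thesis using \<open>open T\<close> by (simp add: holomorphic_on_imp_differentiable_at)
  next
    case True
    have dP: "deriv P z \<noteq> 0" and \<phi>0: "\<phi> z = 0" using zeros[OF z True] by auto
    have DP: "(P has_field_derivative deriv P z) (at z)" by (rule holomorphic_derivI[OF P S z])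
    have D\<phi>: "(\<phi> has_field_derivative deriv \<phi> z) (at z)" by (rule holomorphic_derivI[OF \<phi> S z])
    have lim: "((\<lambda>w. \<phi> w / P w) \<longlongrightarrow> deriv \<phi> z / deriv P z) (at z)"
    proof -
      have "((\<lambda>w. ((\<phi> w - \<phi> z) / (w - z)) / ((P w - P z) / (w - z))) \<longlongrightarrow> deriv \<phi> z / deriv P z) (at z)"
        by (intro tendsto_divide dP) (use DP D\<phi> in \<open>auto simp: has_field_derivative_iff\<close>)
      moreover have "\<forall>\<^sub>F w in at z. ((\<phi> w - \<phi> z) / (w - z)) / ((P w - P z) / (w - z)) = \<phi> w / P w"
        by (auto simp: True \<phi>0 eventually_at_filter)
      ultimately show ?thesis by (rule Lim_transform_eventually)
    qed
    \<comment> \<open>a zero at which the derivative does not vanish is isolated\<close>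
    have "\<forall>\<^sub>F w in at z. P w \<noteq> 0"
    proof -
      have "((\<lambda>w. (P w - P z) / (w - z)) \<longlongrightarrow> deriv P z) (at z)" using DP by (simp add: has_field_derivative_iff)
      then have "\<forall>\<^sub>F w in at z. (P w - P z) / (w - z) \<noteq> 0"
        using dP by (rule tendsto_imp_eventually_ne)
      then show ?thesis by eventually_elim (auto simp: True)
    qed
    moreover have "\<forall>\<^sub>F w in at z. w \<in> S" using S z by (rule eventually_at_in_open')
    ultimately have "\<forall>\<^sub>F w in at z. P w \<noteq> 0 \<and> w \<in> S" by eventually_elim auto
    then obtain e where e: "e > 0" "\<And>w. w \<noteq> z \<Longrightarrow> dist w z < e \<Longrightarrow> P w \<noteq> 0 \<and> w \<in> S"
      unfolding eventually_at by blast
    have sub: "ball z e \<subseteq> S" using e(2) z by (metis dist_commute mem_ball subsetI)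
    have hd: "(\<lambda>w. \<phi> w / P w) holomorphic_on ball z e - {z}"
      by (intro holomorphic_on_divide holomorphic_on_subset[OF \<phi>] holomorphic_on_subset[OF P])
         (use sub e(2) in \<open>auto simp: dist_commute\<close>)
    have heq: "h w = \<phi> w / P w" if "w \<in> ball z e - {z}" for w
      using that e(2)[of w] by (simp add: h_def dist_commute)
    have hz: "h z = deriv \<phi> z / deriv P z" by (simp add: h_def True)
    have "h holomorphic_on ball z e"
    proof (rule no_isolated_singularity'[where K = "{z}"])
      show "h holomorphic_on ball z e - {z}"
        by (rule holomorphic_transform[OF hd]) (simp add: heq)
      show "(h \<longlongrightarrow> h w) (at w within ball z e)" if "w \<in> {z}" for w
      proof -
        have "(h \<longlongrightarrow> deriv \<phi> z / deriv P z) (at z)"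
        proof (rule Lim_transform_eventually[OF lim])
          show "\<forall>\<^sub>F w in at z. \<phi> w / P w = h w"
            unfolding eventually_at using e heq by (intro exI[of _ e]) (auto simp: dist_commute)
        qed
        then show ?thesis using that hz by (auto intro: tendsto_within_subset)
      qed
    qed auto
    then show ?thesis using e(1) by (intro holomorphic_on_imp_differentiable_at[of h "ball z e"]) auto
  qed
  then have "h holomorphic_on S"
    by (auto simp: holomorphic_on_def intro: field_differentiable_at_within)
  then show ?thesis using that eq by blast
qed

text \<open>
  The region of holomorphy is a punctured disc because the lemma serves to study an isolated singularity.
\<close>

lemma maximum_modulus_annulus:
  assumes hol: "g holomorphic_on ball 0 \<rho> - {0}" and t: "0 < t" "T < \<rho>"
    and bd: "\<And>z. norm z = t \<or> norm z = T \<Longrightarrow> norm (g z) \<le> C"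
    and z: "t < norm z" "norm z < T"
  shows "norm (g z) \<le> C"
proof -
  define A where "A = ball 0 T - cball (0::complex) t"
  have opA: "open A" by (simp add: A_def open_Diff)
  have cl: "closure A \<subseteq> {w. t \<le> norm w \<and> norm w \<le> T}"
  proof (rule closure_minimal)
    have "{w::complex. t \<le> norm w \<and> norm w \<le> T} = cball 0 T - ball 0 t" by auto
    then show "closed {w::complex. t \<le> norm w \<and> norm w \<le> T}" by (simp add: closed_Diff)
  qed (auto simp: A_def)
  have sub: "closure A \<subseteq> ball 0 \<rho> - {0}" using cl t by auto
  show ?thesis
  proof (rule maximum_modulus_frontier[where S = A and f = g])
    have "A \<subseteq> ball 0 \<rho> - {0}" using sub closure_subset[of A] by (rule subset_trans[rotated])
    then show "g holomorphic_on interior A"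
      unfolding interior_open[OF opA] by (rule holomorphic_on_subset[OF hol])
    show "continuous_on (closure A) g"
      by (rule continuous_on_subset[OF holomorphic_on_imp_continuous_on[OF hol] sub])
    show "bounded A" unfolding A_def by (rule bounded_subset[of "ball 0 T"]) auto
    show "norm (g w) \<le> C" if "w \<in> frontier A" for w
    proof (rule bd)
      have "w \<in> closure A" "w \<notin> A" using that opA by (auto simp: frontier_def interior_open)
      then show "norm w = t \<or> norm w = T" using cl by (auto simp: A_def)
    qed
    show "z \<in> A" using z by (simp add: A_def)
  qed
qed

text \<open>
  A growth bound on a sequence of circles shrinking to the singularity suffices to exclude an essential singularity:
  the maximum principle on the annuli between the circles extends the bound on \<open>z\<^sup>K h(z)\<close> to a punctured neighbourhood
  of \<open>0\<close>.  Riemann's theorem then makes \<open>z\<^sup>K h(z)\<close> holomorphic at \<open>0\<close>, where its zeros accumulate.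
\<close>

lemma holomorphic_punctured_eq_0:
  fixes h :: "complex \<Rightarrow> complex" and t :: "nat \<Rightarrow> real" and x :: "nat \<Rightarrow> complex"
  assumes hol: "h holomorphic_on ball 0 \<rho> - {0}"
    and t: "\<And>m. 0 < t m" "\<And>m. t m < \<rho>" "t \<longlonglongrightarrow> 0"
    and bd: "\<And>m z. norm z = t m \<Longrightarrow> norm (z ^ K * h z) \<le> C"
    and x: "x \<longlonglongrightarrow> 0" "\<And>n. x n \<noteq> 0" "\<And>n. x n \<in> ball 0 \<rho> \<Longrightarrow> h (x n) = 0"
    and z: "z \<in> ball 0 \<rho> - {0}"
  shows "h z = 0"
proof -
  have \<rho>: "\<rho> > 0" using t(1)[of 0] t(2)[of 0] by linarith
  define g where "g z = z ^ K * h z" for z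
  have holg: "g holomorphic_on ball 0 \<rho> - {0}" unfolding g_def by (intro holomorphic_intros hol)
  have gb: "norm (g w) \<le> C" if w: "w \<noteq> 0" "norm w < t 0" for w
  proof -
    have "\<forall>\<^sub>F m in sequentially. t m < norm w" using order_tendstoD(2)[OF t(3), of "norm w"] w by simp
    then have ex: "\<exists>m. t m < norm w" by (meson eventually_sequentially order_refl)
    obtain m where tm: "t m < norm w" using ex by blast
    show ?thesis
    proof (rule maximum_modulus_annulus[OF holg t(1)[of m] t(2)[of 0] _ _ w(2)])
      show "norm (g v) \<le> C" if "norm v = t m \<or> norm v = t 0" for v
        using that bd unfolding g_def by (elim disjE)
    qed (rule tm)
  qed
  have "\<exists>G. G holomorphic_on ball 0 \<rho> \<and> (\<forall>w\<in>ball 0 \<rho> - {0}. G w = g w)"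
  proof (subst holomorphic_on_extend_bounded[OF holg])
    show "0 \<in> interior (ball 0 \<rho>)" using \<rho> by simp
    show "\<exists>B. \<forall>\<^sub>F w in at 0. norm (g w) \<le> B"
      unfolding eventually_at using gb t(1)[of 0] by (intro exI[of _ C] exI[of _ "t 0"]) auto
  qed
  then obtain G where G: "G holomorphic_on ball 0 \<rho>" "\<And>w. w \<in> ball 0 \<rho> - {0} \<Longrightarrow> G w = g w" by blast
  have "\<forall>\<^sub>F n in sequentially. x n \<in> ball 0 \<rho>"
    using tendstoD[OF x(1) \<rho>] by (simp add: dist_commute)
  then obtain N where N: "\<And>n. n \<ge> N \<Longrightarrow> x n \<in> ball 0 \<rho>" unfolding eventually_sequentially by blast
  define U where "U = (\<lambda>n. x (n + N)) ` UNIV"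
  have lp: "0 islimpt U"
    unfolding islimpt_sequential
  proof (intro exI conjI allI)
    show "x (n + N) \<in> U - {0}" for n using x(2) by (auto simp: U_def)
    show "(\<lambda>n. x (n + N)) \<longlonglongrightarrow> 0" by (rule LIMSEQ_ignore_initial_segment[OF x(1)])
  qed
  have "G z = 0"
  proof (rule analytic_continuation[OF G(1) _ _ _ _ lp])
    show "U \<subseteq> ball 0 \<rho>" using N by (auto simp: U_def)
    show "G w = 0" if "w \<in> U" for w
    proof -
      obtain n where n: "w = x (n + N)" using \<open>w \<in> U\<close> by (auto simp: U_def)
      then show ?thesis using G(2)[of w] N[of "n + N"] x(2)[of "n + N"] x(3)[of "n + N"] by (simp add: g_def)
    qed
  qed (use \<rho> z in auto)
  then show "h z = 0" using G(2)[OF z] z by (simp add: g_def)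
qed

section \<open>Growth of the defect between its zeros\<close>

context q_in_disc begin

text \<open>
  When \<open>|sd| = |q|\<^sup>1\<^sup>/\<^sup>2\<^sup>-\<^sup>M\<close>, each of the numbers \<open>s d q\<^sup>j\<close> has modulus at most \<open>|q|\<^sup>1\<^sup>/\<^sup>2\<close> or at least \<open>|q|\<^sup>-\<^sup>1\<^sup>/\<^sup>2\<close>.
  Hence each of the \<open>M\<close> factors with \<open>|s d q\<^sup>j| > 1\<close> contributes at most a fixed constant to the quotient
  \<open>(d)\<^sub>n / (sd)\<^sub>n\<close>, and the remaining factors form a convergent product.  So the quotient is at most exponential in
  \<open>M\<close>, that is, polynomial in \<open>|d|\<close>.
\<close>

lemma qpoch_ratio_bound:
  assumes s: "s \<noteq> 0" and \<kappa>: "\<kappa>\<^sup>2 = norm q" "0 < \<kappa>" "\<kappa> < 1"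
  obtains C K where "C \<ge> 0" "\<And>M n d. norm (s * d) = \<kappa> * (1 / norm q) ^ M \<Longrightarrow>
     norm (qpoch q d n) \<le> C * ((1 / norm q) ^ K) ^ M * norm (qpoch q (s * d) n)"
proof -
  define C0 where "C0 = max 1 ((1 + 1 / norm s) / (1 - \<kappa>))"
  have C0: "C0 \<ge> 1" "(1 + 1 / norm s) / (1 - \<kappa>) \<le> C0" by (auto simp: C0_def)
  obtain K where K: "C0 < (1 / norm q) ^ K"
    using real_arch_pow[of "1 / norm q" C0] q_lt_1 q_pos by (auto simp: field_simps)
  obtain e where e: "e > 0" "\<And>x n. norm x \<le> \<kappa> \<Longrightarrow> e \<le> norm (qpoch q x n)"
    using norm_qpoch_ge[OF \<kappa>(3)] by blast
  define E1 where "E1 = exp (\<kappa> / norm s / (1 - norm q))"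
  define C where "C = max 1 (E1 / e)"
  have C: "C \<ge> 1" "E1 / e \<le> C" by (auto simp: C_def)
  have outer: "norm (qpoch q d n) \<le> C0 ^ n * norm (qpoch q (s * d) n)"
    if sd: "norm (s * d) = \<kappa> * (1 / norm q) ^ M" and "n \<le> M" for d n M
    using \<open>n \<le> M\<close>
  proof (induction n)
    case (Suc n)
    define y where "y = s * d * q ^ n"
    have y: "1 / \<kappa> \<le> norm y"
    proof -
      have "1 / \<kappa> = \<kappa> * (1 / norm q)" using \<kappa> by (simp add: field_simps power2_eq_square)
      also have "\<dots> \<le> \<kappa> * (1 / norm q) ^ (M - n)"
      proof -
        have "(1 / norm q) ^ 1 \<le> (1 / norm q) ^ (M - n)"
          using Suc.prems q_lt_1 q_pos by (intro power_increasing) (auto simp: field_simps)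
        then show ?thesis using \<kappa> by (intro mult_left_mono) auto
      qed
      also have "\<dots> = norm (s * d) * norm q ^ n"
      proof -
        have "M = (M - n) + n" using Suc.prems by simp
        then have "(1 / norm q) ^ M * norm q ^ n = (1 / norm q) ^ (M - n) * ((1 / norm q) ^ n * norm q ^ n)"
          by (metis mult.assoc power_add)
        also have "(1 / norm q) ^ n * norm q ^ n = 1" using q_pos by (simp add: power_one_over)
        finally show ?thesis unfolding sd by simp
      qed
      finally show ?thesis by (simp add: y_def norm_mult norm_power)
    qed
    have y1: "1 \<le> \<kappa> * norm y" using y \<kappa> by (simp add: field_simps)
    then have y2: "1 \<le> norm y" using \<kappa> mult_right_mono[of \<kappa> 1 "norm y"] by simp
    have lower: "norm y * (1 - \<kappa>) \<le> norm (1 - y)"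
    proof -
      have "norm y - norm (1::complex) \<le> norm (y - 1)" by (rule norm_triangle_ineq2)
      then show ?thesis using y1 by (simp add: norm_minus_commute algebra_simps)
    qed
    have dq: "d * q ^ n = y / s" using s by (simp add: y_def)
    have "norm (1 - y / s) \<le> 1 + norm y / norm s"
      using norm_triangle_ineq4[of 1 "y / s"] by (simp add: norm_divide)
    also have "\<dots> \<le> norm y * (1 + 1 / norm s)" using y2 by (simp add: algebra_simps)
    also have "\<dots> \<le> norm y * (C0 * (1 - \<kappa>))"
      using C0(2) \<kappa> by (intro mult_left_mono) (auto simp: field_simps)
    also have "\<dots> = C0 * (norm y * (1 - \<kappa>))" by simp
    also have "\<dots> \<le> C0 * norm (1 - y)" using lower C0 by (intro mult_left_mono) auto
    finally have f: "norm (1 - d * q ^ n) \<le> C0 * norm (1 - s * d * q ^ n)" by (simp add: dq y_def[symmetric])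
    have "norm (qpoch q d (Suc n)) = norm (qpoch q d n) * norm (1 - d * q ^ n)"
      by (simp add: qpoch_Suc norm_mult)
    also have "\<dots> \<le> (C0 ^ n * norm (qpoch q (s * d) n)) * (C0 * norm (1 - s * d * q ^ n))"
      using Suc C0 f by (intro mult_mono) auto
    also have "\<dots> = C0 ^ Suc n * norm (qpoch q (s * d) (Suc n))"
      by (simp add: qpoch_Suc norm_mult)
    finally show ?case .
  qed simp
  have inner: "norm (qpoch q x m) \<le> C * norm (qpoch q (s * x) m)" if x: "norm (s * x) = \<kappa>" for x m
  proof -
    have "norm x = \<kappa> / norm s" using x s by (simp add: norm_mult field_simps)
    then have "norm (qpoch q x m) \<le> E1" unfolding E1_def by (intro norm_qpoch_le) simp
    also have "\<dots> = E1 / e * e" using e by simp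
    also have "\<dots> \<le> C * norm (qpoch q (s * x) m)" using C e x by (intro mult_mono) auto
    finally show ?thesis .
  qed
  show ?thesis
  proof (rule that[of C K])
    show "C \<ge> 0" using C by simp
    fix M n d assume sd: "norm (s * d) = \<kappa> * (1 / norm q) ^ M"
    have KM: "C0 ^ M \<le> ((1 / norm q) ^ K) ^ M" using K C0 by (intro power_mono) auto
    show "norm (qpoch q d n) \<le> C * ((1 / norm q) ^ K) ^ M * norm (qpoch q (s * d) n)"
    proof (cases "n \<le> M")
      case True
      have "C0 ^ n \<le> C0 ^ M" using True C0 by (intro power_increasing) auto
      also have "\<dots> \<le> 1 * ((1 / norm q) ^ K) ^ M" using KM by simp
      also have "\<dots> \<le> C * ((1 / norm q) ^ K) ^ M" using C by (intro mult_right_mono) auto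
      finally have "C0 ^ n * norm (qpoch q (s * d) n) \<le> C * ((1 / norm q) ^ K) ^ M * norm (qpoch q (s * d) n)"
        by (intro mult_right_mono) auto
      then show ?thesis using outer[OF sd True] by simp
    next
      case False
      define m where "m = n - M"
      have n: "n = M + m" using False by (simp add: m_def)
      have "norm (s * (d * q ^ M)) = \<kappa>"
      proof -
        have "norm (s * (d * q ^ M)) = norm (s * d) * norm q ^ M" by (simp add: norm_mult norm_power)
        then show ?thesis using q_pos unfolding sd by (simp add: power_one_over)
      qed
      from inner[OF this, of m] have 2: "norm (qpoch q (d * q ^ M) m) \<le> C * norm (qpoch q (s * d * q ^ M) m)"
        by (simp add: mult.assoc)
      have 1: "norm (qpoch q d M) \<le> ((1 / norm q) ^ K) ^ M * norm (qpoch q (s * d) M)"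
        using outer[OF sd order_refl] mult_right_mono[OF KM norm_ge_zero[of "qpoch q (s * d) M"]] by linarith
      have "norm (qpoch q d n) \<le> (((1 / norm q) ^ K) ^ M * norm (qpoch q (s * d) M)) * (C * norm (qpoch q (s * d * q ^ M) m))"
        unfolding n qpoch_add norm_mult using 1 2 by (intro mult_mono) auto
      then show ?thesis by (simp add: n qpoch_add norm_mult mult_ac)
    qed
  qed
qed

end

context q_in_disc begin

text \<open>
  The zeros of \<open>(s/w)\<^sub>\<infinity>\<close> are simple: exactly one factor of the product vanishes, and it does so to first order.
\<close>

lemma deriv_qpoch_inf_reciprocal:
  assumes s: "s \<noteq> 0" and z: "z \<noteq> 0" and j: "s / z * q ^ j = 1"
  shows "deriv (\<lambda>w. qpoch_inf q (s / w)) z \<noteq> 0"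
proof -
  define g where "g w = qpoch q (s / w) j * qpoch_inf q (s / w * q ^ Suc j)" for w
  have eq: "qpoch_inf q (s / w) = (1 - s / w * q ^ j) * g w" for w
    using qpoch_inf_split[of "s / w" "Suc j"] by (simp add: g_def qpoch_Suc mult_ac)
  have op: "open (- {0::complex})" by (rule open_Compl) simp
  have "g holomorphic_on - {0}"
    unfolding g_def qpoch_def
    by (intro holomorphic_intros holomorphic_on_compose_gen[OF _ holomorphic_qpoch_inf, unfolded o_def]) auto
  then have Dg: "(g has_field_derivative deriv g z) (at z)"
    using op z by (intro holomorphic_derivI) auto
  have D1: "((\<lambda>w. 1 - s / w * q ^ j) has_field_derivative s / z\<^sup>2 * q ^ j) (at z)"
    using z by (auto intro!: derivative_eq_intros simp: power2_eq_square)
  have "((\<lambda>w. (1 - s / w * q ^ j) * g w) has_field_derivative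
      ((1 - s / z * q ^ j) * deriv g z + s / z\<^sup>2 * q ^ j * g z)) (at z)"
    by (rule DERIV_mult'[OF D1 Dg])
  from DERIV_imp_deriv[OF this, unfolded j] have "deriv (\<lambda>w. qpoch_inf q (s / w)) z = s / z\<^sup>2 * q ^ j * g z"
    unfolding eq by simp
  moreover have "g z \<noteq> 0"
  proof -
    have "s / z * q ^ Suc j = q" using j by (simp add: mult_ac)
    then have "qpoch_inf q (s / z * q ^ Suc j) \<noteq> 0" using qpoch_inf_nonzero[OF q_lt_1] by simp
    moreover have "qpoch q (s / z) j \<noteq> 0"
    proof
      assume "qpoch q (s / z) j = 0"
      then obtain i where i: "i < j" "s / z * q ^ i = 1" unfolding qpoch_eq_0_iff by blast
      have "j = i + (j - i)" using i by simp
      then have "q ^ j = q ^ i * q ^ (j - i)" by (metis power_add)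
      then have "s / z * q ^ i * q ^ (j - i) = 1" using j by (simp add: mult.assoc)
      then have "q ^ (j - i) = 1" unfolding i(2) by simp
      then show False using q_power_neq_1[of "j - i"] i by simp
    qed
    ultimately show ?thesis by (simp add: g_def)
  qed
  ultimately show ?thesis using s z by simp
qed

text \<open>
  In the product of the factors \<open>u - ud q\<^sup>j\<close> only \<open>u\<close> and \<open>ud\<close> matter, so the bound does not depend on the size of \<open>d\<close>.
\<close>

lemma norm_qpoch_times_power_le:
  assumes u: "norm u \<le> 1" and ud: "norm (u * d) \<le> B"
  shows "norm (qpoch q d n * u ^ n) \<le> exp (B / (1 - norm q))"
proof -
  have "qpoch q d n * u ^ n = (\<Prod>j<n. u - u * d * q ^ j)"
    by (induction n) (simp_all add: qpoch_Suc algebra_simps)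
  then have "norm (qpoch q d n * u ^ n) = (\<Prod>j<n. norm (u - u * d * q ^ j))"
    by (simp add: prod_norm)
  also have "\<dots> \<le> (\<Prod>j<n. 1 + B * norm q ^ j)"
  proof (intro prod_mono conjI norm_ge_zero)
    fix j
    have "norm (u - u * d * q ^ j) \<le> norm u + norm (u * d) * norm q ^ j"
      by (metis norm_mult norm_power norm_triangle_ineq4)
    also have "\<dots> \<le> 1 + B * norm q ^ j"
      using u ud by (intro add_mono mult_right_mono) auto
    finally show "norm (u - u * d * q ^ j) \<le> 1 + B * norm q ^ j" .
  qed
  also have "\<dots> \<le> exp (B / (1 - norm q))"
    using ud norm_ge_zero[of "u * d"] by (intro prod_one_plus_le) linarith
  finally show ?thesis .
qed

lemma norm_suminf_geometric_le:
  fixes t :: "nat \<Rightarrow> complex"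
  assumes "\<And>n. norm (t n) \<le> C * x ^ n" "0 \<le> x" "x < 1"
  shows "norm (\<Sum>n. t n) \<le> C / (1 - x)"
proof -
  have s: "(\<lambda>n. C * x ^ n) sums (C * (1 / (1 - x)))"
    using assms by (intro sums_mult geometric_sums) auto
  have "norm (\<Sum>n. t n) \<le> (\<Sum>n. C * x ^ n)"
    by (rule norm_suminf_le[OF assms(1)]) (use s in \<open>simp add: sums_iff\<close>)
  then show ?thesis using s by (simp add: sums_iff)
qed

text \<open>
  With \<open>d = 1/z\<close> on the circle of index \<open>M\<close>, the series side is bounded by a constant times
  \<open>|(s/z)\<^sub>\<infinity>|\<close>, and by \<open>qpoch_ratio_bound\<close> the two node sums are bounded by \<open>|q|\<^sup>-\<^sup>K\<^sup>M\<close> times it.  Since \<open>|z|\<close> is a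
  constant multiple of \<open>|q|\<^sup>M\<close>, the factor \<open>z\<^sup>K\<close> compensates this growth.
\<close>

lemma defect_circle_bound:
  assumes hol: "f holomorphic_on ball 0 R" "R > 1" and nz: "a \<noteq> 0" "b \<noteq> 0" "c \<noteq> 0"
    and \<kappa>: "\<kappa>\<^sup>2 = norm q" "0 < \<kappa>" "\<kappa> < 1"
  obtains C K where "\<And>M z. \<lbrakk>norm z = norm (b * c / a) / \<kappa> * norm q ^ M; norm z \<le> 1; norm (a * q / (b * c) * z) \<le> 1\<rbrakk>
     \<Longrightarrow> norm (z ^ K * defect f (vec4 a b c (1 / z))) \<le> C * norm (qpoch_inf q (b * c / a / z))"
proof -
  define s where "s = b * c / a"
  have s: "s \<noteq> 0" using nz by (simp add: s_def)
  obtain C2 K where C2: "C2 \<ge> 0" "\<And>M n d. norm (s * d) = \<kappa> * (1 / norm q) ^ M \<Longrightarrow>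
     norm (qpoch q d n) \<le> C2 * ((1 / norm q) ^ K) ^ M * norm (qpoch q (s * d) n)"
    using qpoch_ratio_bound[OF s \<kappa>] by blast
  define B where "B = 1 + norm a + norm b + norm c + norm (a * q / b) + norm (a * q / c) + norm (a * q / (b * c))"
  have nn: "0 \<le> norm a" "0 \<le> norm b" "0 \<le> norm c" "0 \<le> norm (a * q / b)" "0 \<le> norm (a * q / c)" "0 \<le> norm (a * q / (b * c))"
    by simp_all
  have B: "B \<ge> 1" "norm a \<le> B" "norm b \<le> B" "norm c \<le> B" "norm (a * q / b) \<le> B" "norm (a * q / c) \<le> B" "norm (a * q / (b * c)) \<le> B"
    using nn unfolding B_def by linarith+
  have B0: "B \<ge> 0" using B by simp
  define r where "r = (1 + R) / 2"
  have r: "1 < r" "r < R" using hol by (auto simp: r_def)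
  obtain CS where CS: "CS \<ge> 0" "\<And>a b c d n. norm a \<le> B \<and> norm b \<le> B \<and> norm c \<le> B \<and>
           norm (a * q / b) \<le> B \<and> norm (a * q / c) \<le> B \<and> norm (a * q / d) \<le> B \<Longrightarrow>
           norm (series_term f a b c d n) \<le> CS * (1 / r) ^ n * norm (qpoch q d n * (a * q / (b * c * d)) ^ n)"
    using series_term_bound[OF hol(1) r B0] by blast
  obtain C1 where C1: "C1 \<ge> 0" "\<And>a b c d n. norm a \<le> B \<and> norm b \<le> B \<and> norm c \<le> B \<and>
           norm (a * q / (b * c)) \<le> B \<and> norm (a * q / (b * d)) \<le> B \<and> norm (a * q / (c * d)) \<le> B \<Longrightarrow>
           norm (node1_term f a b c d n) \<le> C1 * norm q ^ n * norm (qpoch q d n * qpoch_inf q (b * c * d / a * q ^ n))"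
    using node1_term_bound[OF hol B(1)] by blast
  obtain CN where CN: "CN \<ge> 0" "\<And>a b c d n. norm a \<le> B \<and> norm b \<le> B \<and> norm c \<le> B \<and> norm (a * q / (b * c * d)) \<le> 1 \<and>
           norm (a * q / (b * c)) \<le> B \<and> norm (a * q / (b * d)) \<le> B \<and> norm (a * q / (c * d)) \<le> B \<Longrightarrow>
           norm (node2_term f a b c d n) \<le> CN * norm q ^ n * norm (a * q / (b * c * d) * qpoch_inf q d)"
    using node2_term_bound[OF hol B(1) B(1)] by blast
  define E where "E = exp (B / (1 - norm q))"
  have E: "E \<ge> 0" by (simp add: E_def)
  define W where "W = (norm s / \<kappa>) ^ K"
  have W: "W \<ge> 0" using \<kappa> by (simp add: W_def)
  define CT where "CT = CS * E / (1 - 1 / r) * (E * E) + E * ((C1 * C2 * W + CN * C2 * W) / (1 - norm q))"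
  show ?thesis
  proof (rule that[of K CT])
    fix M and z :: complex
    assume z: "norm z = norm (b * c / a) / \<kappa> * norm q ^ M" and z1: "norm z \<le> 1" and u1': "norm (a * q / (b * c) * z) \<le> 1"
    have nz_z: "z \<noteq> 0"
    proof
      assume "z = 0"
      then show False using z s \<kappa> by (simp add: s_def)
    qed
    define d where "d = 1 / z"
    have d: "d \<noteq> 0" using nz_z by (simp add: d_def)
    define u where "u = a * q / (b * c * d)"
    have u_eq: "u = a * q / (b * c) * z" by (simp add: u_def d_def)
    have u1: "norm u \<le> 1" using u1' by (simp add: u_eq)
    have sd: "norm (s * d) = \<kappa> * (1 / norm q) ^ M"
      using z \<kappa> s nz_z unfolding s_def[symmetric] by (simp add: d_def norm_divide power_one_over field_simps)
    \<comment> \<open>the growth factor \<open>|q|\<^sup>-\<^sup>K\<^sup>M\<close>, which \<open>|z|\<^sup>K\<close> turns into the constant \<open>W\<close>\<close>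
    define X where "X = ((1 / norm q) ^ K) ^ M"
    have X0: "X \<ge> 0" by (simp add: X_def)
    have zX: "norm z ^ K * X = W"
    proof -
      have "norm z ^ K * X = (norm s / \<kappa>) ^ K * ((norm q ^ M) ^ K * ((1 / norm q) ^ M) ^ K)"
        unfolding z X_def s_def[symmetric] by (simp add: power_mult_distrib mult.commute power_divide flip: power_mult)
      also have "(norm q ^ M) ^ K * ((1 / norm q) ^ M) ^ K = 1"
        using q_pos by (simp add: power_one_over flip: power_mult_distrib)
      finally show ?thesis by (simp add: W_def)
    qed
    define P where "P = qpoch_inf q (s * d)"
    \<comment> \<open>division by \<open>d\<close> is multiplication by \<open>z\<close>, and \<open>|z| \<le> 1\<close>\<close>
    have small: "norm (x * z) \<le> B" if "norm x \<le> B" for x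
      using mult_mono[OF that z1] B0 by (simp add: norm_mult)
    have m1: "norm (a * q / d) \<le> B"
      using small[OF norm_mult_q_power_le[OF B(2), of 1]] by (simp add: d_def)
    have m2: "norm (a * q / (b * d)) \<le> B" using small[OF B(5)] by (simp add: d_def)
    have m3: "norm (a * q / (c * d)) \<le> B" using small[OF B(6)] by (simp add: d_def)
    have ud: "u * d = a * q / (b * c)" using d by (simp add: u_def)
    have S: "norm (series_fun f (vec4 a b c d)) \<le> CS * E / (1 - 1 / r)"
      unfolding series_fun_def vec4_nth
    proof (rule norm_suminf_geometric_le)
      fix n
      have "norm (series_term f a b c d n) \<le> CS * (1 / r) ^ n * norm (qpoch q d n * (a * q / (b * c * d)) ^ n)"
        by (rule CS(2)) (use B m1 in auto)
      also have "\<dots> \<le> CS * (1 / r) ^ n * E"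
        using norm_qpoch_times_power_le[OF u1, of d B n] B(7) CS r unfolding ud
        by (intro mult_left_mono) (auto simp: u_def E_def)
      finally show "norm (series_term f a b c d n) \<le> CS * E * (1 / r) ^ n" by (simp add: mult_ac)
    qed (use r in auto)
    have bcda: "b * c * d / a = s * d" by (simp add: s_def)
    have N1: "norm (\<Sum>n. node1_term f a b c d n) \<le> C1 * C2 * X * norm P / (1 - norm q)"
    proof (rule norm_suminf_geometric_le)
      fix n
      have "norm (node1_term f a b c d n) \<le> C1 * norm q ^ n * norm (qpoch q d n * qpoch_inf q (b * c * d / a * q ^ n))"
        by (rule C1(2)) (use B m2 m3 in auto)
      also have "\<dots> \<le> C1 * norm q ^ n * (C2 * X * norm P)"
      proof (rule mult_left_mono)
        have "norm (qpoch q d n * qpoch_inf q (b * c * d / a * q ^ n))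
            \<le> (C2 * X * norm (qpoch q (s * d) n)) * norm (qpoch_inf q (s * d * q ^ n))"
          unfolding norm_mult bcda X_def by (intro mult_right_mono C2(2)[OF sd]) auto
        also have "\<dots> = C2 * X * norm P"
          unfolding P_def qpoch_inf_split[of "s * d" n] norm_mult by simp
        finally show "norm (qpoch q d n * qpoch_inf q (b * c * d / a * q ^ n)) \<le> C2 * X * norm P" .
      qed (use C1 in auto)
      finally show "norm (node1_term f a b c d n) \<le> C1 * C2 * X * norm P * norm q ^ n" by (simp add: mult_ac)
    qed (use q_lt_1 in auto)
    have dP: "norm (qpoch_inf q d) \<le> C2 * X * norm P"
    proof (rule LIMSEQ_le)
      show "(\<lambda>n. norm (qpoch q d n)) \<longlonglongrightarrow> norm (qpoch_inf q d)" by (intro tendsto_norm qpoch_tendsto)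
      show "(\<lambda>n. C2 * X * norm (qpoch q (s * d) n)) \<longlonglongrightarrow> C2 * X * norm P"
        unfolding P_def by (intro tendsto_intros qpoch_tendsto)
      show "\<exists>N. \<forall>n\<ge>N. norm (qpoch q d n) \<le> C2 * X * norm (qpoch q (s * d) n)"
        unfolding X_def using C2(2)[OF sd] by blast
    qed
    have N2: "norm (\<Sum>n. node2_term f a b c d n) \<le> CN * C2 * X * norm P / (1 - norm q)"
    proof (rule norm_suminf_geometric_le)
      fix n
      have "norm (node2_term f a b c d n) \<le> CN * norm q ^ n * norm (a * q / (b * c * d) * qpoch_inf q d)"
        by (rule CN(2)) (use B m2 m3 u1 in \<open>auto simp: u_def\<close>)
      also have "\<dots> \<le> CN * norm q ^ n * (1 * (C2 * X * norm P))"
        unfolding norm_mult[of _ "qpoch_inf q d"] using u1 dP CN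
        by (intro mult_left_mono mult_mono) (auto simp: u_def)
      finally show "norm (node2_term f a b c d n) \<le> CN * C2 * X * norm P * norm q ^ n" by (simp add: mult_ac)
    qed (use q_lt_1 in auto)
    have aE: "norm (qpoch_inf q a) \<le> E" unfolding E_def by (rule norm_qpoch_inf_le[OF B(2)])
    have uE: "norm (qpoch_inf q u) \<le> E" unfolding E_def by (rule norm_qpoch_inf_le) (use u1 B in simp)
    have qE: "norm (qpoch_inf q q) \<le> E" unfolding E_def by (rule norm_qpoch_inf_le) (use q_lt_1 B in simp)
    have part1: "norm (z ^ K * (series_fun f (vec4 a b c d) * (qpoch_inf q u * P * qpoch_inf q q)))
        \<le> CS * E / (1 - 1 / r) * (E * E) * norm P"
    proof -
      have "norm z ^ K * (norm (series_fun f (vec4 a b c d)) * (norm (qpoch_inf q u) * norm P * norm (qpoch_inf q q)))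
         \<le> 1 * ((CS * E / (1 - 1 / r)) * (E * norm P * E))"
        by (intro mult_mono S uE qE power_le_one z1 mult_nonneg_nonneg norm_ge_zero divide_nonneg_nonneg E CS zero_le_power)
           (use r in auto)
      then show ?thesis by (simp add: norm_mult norm_power mult_ac)
    qed
    have part2: "norm (z ^ K * nodes_fun f (vec4 a b c d)) \<le> E * ((C1 * C2 * W + CN * C2 * W) / (1 - norm q)) * norm P"
    proof -
      have "norm (nodes_fun f (vec4 a b c d)) \<le> E * (C1 * C2 * X * norm P / (1 - norm q) + CN * C2 * X * norm P / (1 - norm q))"
        unfolding nodes_fun_def vec4_nth norm_mult
        by (intro mult_mono aE order_trans[OF norm_triangle_ineq4] add_mono N1 N2 E norm_ge_zero)
      also have "\<dots> = X * (E * ((C1 * C2 + CN * C2) / (1 - norm q)) * norm P)"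
        by (simp add: add_divide_distrib algebra_simps)
      finally have "norm z ^ K * norm (nodes_fun f (vec4 a b c d)) \<le> norm z ^ K * (X * (E * ((C1 * C2 + CN * C2) / (1 - norm q)) * norm P))"
        by (rule mult_left_mono) simp
      also have "\<dots> = W * (E * ((C1 * C2 + CN * C2) / (1 - norm q)) * norm P)"
        unfolding zX[symmetric] by simp
      finally show ?thesis by (simp add: norm_mult norm_power algebra_simps)
    qed
    have "z ^ K * defect f (vec4 a b c d) =
       z ^ K * (series_fun f (vec4 a b c d) * (qpoch_inf q u * P * qpoch_inf q q)) - z ^ K * nodes_fun f (vec4 a b c d)"
      by (simp add: defect_def u_def P_def s_def algebra_simps)
    then have "norm (z ^ K * defect f (vec4 a b c d)) \<le>
       CS * E / (1 - 1 / r) * (E * E) * norm P + E * ((C1 * C2 * W + CN * C2 * W) / (1 - norm q)) * norm P"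
      using norm_triangle_ineq4 part1 part2 by (smt (verit, best))
    also have "\<dots> = CT * norm P" by (simp add: CT_def distrib_right)
    finally show "norm (z ^ K * defect f (vec4 a b c (1 / z))) \<le> CT * norm (qpoch_inf q (b * c / a / z))"
      by (simp add: P_def d_def s_def)
  qed
qed

end

section \<open>Vanishing of the defect\<close>

context q_in_disc begin

text \<open>
  The conditions on \<open>a\<close> keep \<open>defect_terminating\<close> applicable for every \<open>N\<close> and keep the points
  \<open>z = q\<^sup>N\<close> away from the zeros of \<open>(s/z)\<^sub>\<infinity>\<close>, so that the vanishing of the defect there passes to the quotient \<open>h\<close>.
\<close>

lemma defect_generic:
  fixes a b c d :: complex
  assumes hol: "f holomorphic_on ball 0 R" "R > 1" and p: "vec4 a b c d \<in> param_region q R"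
    and A: "\<And>j. a * q ^ Suc j \<noteq> 1"
    and B: "\<And>j. a * q / b * q ^ j \<noteq> 1" and C: "\<And>j. a * q / c * q ^ j \<noteq> 1"
    and BC: "\<And>N j. b * c / a / q ^ N * q ^ j \<noteq> 1"
  shows "defect f (vec4 a b c d) = 0"
proof -
  have nz: "a \<noteq> 0" "b \<noteq> 0" "c \<noteq> 0" "d \<noteq> 0" and uR: "norm (a * q / (b * c * d)) < R"
    using param_regionD[OF p] by simp_all
  define s where "s = b * c / a"
  have s: "s \<noteq> 0" using nz by (simp add: s_def)
  define v where "v = a * q / (b * c)"
  have v: "v \<noteq> 0" using nz by (simp add: v_def)
  define \<rho> where "\<rho> = R / norm v"
  have \<rho>: "\<rho> > 0" using hol v by (simp add: \<rho>_def)
  define \<kappa> where "\<kappa> = sqrt (norm q)"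
  have \<kappa>: "\<kappa>\<^sup>2 = norm q" "0 < \<kappa>" "\<kappa> < 1" using q_pos q_lt_1 by (simp_all add: \<kappa>_def)
  define D where "D = ball 0 \<rho> - {0::complex}"
  have opD: "open D" by (simp add: D_def open_delete)
  have inD: "vec4 a b c (1 / z) \<in> param_region q R" if "z \<in> D" for z
  proof -
    have "norm z * norm v < R" using that v by (simp add: D_def \<rho>_def field_simps)
    moreover have "a * q / (b * c * (1 / z)) = v * z" by (simp add: v_def)
    ultimately show ?thesis using that nz by (simp add: param_region_def D_def norm_mult mult.commute)
  qed
  define \<phi> where "\<phi> z = defect f (vec4 a b c (1 / z))" for z
  define P where "P z = qpoch_inf q (s / z)" for z
  have hol\<phi>: "\<phi> holomorphic_on D"
    unfolding \<phi>_def vec4_def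
  proof (rule sev_holomorphic_on_curve[OF defect_sev[OF hol] _ opD])
    show "(\<lambda>z. if i = 1 then a else if i = 2 then b else if i = 3 then c else 1 / z) holomorphic_on D" for i :: 4
      by (cases "i = 1"; cases "i = 2"; cases "i = 3") (auto simp: D_def intro!: holomorphic_intros)
    show "(\<chi> i. if i = 1 then a else if i = 2 then b else if i = 3 then c else 1 / z) \<in> param_region q R"
      if "z \<in> D" for z using inD[OF that] by (simp add: vec4_def)
  qed
  have holP: "P holomorphic_on D"
    unfolding P_def by (rule holomorphic_on_compose_gen[OF _ holomorphic_qpoch_inf, unfolded o_def])
      (auto simp: D_def intro!: holomorphic_intros)
  have zeros: "\<phi> z = 0 \<and> deriv P z \<noteq> 0" if z: "z \<in> D" and Pz: "P z = 0" for z
  proof -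
    have z0: "z \<noteq> 0" using z by (simp add: D_def)
    obtain j where j: "s / z * q ^ j = 1" using Pz unfolding P_def qpoch_inf_eq_0_iff by blast
    have "\<phi> z = 0" unfolding \<phi>_def
      by (rule defect_lattice[OF hol inD[OF z], of j]) (use j in \<open>simp add: s_def\<close>)
    moreover have "deriv P z \<noteq> 0"
      unfolding P_def[abs_def] by (rule deriv_qpoch_inf_reciprocal[OF s z0 j])
    ultimately show ?thesis ..
  qed
  obtain h where h: "h holomorphic_on D" "\<And>z. z \<in> D \<Longrightarrow> \<phi> z = P z * h z"
    using holomorphic_divide_simple_zeros[OF opD hol\<phi> holP zeros] by blast
  obtain K C' where circle: "\<And>M z. \<lbrakk>norm z = norm s / \<kappa> * norm q ^ M; norm z \<le> 1; norm (v * z) \<le> 1\<rbrakk>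
     \<Longrightarrow> norm (z ^ K * \<phi> z) \<le> C' * norm (P z)"
    using defect_circle_bound[OF hol nz(1-3) \<kappa>] unfolding s_def v_def \<phi>_def P_def by metis
  \<comment> \<open>circles of radius less than \<open>\<eta>\<close> satisfy the hypotheses of \<open>circle\<close> and lie in \<open>D\<close>\<close>
  define \<eta> where "\<eta> = min (min 1 (1 / norm v)) \<rho>"
  have \<eta>: "\<eta> > 0" using v \<rho> by (simp add: \<eta>_def)
  have lim: "(\<lambda>M. norm s / \<kappa> * norm q ^ M) \<longlonglongrightarrow> norm s / \<kappa> * 0"
    using q_lt_1 by (intro tendsto_intros LIMSEQ_power_zero) auto
  then have "\<forall>\<^sub>F M in sequentially. norm s / \<kappa> * norm q ^ M < \<eta>"
    using \<eta> by (intro order_tendstoD(2)[OF lim]) auto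
  then obtain M0 where M0: "\<And>M. M \<ge> M0 \<Longrightarrow> norm s / \<kappa> * norm q ^ M < \<eta>"
    unfolding eventually_sequentially by blast
  define t where "t m = norm s / \<kappa> * norm q ^ (m + M0)" for m
  have t: "0 < t m" "t m < \<eta>" for m using M0 s \<kappa> q_pos by (auto simp: t_def)
  have tlim: "t \<longlonglongrightarrow> 0"
    unfolding t_def using LIMSEQ_ignore_initial_segment[OF lim, of M0] by simp
  have h0: "h z = 0" if "z \<in> D" for z
  proof (rule holomorphic_punctured_eq_0[where h = h and t = t and x = "\<lambda>N. q ^ N" and K = K and C = C' and \<rho> = \<rho>])
    show "h holomorphic_on ball 0 \<rho> - {0}" "z \<in> ball 0 \<rho> - {0}" using h(1) that by (simp_all add: D_def)
    show "0 < t m" "t m < \<rho>" for m using t[of m] by (auto simp: \<eta>_def)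
    show "t \<longlonglongrightarrow> 0" by (rule tlim)
    show "(\<lambda>N. q ^ N) \<longlonglongrightarrow> 0" using q_lt_1 by (intro LIMSEQ_power_zero)
    show "q ^ N \<noteq> 0" for N by simp
    show "norm (w ^ K * h w) \<le> C'" if w: "norm w = t m" for m w
    proof -
      have tm: "t m \<le> 1" "t m \<le> 1 / norm v" "t m < \<rho>" using t[of m] by (auto simp: \<eta>_def)
      have w0: "w \<noteq> 0" using w t[of m] by auto
      have wD: "w \<in> D" using w tm w0 by (simp add: D_def)
      have "norm (v * w) \<le> 1" using tm(2) v w by (simp add: norm_mult field_simps)
      then have "norm (w ^ K * \<phi> w) \<le> C' * norm (P w)"
        using w tm by (intro circle[of w "m + M0"]) (simp_all add: t_def)
      then have "norm (w ^ K * h w) * norm (P w) \<le> C' * norm (P w)"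
        by (simp add: h(2)[OF wD] norm_mult mult_ac)
      \<comment> \<open>on the zeros \<open>|w|\<close> is \<open>|s|\<close> times an integral power of \<open>|q|\<close>, on the circles a half-integral one\<close>
      moreover have "P w \<noteq> 0"
      proof
        assume "P w = 0"
        then obtain j where "s / w * q ^ j = 1" unfolding P_def qpoch_inf_eq_0_iff by blast
        then have "norm (s / w * q ^ j) = 1" by simp
        then have "norm s * norm q ^ j = t m" using w w0 t[of m] by (simp add: norm_mult norm_divide norm_power field_simps)
        then have "norm q ^ j * \<kappa> = norm q ^ (m + M0)" using s \<kappa> by (simp add: t_def field_simps)
        then have "(norm q ^ j * \<kappa>)\<^sup>2 = (norm q ^ (m + M0))\<^sup>2" by simp
        then have "norm q ^ (2 * j + 1) = norm q ^ (2 * (m + M0))"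
          by (simp add: power_mult_distrib \<kappa>(1) mult.commute flip: power_mult)
        then have "2 * j + 1 = 2 * (m + M0)" using q_pos q_lt_1 by (subst (asm) power_inject_exp') auto
        then show False by presburger
      qed
      ultimately show ?thesis by simp
    qed
    show "h (q ^ N) = 0" if "q ^ N \<in> ball 0 \<rho>" for N
    proof -
      have qD: "q ^ N \<in> D" using that by (simp add: D_def)
      have "\<phi> (q ^ N) = 0" unfolding \<phi>_def
      proof (rule defect_terminating[OF nz(1-3) A])
        show "qpoch q (a * q / b) n \<noteq> 0" "qpoch q (a * q / c) n \<noteq> 0" for n
          using B C unfolding qpoch_eq_0_iff by blast+
        show "qpoch q (b * c / a / q ^ N) k \<noteq> 0" for k using BC unfolding qpoch_eq_0_iff by blast
      qed (simp add: divide_inverse)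
      moreover have "P (q ^ N) \<noteq> 0"
        unfolding P_def qpoch_inf_eq_0_iff s_def using BC by blast
      ultimately show ?thesis using h(2)[OF qD] by simp
    qed
  qed
  have "1 / d \<in> D"
  proof -
    have "norm v / norm d < R" using uR by (simp add: v_def norm_divide norm_mult)
    then show ?thesis using nz v by (simp add: D_def \<rho>_def norm_divide field_simps)
  qed
  from h(2)[OF this] h0[OF this] show ?thesis by (simp add: \<phi>_def)
qed

lemma vec4_surj: "p = vec4 (p $ 1) (p $ 2) (p $ 3) (p $ 4)"
  by (simp add: vec_eq_iff vec4_def forall_4)

text \<open>
  If the defect were nonzero at a point, it would be nonzero for all \<open>a\<close> in a disc, an uncountable set, whereas
  \<open>defect_generic\<close> covers all but countably many \<open>a\<close>.
\<close>

theorem defect_eq_0: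
  assumes hol: "f holomorphic_on ball 0 R" "R > 1" and p: "p \<in> param_region q R"
  shows "defect f p = 0"
proof (rule ccontr)
  assume ne: "defect f p \<noteq> 0"
  define a b c d where "a = p $ 1" and "b = p $ 2" and "c = p $ 3" and "d = p $ 4"
  have p_eq: "p = vec4 a b c d" unfolding a_def b_def c_def d_def by (rule vec4_surj)
  have nz: "a \<noteq> 0" "b \<noteq> 0" "c \<noteq> 0" "d \<noteq> 0" using param_regionD[OF p] by (simp_all add: p_eq)
  define U where "U = {x \<in> param_region q R. defect f x \<noteq> 0}"
  have "open U"
  proof -
    have "open (param_region q R \<inter> defect f -` (- {0}))"
      by (rule continuous_open_preimage[OF sev_holomorphic_on_imp_continuous_on[OF defect_sev[OF hol]] open_param_region]) auto
    moreover have "param_region q R \<inter> defect f -` (- {0}) = U" by (auto simp: U_def)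
    ultimately show ?thesis by simp
  qed
  define L where "L x = vec4 x b c d" for x
  have "continuous_on UNIV L" unfolding L_def vec4_def
  proof (intro continuous_on_vec_lambda)
    show "continuous_on UNIV (\<lambda>x. if i = 1 then x else if i = 2 then b else if i = 3 then c else d)" for i :: 4
      by (cases "i = 1") (auto intro!: continuous_intros)
  qed
  then have "open (L -` U)" using \<open>open U\<close> by (intro open_vimage) (auto simp: continuous_on_eq_continuous_at)
  moreover have "a \<in> L -` U" using p ne by (simp add: L_def U_def p_eq)
  ultimately obtain e where e: "e > 0" "ball a e \<subseteq> L -` U" by (meson open_contains_ball)
  define Bad where "Bad = insert 0 (range (\<lambda>j. inverse (q ^ Suc j)) \<union> range (\<lambda>j. b / (q * q ^ j)) \<union> range (\<lambda>j. c / (q * q ^ j))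
     \<union> range (\<lambda>(N, j). b * c / q ^ N * q ^ j))"
  have "countable Bad" unfolding Bad_def by (intro countable_insert countable_Un countable_image) auto
  moreover have "ball a e \<subseteq> Bad"
  proof
    fix x assume "x \<in> ball a e"
    then have x: "vec4 x b c d \<in> param_region q R" "defect f (vec4 x b c d) \<noteq> 0"
      using e(2) by (auto simp: L_def U_def)
    show "x \<in> Bad"
    proof (rule ccontr)
      assume nb: "x \<notin> Bad"
      then have x0: "x \<noteq> 0" by (simp add: Bad_def)
      have "defect f (vec4 x b c d) = 0"
      proof (rule defect_generic[OF hol x(1)])
        show "x * q ^ Suc j \<noteq> 1" for j
        proof
          assume "x * q ^ Suc j = 1"
          then have "x = inverse (q ^ Suc j)" by (metis inverse_unique mult.commute)
          then show False using nb unfolding Bad_def by blast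
        qed
        show "x * q / b * q ^ j \<noteq> 1" for j
        proof
          assume "x * q / b * q ^ j = 1"
          then have "x = b / (q * q ^ j)" using nz by (simp add: field_simps)
          then show False using nb unfolding Bad_def by blast
        qed
        show "x * q / c * q ^ j \<noteq> 1" for j
        proof
          assume "x * q / c * q ^ j = 1"
          then have "x = c / (q * q ^ j)" using nz by (simp add: field_simps)
          then show False using nb unfolding Bad_def by blast
        qed
        show "b * c / x / q ^ N * q ^ j \<noteq> 1" for N j
        proof
          assume "b * c / x / q ^ N * q ^ j = 1"
          then have "x = (\<lambda>(N, j). b * c / q ^ N * q ^ j) (N, j)" using x0 by (simp add: field_simps)
          then show False using nb unfolding Bad_def by blast
        qed
      qed
      then show False using x(2) by simp
    qed
  qed
  ultimately have "countable (ball a e)" by (rule countable_subset[rotated])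
  then show False using uncountable_ball[OF e(1)] by blast
qed

end

section \<open>Denominators and meromorphy\<close>

context q_in_disc begin

text \<open>
  The three factors of the common denominator: \<open>series_denom\<close> belongs to both sides, \<open>theta_denom\<close> to the prefactor of the
  right-hand side only, and \<open>node_denom\<close> to the integrand at the nodes, where it cancels against the
  numerator of the prefactor.
\<close>

definition series_denom where
  "series_denom a b c d = qpoch_inf q (a * q / b) * qpoch_inf q (a * q / c) * qpoch_inf q (a * q / d)"

definition theta_denom where
  "theta_denom a b c d = qpoch_inf q (a * q / (b * c * d)) * qpoch_inf q (b * c * d / a) * qpoch_inf q q"

definition node_denom where
  "node_denom a b c d = qpoch_inf q b * qpoch_inf q c * qpoch_inf q d
     * (qpoch_inf q (a * q / (b * c)) * qpoch_inf q (a * q / (b * d)) * qpoch_inf q (a * q / (c * d)))"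

lemma inner_sum_eq:
  "(\<Sum>k = 0..n. qpochs q [q powi (- int n), a * q ^ n] k / qpochs q [q] k * f (q ^ k) * q ^ k) = inner_sum f a n"
  by (simp add: inner_sum_def qpochs_def power_int_minus atLeast0AtMost)

lemma series_term_eq:
  assumes "series_denom a b c d \<noteq> 0"
  shows "lhs_term q f a b c d n = series_term f a b c d n / series_denom a b c d"
proof -
  have *: "qpoch_inf q (a * q / x) = qpoch q (a * q / x) n * qpoch_inf q (a * q / x * q ^ n)" for x
    by (rule qpoch_inf_split)
  have nz: "qpoch q (a * q / b) n \<noteq> 0" "qpoch_inf q (a * q / b * q ^ n) \<noteq> 0"
    "qpoch q (a * q / c) n \<noteq> 0" "qpoch_inf q (a * q / c * q ^ n) \<noteq> 0"
    "qpoch q (a * q / d) n \<noteq> 0" "qpoch_inf q (a * q / d * q ^ n) \<noteq> 0"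
    using assms unfolding series_denom_def *[of b] *[of c] *[of d] by auto
  have "L * (A * (B * (C * (D * 1)))) / (Q * (X1 * (X2 * (X3 * 1)))) * U * I =
      L * (A * B * C) / Q * (Y1 * Y2 * Y3) * I * (D * U) / (X1 * Y1 * (X2 * Y2) * (X3 * Y3))"
    if "Y1 \<noteq> 0" "Y2 \<noteq> 0" "Y3 \<noteq> 0" for L A B C D Q X1 X2 X3 U I Y1 Y2 Y3 :: complex
    using that by (simp add: divide_simps)
  note red = this[OF nz(2,4,6)]
  show ?thesis
    unfolding lhs_term_def inner_sum_eq series_term_def series_denom_def *[of b] *[of c] *[of d]
    unfolding qpochs_def list.map prod_list.Cons prod_list.Nil
    by (rule red)
qed

lemma jackson_term_eq:
  assumes nz: "a \<noteq> 0" "b \<noteq> 0" "c \<noteq> 0" "d \<noteq> 0" and E: "node_denom a b c d \<noteq> 0"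
  shows "jackson_term q (a * q / (b * c * d)) 1 (integrand q f a b c d) n
     = (node1_term f a b c d n - node2_term f a b c d n) / node_denom a b c d"
proof -
  define u where "u = a * q / (b * c * d)"
  have E': "qpoch_inf q b \<noteq> 0" "qpoch_inf q c \<noteq> 0" "qpoch_inf q d \<noteq> 0" "qpoch_inf q (a * q / (b * c)) \<noteq> 0"
    "qpoch_inf q (a * q / (b * d)) \<noteq> 0" "qpoch_inf q (a * q / (c * d)) \<noteq> 0"
    using E by (auto simp: node_denom_def)
  have inv: "1 / qpoch_inf q (x * q ^ n) = qpoch q x n / qpoch_inf q x" if "qpoch_inf q x \<noteq> 0" for x
    using qpoch_inf_split[of x n] that by (simp add: field_simps)
  have eu: "b * (u * q ^ n) = a * q / (c * d) * q ^ n" "c * (u * q ^ n) = a * q / (b * d) * q ^ n"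
      "d * (u * q ^ n) = a * q / (b * c) * q ^ n" "b * c * d * (u * q ^ n) / a = q * q ^ n" "u * q ^ n * q = u * (q * q ^ n)"
    using nz by (simp_all add: u_def)
  have e1: "b * c * d * q ^ n / a = b * c * d / a * q ^ n" "q ^ n * q = q * q ^ n"
    by simp_all
  have dv: "x / (y1 * (y2 * (y3 * 1))) = x * (1 / y1) * (1 / y2) * (1 / y3)" for x y1 y2 y3 :: complex by simp
  have 1: "q ^ n * integrand q f a b c d (q ^ n) = node1_term f a b c d n / node_denom a b c d"
    unfolding integrand_def qpochs_inf_def list.map prod_list.Cons prod_list.Nil dv e1 inv[OF E'(1)] inv[OF E'(2)] inv[OF E'(3)]
      node1_term_def node_denom_def
    using E' by (simp add: divide_simps)
  have 2: "u * q ^ n * integrand q f a b c d (u * q ^ n) = node2_term f a b c d n / node_denom a b c d"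
    unfolding integrand_def qpochs_inf_def list.map prod_list.Cons prod_list.Nil dv eu inv[OF E'(4)] inv[OF E'(5)] inv[OF E'(6)]
      node2_term_def node_denom_def u_def[symmetric]
    using E' by (simp add: divide_simps)
  show ?thesis
    unfolding jackson_term_def u_def[symmetric] using 1 2 by (simp add: diff_divide_distrib)
qed

lemma jackson_sums:
  assumes hol: "f holomorphic_on ball 0 R" "R > 1" and p: "vec4 a b c d \<in> param_region q R"
    and E: "node_denom a b c d \<noteq> 0"
  shows "jackson_term q (a * q / (b * c * d)) 1 (integrand q f a b c d) sums
     (((\<Sum>n. node1_term f a b c d n) - (\<Sum>n. node2_term f a b c d n)) / node_denom a b c d)"
proof -
  have nz: "a \<noteq> 0" "b \<noteq> 0" "c \<noteq> 0" "d \<noteq> 0" using param_regionD[OF p] by simp_all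
  have "summable (node1_term f a b c d)" "summable (node2_term f a b c d)"
    using param_summable(2,3)[OF hol p] by simp_all
  then show ?thesis
    unfolding jackson_term_eq[OF nz E] by (intro sums_divide sums_diff summable_sums)
qed

lemma rhs_eq:
  assumes hol: "f holomorphic_on ball 0 R" "R > 1" and p: "vec4 a b c d \<in> param_region q R"
    and E: "node_denom a b c d \<noteq> 0"
  shows "rhs q f a b c d = nodes_fun f (vec4 a b c d) / (series_denom a b c d * theta_denom a b c d)"
proof -
  have "rhs q f a b c d = (qpoch_inf q a * node_denom a b c d) / (series_denom a b c d * theta_denom a b c d)
      * (((\<Sum>n. node1_term f a b c d n) - (\<Sum>n. node2_term f a b c d n)) / node_denom a b c d)"
    unfolding rhs_def jackson_integral_def sums_unique[OF jackson_sums[OF assms], symmetric]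
    by (simp add: qpochs_inf_def node_denom_def series_denom_def theta_denom_def mult_ac)
  then show ?thesis using E by (simp add: nodes_fun_def)
qed

lemma lhs_sums:
  assumes hol: "f holomorphic_on ball 0 R" "R > 1" and p: "vec4 a b c d \<in> param_region q R"
    and H: "series_denom a b c d \<noteq> 0"
  shows "lhs_term q f a b c d sums (series_fun f (vec4 a b c d) / series_denom a b c d)"
proof -
  have "summable (series_term f a b c d)" using param_summable(1)[OF hol p] by simp
  then show ?thesis
    unfolding series_term_eq[OF H] series_fun_def vec4_nth by (intro sums_divide summable_sums)
qed

text \<open>
  The nodes \<open>t = 1\<close> and \<open>t = u\<close> yield \<open>node_denom\<close>, since \<open>bu = aq/(cd)\<close> and similarly for \<open>cu\<close> and \<open>du\<close>.
\<close>

lemma denominators_nonzeroD: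
  assumes "denominators_nonzero q a b c d"
  shows "a \<noteq> 0" "b \<noteq> 0" "c \<noteq> 0" "d \<noteq> 0" "series_denom a b c d \<noteq> 0" "theta_denom a b c d \<noteq> 0" "node_denom a b c d \<noteq> 0"
proof -
  show nz: "a \<noteq> 0" "b \<noteq> 0" "c \<noteq> 0" "d \<noteq> 0" using assms by (auto simp: denominators_nonzero_def)
  have "qpochs_inf q [a * q / b, a * q / c, a * q / d, a * q / (b * c * d), b * c * d / a, q] \<noteq> 0"
    using assms by (simp add: denominators_nonzero_def)
  then show "series_denom a b c d \<noteq> 0" "theta_denom a b c d \<noteq> 0"
    by (auto simp: qpochs_inf_def series_denom_def theta_denom_def)
  have n: "\<forall>t \<in> {q ^ 0, a * q / (b * c * d) * q ^ 0}. qpochs_inf q [b * t, c * t, d * t] \<noteq> 0"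
    using assms unfolding denominators_nonzero_def by blast
  have e: "b * (a * q / (b * c * d)) = a * q / (c * d)" "c * (a * q / (b * c * d)) = a * q / (b * d)"
    "d * (a * q / (b * c * d)) = a * q / (b * c)" using nz by simp_all
  have "qpochs_inf q [b, c, d] \<noteq> 0" using n by simp
  moreover have "qpochs_inf q [a * q / (c * d), a * q / (b * d), a * q / (b * c)] \<noteq> 0"
    using n unfolding e[symmetric] by simp
  ultimately show "node_denom a b c d \<noteq> 0" by (simp add: qpochs_inf_def node_denom_def)
qed

lemma countable_qpoch_inf_zeros:
  fixes g :: "real \<Rightarrow> complex"
  assumes "inj_on g {0<..}"
  shows "countable {t. t > 0 \<and> qpoch_inf q (g t) = 0}"
proof (rule countable_image_inj_on)
  have "g ` {t. t > 0 \<and> qpoch_inf q (g t) = 0} \<subseteq> range (\<lambda>j. inverse (q ^ j))"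
  proof safe
    fix t assume "qpoch_inf q (g t) = 0"
    then obtain j where "g t * q ^ j = 1" unfolding qpoch_inf_eq_0_iff by blast
    then have "g t = inverse (q ^ j)" by (metis inverse_unique mult.commute)
    then show "g t \<in> range (\<lambda>j. inverse (q ^ j))" by blast
  qed
  then show "countable (g ` {t. t > 0 \<and> qpoch_inf q (g t) = 0})"
    by (rule countable_subset) auto
  show "inj_on g {t. t > 0 \<and> qpoch_inf q (g t) = 0}" by (rule inj_on_subset[OF assms]) auto
qed

lemma inj_on_monomial:
  assumes "k \<noteq> 0" "j > 0"
  shows "inj_on (\<lambda>t. k * complex_of_real t ^ j) {0<..}"
proof (rule inj_onI)
  fix s t :: real assume st: "s \<in> {0<..}" "t \<in> {0<..}" and eq: "k * complex_of_real s ^ j = k * complex_of_real t ^ j"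
  have "complex_of_real (s ^ j) = complex_of_real (t ^ j)" using eq assms by simp
  then have "s ^ j = t ^ j" by (simp only: of_real_eq_iff)
  then show "s = t" using st assms power_eq_iff_eq_base[of j s t] by auto
qed

text \<open>
  The denominators are restricted to the curve \<open>t \<mapsto> (t\<^sup>4 a, t b, t c, t d)\<close>, \<open>t > 0\<close>.  The weights are chosen so that each
  relevant monomial is multiplied by a nonzero power of \<open>t\<close>; hence, apart from the nonzero constant \<open>(q)\<^sub>\<infinity>\<close>, each factor vanishes for at most countably many \<open>t\<close>.
\<close>

lemma denominators_not_identically_0:
  assumes U: "open U" "p \<in> U" "U \<subseteq> param_region q R"
  shows "\<exists>x\<in>U. series_denom (x $ 1) (x $ 2) (x $ 3) (x $ 4) * theta_denom (x $ 1) (x $ 2) (x $ 3) (x $ 4)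
     * node_denom (x $ 1) (x $ 2) (x $ 3) (x $ 4) \<noteq> 0"
proof (rule ccontr)
  assume *: "\<not> ?thesis"
  define a b c d where "a = p $ 1" and "b = p $ 2" and "c = p $ 3" and "d = p $ 4"
  have p_eq: "p = vec4 a b c d" unfolding a_def b_def c_def d_def by (rule vec4_surj)
  have "p \<in> param_region q R" using U by blast
  note nz = param_regionD(1-4)[OF this, unfolded a_def[symmetric] b_def[symmetric] c_def[symmetric] d_def[symmetric]]
  define \<gamma> where "\<gamma> t = vec4 (a * complex_of_real t ^ 4) (b * complex_of_real t) (c * complex_of_real t) (d * complex_of_real t)" for t
  have "continuous_on UNIV \<gamma>" unfolding \<gamma>_def vec4_def
  proof (intro continuous_on_vec_lambda)
    show "continuous_on UNIV (\<lambda>t. if i = 1 then a * complex_of_real t ^ 4 else if i = 2 then b * complex_of_real t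
        else if i = 3 then c * complex_of_real t else d * complex_of_real t)" for i :: 4
      by (cases "i = 1"; cases "i = 2"; cases "i = 3") (auto intro!: continuous_intros)
  qed
  then have "open (\<gamma> -` U)" using U(1) by (intro open_vimage) (auto simp: continuous_on_eq_continuous_at)
  moreover have "1 \<in> \<gamma> -` U" using U(2) by (simp add: \<gamma>_def p_eq)
  ultimately obtain e where e: "e > 0" "ball 1 e \<subseteq> \<gamma> -` U" by (meson open_contains_ball)
  define Z where "Z g = {t::real. t > 0 \<and> qpoch_inf q (g t) = 0}" for g :: "real \<Rightarrow> complex"
  define Bad where "Bad = (\<Union>k\<in>{a * q / b, a * q / c, a * q / d}. Z (\<lambda>t. k * complex_of_real t ^ 3))
      \<union> (\<Union>k\<in>{a * q / (b * c * d), b, c, d}. Z (\<lambda>t. k * complex_of_real t ^ 1))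
      \<union> (\<Union>k\<in>{a * q / (b * c), a * q / (b * d), a * q / (c * d)}. Z (\<lambda>t. k * complex_of_real t ^ 2))
      \<union> Z (\<lambda>t. b * c * d / a / complex_of_real t)"
  have Zc: "countable (Z (\<lambda>t. k * complex_of_real t ^ j))" if "k \<noteq> 0" "j > 0" for k j
    unfolding Z_def by (rule countable_qpoch_inf_zeros[OF inj_on_monomial[OF that]])
  have "inj_on (\<lambda>t. b * c * d / a / complex_of_real t) {0<..}"
    using nz by (auto simp: inj_on_def)
  then have "countable (Z (\<lambda>t. b * c * d / a / complex_of_real t))"
    unfolding Z_def by (rule countable_qpoch_inf_zeros)
  then have "countable Bad" unfolding Bad_def
    using nz by (intro countable_Un countable_UN Zc) (auto simp: countable_finite)
  moreover have "{1<..<1 + e} \<subseteq> Bad"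
  proof
    fix t assume t: "t \<in> {1<..<1 + e}"
    then have t0: "t > 0" "complex_of_real t \<noteq> 0" by auto
    have "t \<in> ball 1 e" using t by (simp add: dist_real_def)
    then have "\<gamma> t \<in> U" using e(2) by blast
    then have zero: "series_denom (\<gamma> t $ 1) (\<gamma> t $ 2) (\<gamma> t $ 3) (\<gamma> t $ 4) * theta_denom (\<gamma> t $ 1) (\<gamma> t $ 2) (\<gamma> t $ 3) (\<gamma> t $ 4)
     * node_denom (\<gamma> t $ 1) (\<gamma> t $ 2) (\<gamma> t $ 3) (\<gamma> t $ 4) = 0" using * by blast
    define T where "T = complex_of_real t"
    have T: "T \<noteq> 0" using t0 by (simp add: T_def)
    have e: "a * T ^ 4 * q / (b * T) = a * q / b * T ^ 3" "a * T ^ 4 * q / (c * T) = a * q / c * T ^ 3"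
      "a * T ^ 4 * q / (d * T) = a * q / d * T ^ 3"
      "a * T ^ 4 * q / (b * T * (c * T) * (d * T)) = a * q / (b * c * d) * T ^ 1"
      "b * T * (c * T) * (d * T) / (a * T ^ 4) = b * c * d / a / T"
      "a * T ^ 4 * q / (b * T * (c * T)) = a * q / (b * c) * T ^ 2"
      "a * T ^ 4 * q / (b * T * (d * T)) = a * q / (b * d) * T ^ 2"
      "a * T ^ 4 * q / (c * T * (d * T)) = a * q / (c * d) * T ^ 2"
      using T nz by (simp_all add: field_simps power2_eq_square power3_eq_cube power4_eq_xxxx)
    have "qpoch_inf q q \<noteq> 0" by (rule qpoch_inf_nonzero[OF q_lt_1])
    then show "t \<in> Bad"
      using zero t0(1)
      unfolding \<gamma>_def vec4_nth T_def[symmetric] series_denom_def theta_denom_def node_denom_def e Bad_def Z_def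
      by (auto simp: T_def)
  qed
  ultimately have "countable {1<..<1 + e}" by (rule countable_subset[rotated])
  then show False using uncountable_open_interval[of 1 "1 + e"] e(1) by simp
qed

end

theorem theorem5p3:
  fixes q :: complex and f :: "complex \<Rightarrow> complex" and R :: real
  assumes "0 < norm q" and "norm q < 1"
    and "R > 1" and "f holomorphic_on ball 0 R"
  shows "(\<forall>a b c d. denominators_nonzero q a b c d \<and> norm (a * q / (b * c * d)) < R \<longrightarrow>
            jackson_integrable q (a * q / (b * c * d)) 1 (integrand q f a b c d) \<and>
            lhs_term q f a b c d sums rhs q f a b c d)
       \<and> lhs_fun q f sev_meromorphic_on param_region q R
       \<and> rhs_fun q f sev_meromorphic_on param_region q R
       \<and> lhs_fun q f sev_holomorphic_on pole_free_region q R
       \<and> rhs_fun q f sev_holomorphic_on pole_free_region q R"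
proof -
  interpret q_in_disc q by unfold_locales (use assms in auto)
  note hol = assms(4,3)
  let ?PR = "param_region q R"
  define HS where "HS x = series_denom (x $ 1) (x $ 2) (x $ 3) (x $ 4)" for x :: "complex ^ 4"
  define HT where "HT x = theta_denom (x $ 1) (x $ 2) (x $ 3) (x $ 4)" for x :: "complex ^ 4"
  define HN where "HN x = node_denom (x $ 1) (x $ 2) (x $ 3) (x $ 4)" for x :: "complex ^ 4"
  have HS: "HS sev_holomorphic_on ?PR" unfolding HS_def[abs_def] series_denom_def
    by (intro sev_intros) (auto simp: param_region_def)
  have HT: "HT sev_holomorphic_on ?PR" unfolding HT_def[abs_def] theta_denom_def
    by (intro sev_intros) (auto simp: param_region_def)
  have HN: "HN sev_holomorphic_on ?PR" unfolding HN_def[abs_def] node_denom_def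
    by (intro sev_intros) (auto simp: param_region_def)
  have lhs: "lhs_fun q f x = series_fun f x / HS x" if "x \<in> ?PR" "HS x \<noteq> 0" for x
  proof -
    have "lhs_term q f (x $ 1) (x $ 2) (x $ 3) (x $ 4) sums (series_fun f x / HS x)"
      using lhs_sums[OF hol, of "x $ 1" "x $ 2" "x $ 3" "x $ 4"] that unfolding vec4_surj[symmetric] HS_def by blast
    then show ?thesis unfolding lhs_fun_def by (simp add: sums_iff)
  qed
  have rhs: "rhs_fun q f x = nodes_fun f x / (HS x * HT x)" if "x \<in> ?PR" "HN x \<noteq> 0" for x
    using rhs_eq[OF hol, of "x $ 1" "x $ 2" "x $ 3" "x $ 4"] that
    unfolding vec4_surj[symmetric] rhs_fun_def HS_def HT_def HN_def by blast
  have identity: "jackson_integrable q (a * q / (b * c * d)) 1 (integrand q f a b c d) \<and>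
            lhs_term q f a b c d sums rhs q f a b c d"
    if dn: "denominators_nonzero q a b c d" and u: "norm (a * q / (b * c * d)) < R" for a b c d
  proof
    note nz = denominators_nonzeroD[OF dn]
    have p: "vec4 a b c d \<in> ?PR" using nz u by (simp add: param_region_def)
    show "jackson_integrable q (a * q / (b * c * d)) 1 (integrand q f a b c d)"
      unfolding jackson_integrable_def using jackson_sums[OF hol p nz(7)] by (rule sums_summable)
    have "series_fun f (vec4 a b c d) * theta_denom a b c d = nodes_fun f (vec4 a b c d)"
      using defect_eq_0[OF hol p] by (simp add: defect_def theta_denom_def)
    then have "series_fun f (vec4 a b c d) / series_denom a b c d = rhs q f a b c d"
      unfolding rhs_eq[OF hol p nz(7)] using nz by (simp add: field_simps)
    then show "lhs_term q f a b c d sums rhs q f a b c d" using lhs_sums[OF hol p nz(5)] by simp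
  qed
  define W where "W = {x \<in> ?PR. HS x * HT x * HN x \<noteq> 0}"
  have "open W"
  proof -
    have "(\<lambda>x. HS x * HT x * HN x) sev_holomorphic_on ?PR" by (intro sev_intros HS HT HN)
    then have "open (?PR \<inter> (\<lambda>x. HS x * HT x * HN x) -` (- {0}))"
      by (intro continuous_open_preimage sev_holomorphic_on_imp_continuous_on open_param_region) auto
    moreover have "?PR \<inter> (\<lambda>x. HS x * HT x * HN x) -` (- {0}) = W" by (auto simp: W_def)
    ultimately show ?thesis by simp
  qed
  have WPR: "W \<subseteq> ?PR" by (auto simp: W_def)
  have pfW: "pole_free_region q R \<subseteq> W"
    unfolding W_def pole_free_region_def HS_def HT_def HN_def
    using denominators_nonzeroD by auto
  have "(\<lambda>x. series_fun f x / HS x) sev_holomorphic_on W"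
    by (intro sev_intros sev_holomorphic_on_subset[OF HS WPR] sev_holomorphic_on_subset[OF series_fun_sev[OF hol] WPR])
       (auto simp: W_def)
  then have "lhs_fun q f sev_holomorphic_on W"
    by (rule sev_holomorphic_on_transform) (use \<open>open W\<close> lhs in \<open>auto simp: W_def\<close>)
  then have 1: "lhs_fun q f sev_holomorphic_on pole_free_region q R"
    by (rule sev_holomorphic_on_subset[OF _ pfW])
  have "(\<lambda>x. nodes_fun f x / (HS x * HT x)) sev_holomorphic_on W"
    by (intro sev_intros sev_holomorphic_on_subset[OF HS WPR] sev_holomorphic_on_subset[OF HT WPR]
          sev_holomorphic_on_subset[OF nodes_fun_sev[OF hol] WPR])
       (auto simp: W_def)
  then have "rhs_fun q f sev_holomorphic_on W"
    by (rule sev_holomorphic_on_transform) (use \<open>open W\<close> rhs in \<open>auto simp: W_def\<close>)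
  then have 2: "rhs_fun q f sev_holomorphic_on pole_free_region q R"
    by (rule sev_holomorphic_on_subset[OF _ pfW])
  \<comment> \<open>global quotient representations serve as local ones; only the nonvanishing of the denominators is a local condition\<close>
  have mero: "F sev_meromorphic_on ?PR"
    if G: "G sev_holomorphic_on ?PR" and H: "H sev_holomorphic_on ?PR"
      and eq: "\<And>x. x \<in> ?PR \<Longrightarrow> H x \<noteq> 0 \<Longrightarrow> F x = G x / H x"
      and div: "\<And>x. HS x * HT x * HN x \<noteq> 0 \<Longrightarrow> H x \<noteq> 0" for F G H :: "complex ^ 4 \<Rightarrow> complex"
    unfolding sev_meromorphic_on_def
  proof
    fix p assume "p \<in> ?PR"
    then obtain e where e: "e > 0" "ball p e \<subseteq> ?PR" using open_param_region open_contains_ball by blast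
    obtain x where "x \<in> ball p e" "HS x * HT x * HN x \<noteq> 0"
      using denominators_not_identically_0[of "ball p e" p R] e unfolding HS_def HT_def HN_def by auto
    then have "\<exists>x\<in>ball p e. H x \<noteq> 0" using div by blast
    then show "\<exists>U G H. open U \<and> connected U \<and> p \<in> U \<and> U \<subseteq> ?PR \<and>
        G sev_holomorphic_on U \<and> H sev_holomorphic_on U \<and> (\<exists>x\<in>U. H x \<noteq> 0) \<and>
        (\<forall>x\<in>U. H x \<noteq> 0 \<longrightarrow> F x = G x / H x)"
      using e eq sev_holomorphic_on_subset[OF G e(2)] sev_holomorphic_on_subset[OF H e(2)]
      by (intro exI[of _ "ball p e"] exI[of _ G] exI[of _ H]) auto
  qed
  have 3: "lhs_fun q f sev_meromorphic_on ?PR"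
    by (rule mero[OF series_fun_sev[OF hol] HS]) (use lhs in auto)
  have 4: "rhs_fun q f sev_meromorphic_on ?PR"
  proof (rule mero)
    \<comment> \<open>the factor \<open>HN\<close> is inserted above and below, as the formula for the right-hand side requires \<open>HN x\<close> to be nonzero\<close>
    show "(\<lambda>x. nodes_fun f x * HN x) sev_holomorphic_on ?PR" by (intro sev_intros nodes_fun_sev hol HN)
    show "(\<lambda>x. HS x * HT x * HN x) sev_holomorphic_on ?PR" by (intro sev_intros HS HT HN)
  qed (use rhs in auto)
  show ?thesis using identity 1 2 3 4 by blast
qed

end
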